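(* Let $k,n$ be positive integers such that $k-2n$ is a positive multiple of $q-1$ and $n\le p^{v_p(k-n)}$. For each integer $l\ge0$ put \[ F_{k,n,l}:=\sum_{a\in A_+}a^{(k-n)q^l}G_n(t_a), \] an element of $S_{(k-n)q^l+n,\,m}(\mathrm{GL}_2(A))$ with $m\equiv n\pmod{q-1}$. Let $\nu_0=v_p(k-n)$ and let $\nu\ge0$ be an integer. If $\mathfrak{p}=(\wp)$ is a prime of $A$ of degree $d$ with $d>\log_q(n)$, then \[ F_{k,n,d+\nu}\equiv F_{k,n,\nu}\pmod{\mathfrak{p}^{\,q^\nu p^{\nu_0}}}. \]
   Context: Let $p$ be a prime, $q=p^e$, $A=\mathbb{F}_q[T]$, $A_+$ its monic elements, $K=\mathbb{F}_q(T)$, and $\mathbb{C}_\infty$ the completion of an algebraic closure of $\mathbb{F}_q((1/T))$. $v_p$ is the $p$-adic valuation on integers. Fix a Carlitz period $\widetilde{\pi}$ with Carlitz exponential $e_{\widetilde{\pi}A}(z)=z\prod_{0\neq\lambda\in\widetilde{\pi}A}(1-z/\lambda)$. Put $t(z)=1/e_{\widetilde{\pi}A}(\widetilde{\pi}z)$ and $t_a(z)=t(az)$, viewed as power series in $t$. $G_n(X)$ is the $n$-th Goss polynomial of the lattice $\widetilde{\pi}A$: $G_n(t(z))=\sum_{b\in A}(\widetilde{\pi}z+\widetilde{\pi}b)^{-n}$. $S_{k,m}(\mathrm{GL}_2(A))$ denotes the Drinfeld cusp forms of weight $k$ and type $m$: rigid analytic functions on $\mathbb{C}_\infty\setminus\mathbb{F}_q((1/T))$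 with $f(\gamma z)=(\det\gamma)^{-m}(cz+d)^kf(z)$ for $\gamma\in\mathrm{GL}_2(A)$, whose $t$-expansion has zero constant term. For two forms $F,G$ and an integer $N\ge0$, $F\equiv G\pmod{\mathfrak{p}^N}$ means that every coefficient of the $t$-expansion of $F-G$ lies in $\wp^N A_{(\mathfrak{p})}$, where $A_{(\mathfrak{p})}\subset K$ is the localization of $A$ at $\mathfrak{p}$. *)

theory Defs
  imports
    "HOL-Analysis.Analysis"
    "HOL-Computational_Algebra.Formal_Laurent_Series"
    "HOL-Number_Theory.Cong"
begin

text \<open>
  A field that is complete with respect to a multiplicative ultrametric absolute value.  The norm
  of the library is confined to \<^class>\<open>real_normed_vector\<close>, hence to characteristic zero; the
  absolute value is therefore carried by the metric, as the distance from zero.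
\<close>

class complete_nonarch_field = field + complete_space +
  assumes nonarch_dist_add: "dist (x + z) (y + z) = dist x y"
    and nonarch_dist_mult: "dist (x * y) 0 = dist x 0 * dist y 0"
    and nonarch_dist_max: "dist x y \<le> max (dist x z) (dist z y)"
begin

definition abs_val :: "'a \<Rightarrow> real" where
  "abs_val x = dist x 0"

subclass topological_monoid_add
proof
  fix a b :: 'a
  have dist_add: "dist (x + y) (a + b) \<le> dist x a + dist y b" for x y
  proof -
    have "dist (x + y) (a + y) = dist x a"
      by (rule nonarch_dist_add)
    moreover have "dist (a + y) (a + b) = dist y b"
      using nonarch_dist_add [of y a b] by (simp add: add.commute)
    ultimately show ?thesis
      using dist_triangle [of "x + y" "a + b" "a + y"] by simp
  qed
  show "((\<lambda>x. fst x + snd x) \<longlongrightarrow> a + b) (nhds a \<times>\<^sub>F nhds b)"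
    unfolding tendsto_iff
  proof (intro allI impI)
    fix e :: real
    assume "e > 0"
    then have half: "e / 2 > 0" by simp
    have "\<forall>\<^sub>F x in nhds c. dist x c < e / 2" for c
      using half eventually_nhds_metric by blast
    then have "\<forall>\<^sub>F p in nhds a \<times>\<^sub>F nhds b. dist (fst p) a < e / 2 \<and> dist (snd p) b < e / 2"
      unfolding eventually_prod_filter by fastforce
    then show "\<forall>\<^sub>F p in nhds a \<times>\<^sub>F nhds b. dist (fst p + snd p) (a + b) < e"
    proof eventually_elim
      case (elim p)
      then show ?case using dist_add [of "fst p" "snd p"] by linarith
    qed
  qed
qed

subclass topological_comm_monoid_add ..

end

text \<open>
  Conventions.  \<open>'f\<close> is the field with \<open>q = CARD('f)\<close> elements and \<open>A = 'f poly\<close>.  The field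
  \<open>'f fls\<close> of formal Laurent series is read as the field of Laurent series in \<open>1/T\<close>: its
  uniformizer \<open>fls_X\<close> is \<open>1/T\<close>, so \<open>T\<close> is \<open>fls_X_inv\<close>, and the absolute value normalized by
  \<open>|T| = q\<close> is \<open>q\<close> to the power minus the subdegree.

  The field of all elements of \<open>'c\<close>, together with the embedding \<open>\<iota>\<close> of \<open>'f fls\<close>, plays the role
  of the completion of an algebraic closure of the Laurent series field.
\<close>

definition algebraic_over :: "('f::field \<Rightarrow> 'c::field) \<Rightarrow> 'c \<Rightarrow> bool" where
  "algebraic_over \<iota> x \<longleftrightarrow> (\<exists>P. P \<noteq> 0 \<and> poly (map_poly \<iota> P) x = 0)"

text \<open>
  The elements algebraic over the Laurent series field form an algebraic closure of it, and they
  are dense in the complete field \<open>'c\<close>, whose absolute value extends that of the Laurent series.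
  This determines \<open>\<iota>\<close> up to isometric isomorphism.
\<close>

definition is_C_infinity :: "('f::{field,finite} fls \<Rightarrow> 'c::complete_nonarch_field) \<Rightarrow> bool" where
  "is_C_infinity \<iota> \<longleftrightarrow>
     \<iota> 1 = 1 \<and>
     (\<forall>x y. \<iota> (x + y) = \<iota> x + \<iota> y) \<and>
     (\<forall>x y. \<iota> (x * y) = \<iota> x * \<iota> y) \<and>
     (\<forall>x. x \<noteq> 0 \<longrightarrow> abs_val (\<iota> x) = real CARD('f) powi (- fls_subdegree x)) \<and>
     (\<forall>P. degree P > 0 \<and> (\<forall>i. algebraic_over \<iota> (coeff P i)) \<longrightarrow>
        (\<exists>x. algebraic_over \<iota> x \<and> poly P x = 0)) \<and>
     closure {x. algebraic_over \<iota> x} = UNIV"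

definition emb_A :: "('f::field fls \<Rightarrow> 'c) \<Rightarrow> 'f poly \<Rightarrow> 'c" where
  "emb_A \<iota> a = \<iota> (poly (map_poly fls_const a) fls_X_inv)"

definition upper_half_plane :: "('f::field fls \<Rightarrow> 'c) \<Rightarrow> 'c set" where
  "upper_half_plane \<iota> = UNIV - range \<iota>"

definition imaginary_abs :: "('f::field fls \<Rightarrow> 'c::metric_space) \<Rightarrow> 'c \<Rightarrow> real" where
  "imaginary_abs \<iota> z = infdist z (range \<iota>)"

text \<open>The infinite product is the limit of the net of finite partial products.\<close>

definition lattice_exp :: "'c::complete_nonarch_field set \<Rightarrow> 'c \<Rightarrow> 'c" where
  "lattice_exp \<Lambda> z =
     z * Lim (finite_subsets_at_top (\<Lambda> - {0})) (\<lambda>S. \<Prod>\<mu>\<in>S. 1 - z / \<mu>)"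

definition lattice_A :: "('f::field fls \<Rightarrow> 'c::field) \<Rightarrow> 'c \<Rightarrow> 'c set" where
  "lattice_A \<iota> \<omega> = range (\<lambda>a. \<omega> * emb_A \<iota> a)"

text \<open>
  A Carlitz period is a generator of a rank one lattice whose Drinfeld module is the Carlitz
  module, normalized by \<open>C\<^sub>T(X) = T X + X\<^sup>q\<close>.
\<close>

definition carlitz_period :: "('f::{field,finite} fls \<Rightarrow> 'c::complete_nonarch_field) \<Rightarrow> 'c \<Rightarrow> bool" where
  "carlitz_period \<iota> \<omega> \<longleftrightarrow>
     \<omega> \<noteq> 0 \<and>
     (\<forall>z. lattice_exp (lattice_A \<iota> \<omega>) (\<iota> fls_X_inv * z) =
          \<iota> fls_X_inv * lattice_exp (lattice_A \<iota> \<omega>) z + lattice_exp (lattice_A \<iota> \<omega>) z ^ CARD('f))"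

definition t_param :: "('f::field fls \<Rightarrow> 'c::complete_nonarch_field) \<Rightarrow> 'c \<Rightarrow> 'c \<Rightarrow> 'c" where
  "t_param \<iota> \<omega> z = 1 / lattice_exp (lattice_A \<iota> \<omega>) (\<omega> * z)"

definition goss_poly :: "('f::field fls \<Rightarrow> 'c::complete_nonarch_field) \<Rightarrow> 'c \<Rightarrow> nat \<Rightarrow> 'c poly" where
  "goss_poly \<iota> \<omega> n =
     (THE G. \<forall>z\<in>upper_half_plane \<iota>.
        poly G (t_param \<iota> \<omega> z) = (\<Sum>\<^sub>\<infinity>b\<in>UNIV. 1 / (\<omega> * z + \<omega> * emb_A \<iota> b) ^ n))"

text \<open>
  The sets \<open>|z| \<le> q\<^sup>N, |z|\<^sub>i \<ge> q\<^bsup>-N\<^esup>\<close> form the standard admissible covering of the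
  upper half plane by affinoids (each is a closed disc minus finitely many open discs).  The affinoid
  algebra of such a set is the uniform completion of the rational functions without poles in it.
\<close>

definition affinoid :: "('f::{field,finite} fls \<Rightarrow> 'c::complete_nonarch_field) \<Rightarrow> nat \<Rightarrow> 'c set" where
  "affinoid \<iota> N =
     {z. abs_val z \<le> real CARD('f) ^ N \<and> imaginary_abs \<iota> z \<ge> 1 / real CARD('f) ^ N}"

definition rigid_analytic ::
    "('f::{field,finite} fls \<Rightarrow> 'c::complete_nonarch_field) \<Rightarrow> ('c \<Rightarrow> 'c) \<Rightarrow> bool" where
  "rigid_analytic \<iota> f \<longleftrightarrow>
     (\<forall>N. \<forall>\<epsilon>>0. \<exists>P Q.
        (\<forall>z\<in>affinoid \<iota> N. poly Q z \<noteq> 0 \<and> abs_val (f z - poly P z / poly Q z) < \<epsilon>))"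

definition has_t_expansion ::
    "('f::field fls \<Rightarrow> 'c::complete_nonarch_field) \<Rightarrow> 'c \<Rightarrow> ('c \<Rightarrow> 'c) \<Rightarrow> 'c fps \<Rightarrow> bool" where
  "has_t_expansion \<iota> \<omega> f c \<longleftrightarrow>
     (\<exists>R>0. \<forall>z. imaginary_abs \<iota> z \<ge> R \<longrightarrow>
        (\<lambda>j. fps_nth c j * t_param \<iota> \<omega> z ^ j) sums f z)"

text \<open>
  Cusp forms of weight \<open>k\<close> and type \<open>m\<close>.  Only the values on the upper half plane matter.
  Invertibility of \<open>\<gamma>\<close> is over \<open>A\<close>, i.e. \<open>\<gamma>\<close> ranges over \<open>GL\<^sub>2(A)\<close>.
\<close>

definition cusp_forms ::
    "('f::{field,finite} fls \<Rightarrow> 'c::complete_nonarch_field) \<Rightarrow> 'c \<Rightarrow> nat \<Rightarrow> int \<Rightarrow> ('c \<Rightarrow> 'c) set" where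
  "cusp_forms \<iota> \<omega> k m =
     {f. rigid_analytic \<iota> f \<and>
         (\<forall>(\<gamma> :: 'f poly ^ 2 ^ 2) z. invertible \<gamma> \<longrightarrow> z \<in> upper_half_plane \<iota> \<longrightarrow>
            (let a = emb_A \<iota> (\<gamma> $ 1 $ 1); b = emb_A \<iota> (\<gamma> $ 1 $ 2);
                 c = emb_A \<iota> (\<gamma> $ 2 $ 1); d = emb_A \<iota> (\<gamma> $ 2 $ 2)
             in f ((a * z + b) / (c * z + d)) =
                  emb_A \<iota> (det \<gamma>) powi (- m) * (c * z + d) ^ k * f z)) \<and>
         (\<exists>c. has_t_expansion \<iota> \<omega> f c \<and> fps_nth c 0 = 0)}"

text \<open>The image in \<open>'c\<close> of \<open>wp\<^sup>N A\<^bsub>(\<pp>)\<^esub>\<close>, where \<open>\<pp> = (wp)\<close>.\<close>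

definition local_ideal_power ::
    "('f::field fls \<Rightarrow> 'c::field) \<Rightarrow> 'f poly \<Rightarrow> nat \<Rightarrow> 'c set" where
  "local_ideal_power \<iota> wp N = {emb_A \<iota> (wp ^ N * x) / emb_A \<iota> s | x s. \<not> wp dvd s}"

text \<open>
  The expansion of a function is unique, so that it makes no difference which \<open>c\<close> is taken.
\<close>

definition form_cong ::
    "('f::field fls \<Rightarrow> 'c::complete_nonarch_field) \<Rightarrow> 'c \<Rightarrow> 'f poly \<Rightarrow> nat \<Rightarrow>
     ('c \<Rightarrow> 'c) \<Rightarrow> ('c \<Rightarrow> 'c) \<Rightarrow> bool" where
  "form_cong \<iota> \<omega> wp N F G \<longleftrightarrow>
     (\<exists>c. has_t_expansion \<iota> \<omega> (\<lambda>z. F z - G z) c \<and>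
          (\<forall>j. fps_nth c j \<in> local_ideal_power \<iota> wp N))"

definition F_form ::
    "('f::{field,finite} fls \<Rightarrow> 'c::complete_nonarch_field) \<Rightarrow> 'c \<Rightarrow> nat \<Rightarrow> nat \<Rightarrow> nat \<Rightarrow> 'c \<Rightarrow> 'c" where
  "F_form \<iota> \<omega> k n l z =
     (\<Sum>\<^sub>\<infinity>a\<in>{a. lead_coeff a = 1}.
        emb_A \<iota> a ^ ((k - n) * CARD('f) ^ l) *
        poly (goss_poly \<iota> \<omega> n) (t_param \<iota> \<omega> (emb_A \<iota> a * z)))"

end

theory Submission
  imports Defs "HOL-Real_Asymp.Real_Asymp"
begin

text \<open>
  Put \<open>K = (k - n) q\<^sup>l\<close>. Up to a constant factor \<open>F\<close> is the double sum of \<open>a\<^sup>K / (a z + b)\<^sup>n\<close> over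
  \<open>a, b \<in> A\<close>, which converges when the summation over \<open>b\<close> is carried out first. Under \<open>z \<mapsto> -1/z\<close> the roles
  of \<open>a\<close> and \<open>b\<close> are exchanged, and since \<open>n \<le> p\<^sup>s\<close> for a power \<open>p\<^sup>s\<close> dividing \<open>K\<close>, the difference
  \<open>((a z)\<^sup>K - (-b)\<^sup>K) / (a z + b)\<^sup>n\<close> is a polynomial in \<open>a\<close>. Its sum over all \<open>a\<close> of degree less than \<open>D\<close>
  vanishes as soon as \<open>q\<^sup>D\<close> exceeds its degree by more than one, because by Lagrange interpolation a
  polynomial \<open>f\<close> of degree less than \<open>|V|\<close> sums over a finite additive subgroup \<open>V\<close> to a multiple of the
  coefficient of \<open>f\<close> at \<open>|V| - 1\<close>. The same vanishing makes the tails over \<open>b\<close> decay faster than any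
  exponential in \<open>D\<close>, so that finite boxes of pairs \<open>(a, b)\<close> compute \<open>F\<close> on both sides. Translations,
  constants and the inversion generate \<open>GL\<^sub>2(A)\<close> by the Euclidean algorithm.

  For the congruence, \<open>1 / t\<^sub>a\<close> is the Carlitz polynomial of \<open>a\<close> evaluated at \<open>1 / t\<close>, so that \<open>t\<^sub>a\<close> is a
  power series in \<open>t\<close> over \<open>A\<close>. The Goss polynomial involves only those coefficients of the Carlitz
  exponential whose denominators are products of \<open>T\<^bsup>q\<^sup>i\<^esup> - T\<close> with \<open>q\<^sup>i < n < q\<^sup>d\<close>, and these are prime to
  \<open>\<pp>\<close>. Finally \<open>a\<^bsup>q\<^sup>d\<^esup> - a\<close> is divisible by the generator of \<open>\<pp>\<close>, and raising to the power
  \<open>q\<^sup>\<nu> p\<^bsup>\<nu>\<^sub>0\<^esup>\<close> is additive.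
\<close>

section \<open>Nonarchimedean absolute values\<close>

text \<open>For fixed \<open>b\<close> the terms \<open>a^K / (a z + b)^n\<close> grow like
  \<open>|a|^(K - n)\<close>, so the family over all pairs has no unordered sum and the two
  summations cannot simply be interchanged. This is why both sides of the inversion are computed
  from one and the same finite set of pairs. The vanishing of power sums disposes of a column
  \<open>b\<close> only if \<open>|a z| < |b|\<close> for every \<open>a\<close> in the box, and the
  mirrored box has to satisfy the same condition for \<open>-1/z\<close>. For
  \<open>deg a < j + h\<close> and \<open>deg b < j + h'\<close> the two conditions together read
  \<open>q^(h' - h - 1) < |z| < q^(h' - h + 1)\<close>; the integer part of \<open>log_q |z|\<close>
  serves as \<open>h' - h\<close>. Functions of the lattice are reached through its finite subgroups
  of bounded degree. Additivity, partial fractions and the Goss recursion are exact polynomial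
  identities there, and they survive the limit because the exponentials of the subgroups converge
  both pointwise and coefficientwise.\<close>

lemma dist_eq_abs_val: "dist x y = abs_val (x - y)" for x y :: "'c::complete_nonarch_field"
  using nonarch_dist_add[of x "-y" y] by (simp add: abs_val_def)

lemma abs_val_zero [simp]: "abs_val (0::'c::complete_nonarch_field) = 0"
  by (simp add: abs_val_def)

lemma abs_val_eq_0_iff [simp]: "abs_val x = 0 \<longleftrightarrow> x = 0" for x :: "'c::complete_nonarch_field"
  by (simp add: abs_val_def)

lemma abs_val_nonneg [simp]: "0 \<le> abs_val x" for x :: "'c::complete_nonarch_field"
  by (simp add: abs_val_def)

lemma abs_val_pos_iff [simp]: "0 < abs_val x \<longleftrightarrow> x \<noteq> 0" for x :: "'c::complete_nonarch_field"
  by (simp add: abs_val_def)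

lemma abs_val_mult: "abs_val (x * y) = abs_val x * abs_val y" for x y :: "'c::complete_nonarch_field"
  by (simp add: abs_val_def nonarch_dist_mult)

lemma abs_val_one [simp]: "abs_val (1::'c::complete_nonarch_field) = 1"
  using abs_val_mult[of "1::'c" 1, symmetric] by simp

lemma abs_val_minus [simp]: "abs_val (- x) = abs_val x" for x :: "'c::complete_nonarch_field"
proof -
  have "abs_val (-1::'c) ^ 2 = 1"
    using abs_val_mult[of "-1::'c" "-1"] by (simp add: power2_eq_square)
  then have "abs_val (-1::'c) = 1"
    using abs_val_nonneg[of "-1::'c"] unfolding power2_eq_1_iff by linarith
  then show ?thesis using abs_val_mult[of "-1" x] by simp
qed

lemma abs_val_minus_commute: "abs_val (x - y) = abs_val (y - x)" for x y :: "'c::complete_nonarch_field"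
  by (metis abs_val_minus minus_diff_eq)

lemma abs_val_add_le_max: "abs_val (x + y) \<le> max (abs_val x) (abs_val y)"
  for x y :: "'c::complete_nonarch_field"
  using nonarch_dist_max[of "x + y" 0 y] by (simp add: dist_eq_abs_val)

lemma abs_val_add_le: "abs_val x \<le> B \<Longrightarrow> abs_val y \<le> B \<Longrightarrow> abs_val (x + y) \<le> B"
  for x y :: "'c::complete_nonarch_field"
  using abs_val_add_le_max[of x y] by simp

lemma abs_val_diff_le: "abs_val x \<le> B \<Longrightarrow> abs_val y \<le> B \<Longrightarrow> abs_val (x - y) \<le> B"
  for x y :: "'c::complete_nonarch_field"
  using abs_val_add_le[of x B "-y"] by simp

lemma abs_val_add_less: "abs_val x < B \<Longrightarrow> abs_val y < B \<Longrightarrow> abs_val (x + y) < B"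
  for x y :: "'c::complete_nonarch_field"
  using abs_val_add_le_max[of x y] by simp

lemma abs_val_diff_less: "abs_val x < B \<Longrightarrow> abs_val y < B \<Longrightarrow> abs_val (x - y) < B"
  for x y :: "'c::complete_nonarch_field"
  using abs_val_add_less[of x B "-y"] by simp

lemma abs_val_add_eq_left: "abs_val y < abs_val x \<Longrightarrow> abs_val (x + y) = abs_val x"
  for x y :: "'c::complete_nonarch_field"
  using abs_val_add_le_max[of x y] abs_val_add_le_max[of "x + y" "-y"] by simp

lemma abs_val_diff_eq_left: "abs_val y < abs_val x \<Longrightarrow> abs_val (x - y) = abs_val x"
  for x y :: "'c::complete_nonarch_field"
  using abs_val_add_eq_left[of "-y" x] by simp

lemma abs_val_diff_eq_right: "abs_val x < abs_val y \<Longrightarrow> abs_val (x - y) = abs_val y"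
  for x y :: "'c::complete_nonarch_field"
  using abs_val_diff_eq_left[of x y] abs_val_minus_commute[of x y] by simp

lemma abs_val_power: "abs_val (x ^ n) = abs_val x ^ n" for x :: "'c::complete_nonarch_field"
  by (induction n) (simp_all add: abs_val_mult)

lemma abs_val_inverse: "abs_val (inverse x) = inverse (abs_val x)" for x :: "'c::complete_nonarch_field"
proof (cases "x = 0")
  case False
  then have "abs_val x * abs_val (inverse x) = 1"
    by (simp flip: abs_val_mult)
  then show ?thesis by (metis inverse_unique)
qed simp

lemma abs_val_divide: "abs_val (x / y) = abs_val x / abs_val y" for x y :: "'c::complete_nonarch_field"
  by (simp add: divide_inverse abs_val_mult abs_val_inverse)

lemma abs_val_prod: "abs_val (\<Prod>i\<in>S. f i) = (\<Prod>i\<in>S. abs_val (f i))"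
  for f :: "'i \<Rightarrow> 'c::complete_nonarch_field"
  by (induction S rule: infinite_finite_induct) (simp_all add: abs_val_mult)

lemma abs_val_sum_le:
  fixes f :: "'i \<Rightarrow> 'c::complete_nonarch_field"
  assumes "0 \<le> B" "\<And>i. i \<in> S \<Longrightarrow> abs_val (f i) \<le> B"
  shows "abs_val (\<Sum>i\<in>S. f i) \<le> B"
  using assms by (induction S rule: infinite_finite_induct) (simp_all add: abs_val_add_le)

lemma abs_val_prod_one_plus_minus_one_le:
  fixes f :: "'i \<Rightarrow> 'c::complete_nonarch_field"
  assumes "0 \<le> B" "B \<le> 1" "\<And>i. i \<in> S \<Longrightarrow> abs_val (f i) \<le> B"
  shows "abs_val ((\<Prod>i\<in>S. 1 + f i) - 1) \<le> B"
  using assms(3)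
proof (induction S rule: infinite_finite_induct)
  case (insert i S)
  let ?P = "\<Prod>j\<in>S. 1 + f j"
  have "abs_val (f i) * abs_val ((?P - 1) + 1) \<le> B * 1"
    using assms insert by (intro mult_mono abs_val_add_le) force+
  then have "abs_val ((?P - 1) + f i * ((?P - 1) + 1)) \<le> B"
    using insert by (intro abs_val_add_le) (simp_all add: abs_val_mult)
  then show ?case using insert by (simp add: algebra_simps)
qed (use assms in auto)

text \<open>By the splitting \<open>u^(n+1) - v^(n+1) = (u - v) u^n + v (u^n - v^n)\<close>, powers
  do not expand distances on the closed unit disc.\<close>

lemma abs_val_power_diff_le:
  fixes u v :: "'c::complete_nonarch_field"
  assumes "abs_val u \<le> 1" "abs_val v \<le> 1"
  shows "abs_val (u ^ n - v ^ n) \<le> abs_val (u - v)"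
proof (induction n)
  case (Suc n)
  have "abs_val (u ^ Suc n - v ^ Suc n) = abs_val ((u - v) * u ^ n + v * (u ^ n - v ^ n))"
    by (simp add: algebra_simps)
  also have "\<dots> \<le> abs_val (u - v)"
  proof (intro abs_val_add_le)
    show "abs_val ((u - v) * u ^ n) \<le> abs_val (u - v)"
      using assms by (simp add: abs_val_mult abs_val_power mult_left_le power_le_one)
    show "abs_val (v * (u ^ n - v ^ n)) \<le> abs_val (u - v)"
      using assms Suc mult_mono[of "abs_val v" 1 "abs_val (u ^ n - v ^ n)" "abs_val (u - v)"]
      by (simp add: abs_val_mult)
  qed
  finally show ?case .
qed simp

section \<open>Limits with respect to the absolute value\<close>

lemma tendsto_abs_val_iff:
  fixes f :: "'i \<Rightarrow> 'c::complete_nonarch_field"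
  shows "(f \<longlongrightarrow> l) F \<longleftrightarrow> ((\<lambda>i. abs_val (f i - l)) \<longlongrightarrow> 0) F"
  unfolding tendsto_dist_iff[of f] dist_eq_abs_val ..

lemma tendsto_abs_val:
  fixes f :: "'i \<Rightarrow> 'c::complete_nonarch_field"
  assumes "(f \<longlongrightarrow> l) F"
  shows "((\<lambda>i. abs_val (f i)) \<longlongrightarrow> abs_val l) F"
  unfolding abs_val_def by (intro tendsto_intros assms)

lemma tendsto_uminus_nonarch:
  fixes f :: "'i \<Rightarrow> 'c::complete_nonarch_field"
  assumes "(f \<longlongrightarrow> l) F"
  shows "((\<lambda>i. - f i) \<longlongrightarrow> - l) F"
proof -
  have "abs_val (- f i + l) = abs_val (f i - l)" for i
    using abs_val_minus[of "f i - l"] by simp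
  then show ?thesis using assms unfolding tendsto_abs_val_iff[of f] tendsto_abs_val_iff[of "\<lambda>i. - f i"] by simp
qed

lemma tendsto_diff_nonarch:
  fixes f :: "'i \<Rightarrow> 'c::complete_nonarch_field"
  assumes "(f \<longlongrightarrow> l) F" "(g \<longlongrightarrow> m) F"
  shows "((\<lambda>i. f i - g i) \<longlongrightarrow> l - m) F"
  using tendsto_add[OF assms(1) tendsto_uminus_nonarch[OF assms(2)]] by simp

lemma tendsto_mult_nonarch:
  fixes f :: "'i \<Rightarrow> 'c::complete_nonarch_field"
  assumes "(f \<longlongrightarrow> l) F" "(g \<longlongrightarrow> m) F"
  shows "((\<lambda>i. f i * g i) \<longlongrightarrow> l * m) F"
proof -
  have "((\<lambda>i. abs_val (f i - l) * abs_val (g i) + abs_val l * abs_val (g i - m)) \<longlongrightarrow>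
      0 * abs_val m + abs_val l * 0) F"
    using assms tendsto_abs_val[OF assms(2)] unfolding tendsto_abs_val_iff[of f] tendsto_abs_val_iff[of g]
    by (intro tendsto_intros)
  then have lim: "((\<lambda>i. abs_val (f i - l) * abs_val (g i) + abs_val l * abs_val (g i - m)) \<longlongrightarrow> 0) F"
    by simp
  show ?thesis
    unfolding tendsto_abs_val_iff[of "\<lambda>i. f i * g i"]
  proof (rule tendsto_sandwich[OF _ _ tendsto_const lim])
    show "\<forall>\<^sub>F i in F. abs_val (f i * g i - l * m)
        \<le> abs_val (f i - l) * abs_val (g i) + abs_val l * abs_val (g i - m)"
    proof (intro always_eventually allI)
      fix i
      have eq: "(f i - l) * g i + l * (g i - m) = f i * g i - l * m"
        by (simp add: algebra_simps)
      have "abs_val ((f i - l) * g i + l * (g i - m))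
          \<le> abs_val ((f i - l) * g i) + abs_val (l * (g i - m))"
        using abs_val_add_le_max[of "(f i - l) * g i" "l * (g i - m)"]
          abs_val_nonneg[of "(f i - l) * g i"] abs_val_nonneg[of "l * (g i - m)"] by linarith
      then show "abs_val (f i * g i - l * m)
          \<le> abs_val (f i - l) * abs_val (g i) + abs_val l * abs_val (g i - m)"
        unfolding eq abs_val_mult .
    qed
  qed auto
qed

lemma tendsto_power_nonarch:
  fixes f :: "'i \<Rightarrow> 'c::complete_nonarch_field"
  assumes "(f \<longlongrightarrow> l) F"
  shows "((\<lambda>i. f i ^ n) \<longlongrightarrow> l ^ n) F"
  by (induction n) (simp_all add: assms tendsto_mult_nonarch)

text \<open>As soon as \<open>|f i - l| < |l|\<close> one has \<open>|f i| = |l|\<close>, so the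
  error of the inverse is exactly \<open>|f i - l| / |l|^2\<close>.\<close>

lemma tendsto_inverse_nonarch:
  fixes f :: "'i \<Rightarrow> 'c::complete_nonarch_field"
  assumes "(f \<longlongrightarrow> l) F" "l \<noteq> 0"
  shows "((\<lambda>i. inverse (f i)) \<longlongrightarrow> inverse l) F"
proof -
  have "\<forall>\<^sub>F i in F. abs_val (f i - l) < abs_val l"
    using assms unfolding tendsto_abs_val_iff[of f] by (intro order_tendstoD(2)) auto
  then have eq: "\<forall>\<^sub>F i in F. abs_val (f i - l) / (abs_val l * abs_val l) = abs_val (inverse (f i) - inverse l)"
  proof eventually_elim
    case (elim i)
    have *: "abs_val (f i) = abs_val l"
      using abs_val_add_eq_left[OF elim] by simp
    then have "f i \<noteq> 0" using assms(2) by auto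
    then have "inverse (f i) - inverse l = (l - f i) / (f i * l)"
      using assms(2) by (simp add: field_simps)
    then show ?case
      using * abs_val_minus_commute[of l "f i"] by (simp add: abs_val_divide abs_val_mult)
  qed
  have "((\<lambda>i. abs_val (f i - l) / (abs_val l * abs_val l)) \<longlongrightarrow> 0 / (abs_val l * abs_val l)) F"
    using assms unfolding tendsto_abs_val_iff[of f] by (intro tendsto_intros) auto
  then show ?thesis
    unfolding tendsto_abs_val_iff[of "\<lambda>i. inverse (f i)"] using Lim_transform_eventually[OF _ eq] by simp
qed

lemma abs_val_limit_le:
  fixes f :: "'i \<Rightarrow> 'c::complete_nonarch_field"
  assumes "(f \<longlongrightarrow> l) F" "F \<noteq> bot" "\<forall>\<^sub>F i in F. abs_val (f i) \<le> B"
  shows "abs_val l \<le> B"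
  using tendsto_upperbound[OF tendsto_abs_val[OF assms(1)] assms(3,2)] .

text \<open>Two late indices are compared through a common earlier one. The ultrametric inequality
  takes the maximum of the two errors, so \<open>B\<close> only has to tend to zero and need not be
  summable.\<close>

lemma Cauchy_if_abs_val_diff_le:
  fixes f :: "nat \<Rightarrow> 'c::complete_nonarch_field"
  assumes "\<And>m n. m \<le> n \<Longrightarrow> abs_val (f n - f m) \<le> B m" "B \<longlonglongrightarrow> 0"
  shows "convergent f"
proof -
  have "Cauchy f"
  proof (rule metric_CauchyI)
    fix e :: real assume "e > 0"
    then have "\<forall>\<^sub>F m in sequentially. B m < e"
      using assms(2) by (intro order_tendstoD(2)) auto
    then obtain M where M: "\<And>m. m \<ge> M \<Longrightarrow> B m < e"
      by (auto simp: eventually_at_top_linorder)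
    have "dist (f m) (f n) < e" if "m \<ge> M" "n \<ge> M" for m n
    proof -
      have "abs_val ((f m - f M) - (f n - f M)) < e"
        using assms(1)[of M m] assms(1)[of M n] M[of M] that
        by (intro abs_val_diff_less[of "f m - f M" e "f n - f M"]) linarith+
      then show ?thesis by (simp add: dist_eq_abs_val)
    qed
    then show "\<exists>M. \<forall>m\<ge>M. \<forall>n\<ge>M. dist (f m) (f n) < e" by blast
  qed
  then show ?thesis by (simp add: Cauchy_convergent_iff)
qed

section \<open>Unordered sums and products over families tending to zero\<close>

definition null_family :: "('i \<Rightarrow> 'c::complete_nonarch_field) \<Rightarrow> 'i set \<Rightarrow> bool" where
  "null_family f A \<longleftrightarrow> (\<forall>\<epsilon>>0. finite {i\<in>A. abs_val (f i) \<ge> \<epsilon>})"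

text \<open>The common core for sums and products: \<open>\<Phi>\<close> will be the finite sum of
  \<open>f\<close> or the finite product of \<open>1 + f\<close>. Along the sets of indices with
  \<open>|f| >= 1/(m+1)\<close> the values form a Cauchy sequence, and its limit is the limit of the
  whole net. The constant \<open>B\<close> makes room for a product whose finitely many large
  factors magnify later errors.\<close>

lemma null_family_net_tendsto:
  fixes f :: "'i \<Rightarrow> 'c::complete_nonarch_field" and \<Phi> :: "'i set \<Rightarrow> 'c"
  assumes "null_family f A"
    and diff: "\<And>S S' \<epsilon>. finite S \<Longrightarrow> S' \<subseteq> A \<Longrightarrow> finite S' \<Longrightarrow> S \<subseteq> S' \<Longrightarrow> 0 < \<epsilon> \<Longrightarrow> \<epsilon> \<le> 1 \<Longrightarrow>
      {i\<in>A. abs_val (f i) \<ge> \<epsilon>} \<subseteq> S \<Longrightarrow> abs_val (\<Phi> S' - \<Phi> S) \<le> B * \<epsilon>"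
  shows "\<exists>l. (\<Phi> \<longlongrightarrow> l) (finite_subsets_at_top A)"
proof -
  define e where "e m = 1 / real (Suc m)" for m
  define S where "S m = {i\<in>A. abs_val (f i) \<ge> e m}" for m
  have e: "e m > 0" "e m \<le> 1" for m by (auto simp: e_def)
  have fin: "finite (S m)" for m
    using assms(1) e unfolding null_family_def S_def by blast
  have mono: "S m \<subseteq> S n" if "m \<le> n" for m n
  proof -
    have "e n \<le> e m" using that by (simp add: e_def field_simps)
    then show ?thesis by (auto simp: S_def)
  qed
  have elim: "(\<lambda>m. B * e m) \<longlonglongrightarrow> 0"
    unfolding e_def using tendsto_mult_right_zero[OF LIMSEQ_Suc[OF lim_inverse_n]]
    by (simp add: inverse_eq_divide)
  have est: "abs_val (\<Phi> S' - \<Phi> (S m)) \<le> B * e m" if "S' \<subseteq> A" "finite S'" "S m \<subseteq> S'" for S' m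
    using diff[OF fin that e] by (simp add: S_def)
  have "convergent (\<lambda>m. \<Phi> (S m))"
    by (rule Cauchy_if_abs_val_diff_le[OF est elim]) (auto simp: S_def fin[unfolded S_def] mono[unfolded S_def])
  then obtain l where l: "(\<lambda>m. \<Phi> (S m)) \<longlonglongrightarrow> l" by (auto simp: convergent_def)
  have "(\<Phi> \<longlongrightarrow> l) (finite_subsets_at_top A)"
    unfolding tendsto_iff
  proof (intro allI impI)
    fix \<epsilon> :: real assume "\<epsilon> > 0"
    then have "\<forall>\<^sub>F m in sequentially. B * e m < \<epsilon> \<and> dist (\<Phi> (S m)) l < \<epsilon>"
      using elim l by (intro eventually_conj order_tendstoD(2)[of _ 0] tendstoD) auto
    then obtain m where m: "B * e m < \<epsilon>" "dist (\<Phi> (S m)) l < \<epsilon>"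
      by (auto simp: eventually_at_top_linorder)
    have "dist (\<Phi> S') l < \<epsilon>" if "S' \<subseteq> A" "finite S'" "S m \<subseteq> S'" for S'
      using abs_val_add_less[of "\<Phi> S' - \<Phi> (S m)" \<epsilon> "\<Phi> (S m) - l"] est[OF that] m
      by (simp add: dist_eq_abs_val)
    then show "\<forall>\<^sub>F S' in finite_subsets_at_top A. dist (\<Phi> S') l < \<epsilon>"
      unfolding eventually_finite_subsets_at_top using fin by (intro exI[of _ "S m"]) (auto simp: S_def)
  qed
  then show ?thesis by blast
qed

lemma null_family_summable:
  fixes f :: "'i \<Rightarrow> 'c::complete_nonarch_field"
  assumes "null_family f A"
  shows "f summable_on A"
proof -
  have "\<exists>l. (sum f \<longlongrightarrow> l) (finite_subsets_at_top A)"
  proof (rule null_family_net_tendsto[OF assms, where B = 1])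
    fix S S' :: "'i set" and \<epsilon> :: real
    assume *: "finite S" "S' \<subseteq> A" "finite S'" "S \<subseteq> S'" "0 < \<epsilon>" "{i\<in>A. abs_val (f i) \<ge> \<epsilon>} \<subseteq> S"
    then have "sum f S' - sum f S = sum f (S' - S)"
      by (simp add: sum_diff)
    also have "abs_val \<dots> \<le> \<epsilon>"
      by (rule abs_val_sum_le) (use * in force)+
    finally show "abs_val (sum f S' - sum f S) \<le> 1 * \<epsilon>" by simp
  qed
  then show ?thesis by (simp add: summable_on_def has_sum_def)
qed

lemma null_family_prod_convergent:
  fixes f :: "'i \<Rightarrow> 'c::complete_nonarch_field"
  assumes "null_family f A"
  shows "\<exists>l. ((\<lambda>S. \<Prod>i\<in>S. 1 + f i) \<longlongrightarrow> l) (finite_subsets_at_top A)"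
proof -
  \<comment> \<open>Only the factors with index in \<open>S1\<close> can exceed 1 in absolute value,
    so \<open>B\<close> bounds every finite product that contains them.\<close>
  define S1 where "S1 = {i\<in>A. abs_val (f i) \<ge> 1}"
  define B where "B = abs_val (\<Prod>i\<in>S1. 1 + f i)"
  have fin1: "finite S1" using assms by (auto simp: S1_def null_family_def)
  have le_B: "abs_val (\<Prod>i\<in>S. 1 + f i) \<le> B" if "finite S" "S1 \<subseteq> S" "S \<subseteq> A" for S
  proof -
    have "abs_val (\<Prod>i\<in>S - S1. 1 + f i) \<le> 1"
      unfolding abs_val_prod using that
      by (intro prod_le_1) (auto simp: S1_def not_le intro!: abs_val_add_le)
    then have "abs_val (\<Prod>i\<in>S1. 1 + f i) * abs_val (\<Prod>i\<in>S - S1. 1 + f i) \<le> B"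
      by (simp add: B_def mult_left_le)
    then show ?thesis
      using prod.subset_diff[OF that(2,1), of "\<lambda>i. 1 + f i"] by (simp add: abs_val_mult mult.commute)
  qed
  show ?thesis
  proof (rule null_family_net_tendsto[OF assms, where B = B])
    fix S S' :: "'i set" and \<epsilon> :: real
    assume *: "finite S" "S' \<subseteq> A" "finite S'" "S \<subseteq> S'" "0 < \<epsilon>" "\<epsilon> \<le> 1" "{i\<in>A. abs_val (f i) \<ge> \<epsilon>} \<subseteq> S"
    have "S1 \<subseteq> S" using * by (auto simp: S1_def)
    then have 1: "abs_val (\<Prod>i\<in>S. 1 + f i) \<le> B" using * by (intro le_B) auto
    have 2: "abs_val ((\<Prod>i\<in>S' - S. 1 + f i) - 1) \<le> \<epsilon>"
      by (rule abs_val_prod_one_plus_minus_one_le) (use * in force)+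
    have "(\<Prod>i\<in>S'. 1 + f i) - (\<Prod>i\<in>S. 1 + f i) = (\<Prod>i\<in>S. 1 + f i) * ((\<Prod>i\<in>S' - S. 1 + f i) - 1)"
      using prod.subset_diff[OF *(4,3), of "\<lambda>i. 1 + f i"] by (simp add: algebra_simps)
    then show "abs_val ((\<Prod>i\<in>S'. 1 + f i) - (\<Prod>i\<in>S. 1 + f i)) \<le> B * \<epsilon>"
      using 1 2 \<open>0 < \<epsilon>\<close> by (simp add: abs_val_mult mult_mono' B_def)
  qed
qed

lemma exhausting_filterlim:
  assumes "\<And>m. finite (V m)" "\<And>m. V m \<subseteq> V (Suc m)" "(\<Union>m. V m) = A"
  shows "filterlim V (finite_subsets_at_top A) sequentially"
  unfolding filterlim_iff
proof (intro allI impI)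
  fix P assume "eventually P (finite_subsets_at_top A)"
  then obtain X where "finite X \<and> X \<subseteq> A \<and> (\<forall>Y. finite Y \<and> X \<subseteq> Y \<and> Y \<subseteq> A \<longrightarrow> P Y)"
    unfolding eventually_finite_subsets_at_top by (elim exE)
  then have X: "finite X" "X \<subseteq> A" "\<And>Y. finite Y \<Longrightarrow> X \<subseteq> Y \<Longrightarrow> Y \<subseteq> A \<Longrightarrow> P Y"
    by simp_all
  have mono: "V m \<subseteq> V n" if "m \<le> n" for m n
    using lift_Suc_mono_le[of V, OF assms(2) that] .
  have "\<exists>m. X \<subseteq> V m"
    using X(1,2)
  proof (induction X rule: finite_induct)
    case (insert x X)
    then obtain m m' where "X \<subseteq> V m" "x \<in> V m'" using assms(3) by auto
    then have "insert x X \<subseteq> V (max m m')"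
      using mono[of m "max m m'"] mono[of m' "max m m'"] by auto
    then show ?case by blast
  qed auto
  then obtain m where "X \<subseteq> V m" by blast
  then have "P (V n)" if "n \<ge> m" for n
    using X(3)[of "V n"] \<open>X \<subseteq> V m\<close> assms(1,3) mono[OF that] by blast
  then show "\<forall>\<^sub>F n in sequentially. P (V n)" by (auto simp: eventually_at_top_linorder)
qed

lemma infsum_exhausting_tendsto:
  fixes f :: "'i \<Rightarrow> 'c::complete_nonarch_field"
  assumes "null_family f A" "\<And>m. finite (V m)" "\<And>m. V m \<subseteq> V (Suc m)" "(\<Union>m. V m) = A"
  shows "(\<lambda>m. \<Sum>i\<in>V m. f i) \<longlonglongrightarrow> infsum f A"
proof -
  have "(f has_sum infsum f A) A"
    using null_family_summable[OF assms(1)] by simp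
  then show ?thesis
    unfolding has_sum_def by (rule filterlim_compose[OF _ exhausting_filterlim[OF assms(2-4)]])
qed

section \<open>Finite additive subgroups of a field\<close>

definition finite_subgroup :: "'a::ab_group_add set \<Rightarrow> bool" where
  "finite_subgroup V \<longleftrightarrow> finite V \<and> 0 \<in> V \<and> (\<forall>x\<in>V. \<forall>y\<in>V. x - y \<in> V)"

lemma finite_subgroupD:
  assumes "finite_subgroup V"
  shows "finite V" "0 \<in> V" "\<And>x y. x \<in> V \<Longrightarrow> y \<in> V \<Longrightarrow> x - y \<in> V"
    "\<And>x. x \<in> V \<Longrightarrow> - x \<in> V" "\<And>x y. x \<in> V \<Longrightarrow> y \<in> V \<Longrightarrow> x + y \<in> V" "card V > 0"
proof -
  show 1: "finite V" "0 \<in> V" "\<And>x y. x \<in> V \<Longrightarrow> y \<in> V \<Longrightarrow> x - y \<in> V"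
    using assms by (auto simp: finite_subgroup_def)
  show 2: "- x \<in> V" if "x \<in> V" for x using 1(3)[OF 1(2) that] by simp
  show "x + y \<in> V" if "x \<in> V" "y \<in> V" for x y using 1(3)[OF that(1) 2[OF that(2)]] by simp
  show "card V > 0" using 1 by (auto simp: card_gt_0_iff)
qed

section \<open>Lagrange interpolation and power sums\<close>

lemma degree_prod_linear:
  fixes S :: "'a::field set"
  shows "degree (\<Prod>\<mu>\<in>S. [:-\<mu>, 1:]) = card S" "coeff (\<Prod>\<mu>\<in>S. [:-\<mu>, 1:]) (card S) = 1"
proof -
  show *: "degree (\<Prod>\<mu>\<in>S. [:-\<mu>, 1:]) = card S"
    by (subst degree_prod_sum_eq) auto
  show "coeff (\<Prod>\<mu>\<in>S. [:-\<mu>, 1:]) (card S) = 1"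
    using lead_coeff_prod[of "\<lambda>\<mu>. [:-\<mu>, 1:]" S] unfolding * by simp
qed

lemma lagrange_interpolation:
  fixes f :: "'a::field poly"
  assumes "finite S" "degree f < card S"
  shows "f = (\<Sum>s\<in>S. smult (poly f s / (\<Prod>\<mu>\<in>S-{s}. s - \<mu>)) (\<Prod>\<mu>\<in>S-{s}. [:-\<mu>, 1:]))"
    (is "f = ?g")
proof (rule poly_eqI_degree)
  have "degree ?g \<le> card S - 1"
    using assms by (intro degree_sum_le order_trans[OF degree_smult_le]) (simp_all add: degree_prod_linear)
  then show "degree ?g < card S" using assms by linarith
  fix x assume x: "x \<in> S"
  have "poly ?g x = (\<Sum>s\<in>S. poly f s / (\<Prod>\<mu>\<in>S-{s}. s - \<mu>) * (\<Prod>\<mu>\<in>S-{s}. x - \<mu>))"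
    by (simp add: poly_sum poly_prod)
  also have "\<dots> = (\<Sum>s\<in>{x}. poly f s / (\<Prod>\<mu>\<in>S-{s}. s - \<mu>) * (\<Prod>\<mu>\<in>S-{s}. x - \<mu>))"
    using assms x by (intro sum.mono_neutral_right) (auto intro!: prod_zero)
  also have "\<dots> = poly f x" using assms by simp
  finally show "poly f x = poly ?g x" ..
qed (use assms in auto)

text \<open>The involution \<open>x -> s - x\<close> of \<open>V\<close> exchanges \<open>s\<close>
  and 0. So the Lagrange denominator is the same at all nodes of a subgroup.\<close>

lemma prod_differences_subgroup:
  fixes V :: "'a::field set"
  assumes "finite_subgroup V" "s \<in> V"
  shows "(\<Prod>\<mu>\<in>V-{s}. s - \<mu>) = \<Prod>(V - {0})"
  by (rule prod.reindex_bij_witness[of _ "\<lambda>x. s - x" "\<lambda>x. s - x"])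
    (use assms finite_subgroupD[OF assms(1)] in auto)

lemma prod_nonzero_subgroup: "finite_subgroup V \<Longrightarrow> \<Prod>(V - {0::'a::field}) \<noteq> 0"
  by (simp add: finite_subgroupD)

text \<open>Compare the coefficients at \<open>card V - 1\<close> in the interpolation formula:
  every basis polynomial is monic of that degree, and the denominators agree.\<close>

lemma sum_poly_subgroup:
  fixes f :: "'a::field poly"
  assumes V: "finite_subgroup V" and deg: "degree f < card V"
  shows "(\<Sum>s\<in>V. poly f s) = \<Prod>(V - {0}) * coeff f (card V - 1)"
proof -
  let ?c = "\<Prod>(V - {0})"
  have "coeff f (card V - 1) = (\<Sum>s\<in>V. poly f s / ?c * coeff (\<Prod>\<mu>\<in>V-{s}. [:-\<mu>, 1:]) (card V - 1))"
    by (subst lagrange_interpolation[OF finite_subgroupD(1)[OF V] deg])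
      (simp add: coeff_sum prod_differences_subgroup[OF V])
  also have "\<dots> = (\<Sum>s\<in>V. poly f s / ?c)"
  proof (rule sum.cong)
    fix s assume "s \<in> V"
    then have "card V - 1 = card (V - {s})" using finite_subgroupD(1)[OF V] by simp
    then show "poly f s / ?c * coeff (\<Prod>\<mu>\<in>V-{s}. [:-\<mu>, 1:]) (card V - 1) = poly f s / ?c"
      using degree_prod_linear(2)[of "V - {s}"] by simp
  qed simp
  finally show ?thesis
    using prod_nonzero_subgroup[OF V] by (simp flip: sum_divide_distrib)
qed

lemma sum_poly_subgroup_eq_0:
  fixes f :: "'a::field poly"
  assumes "finite_subgroup V" "degree f + 1 < card V"
  shows "(\<Sum>s\<in>V. poly f s) = 0"
  using sum_poly_subgroup[OF assms(1), of f] assms(2) by (simp add: coeff_eq_0)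

section \<open>The exponential polynomial of a finite additive subgroup\<close>

definition exp_poly :: "'a::field set \<Rightarrow> 'a poly" where
  "exp_poly V = [:0, 1:] * (\<Prod>\<mu>\<in>V - {0}. [:1, - 1 / \<mu>:])"

lemma poly_exp_poly: "poly (exp_poly V) x = x * (\<Prod>\<mu>\<in>V - {0}. 1 - x / \<mu>)"
  by (simp add: exp_poly_def poly_prod)

lemma coeff_exp_poly_0 [simp]: "coeff (exp_poly V) 0 = 0"
  by (simp add: exp_poly_def)

lemma coeff_exp_poly_1 [simp]: "coeff (exp_poly V) (Suc 0) = 1"
proof -
  have "coeff (\<Prod>\<mu>\<in>V - {0}. [:1, - 1 / \<mu>:]) 0 = 1"
    by (simp flip: poly_0_coeff_0 add: poly_prod)
  then show ?thesis by (simp add: exp_poly_def)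
qed

lemma degree_exp_poly:
  fixes V :: "'a::field set"
  assumes "finite_subgroup V"
  shows "degree (exp_poly V) = card V"
proof -
  note fin = finite_subgroupD[OF assms]
  have "degree (exp_poly V) = 1 + degree (\<Prod>\<mu>\<in>V - {0}. [:1, - 1 / \<mu>:])"
    unfolding exp_poly_def using fin by (subst degree_mult_eq) auto
  also have "\<dots> = 1 + card (V - {0})"
    by (subst degree_prod_sum_eq) auto
  finally show ?thesis using fin by simp
qed

lemma exp_poly_eq_0_iff:
  assumes "finite_subgroup V"
  shows "poly (exp_poly V) x = 0 \<longleftrightarrow> x \<in> V"
  using finite_subgroupD[OF assms] by (auto simp: poly_exp_poly)

lemma prod_diff_eq_exp_poly:
  assumes V: "finite_subgroup V"
  shows "(\<Prod>\<mu>\<in>V. x - \<mu>) = \<Prod>(V - {0}) * poly (exp_poly V) x"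
proof -
  note fin = finite_subgroupD[OF V]
  have "(\<Prod>\<mu>\<in>V. x - \<mu>) = x * (\<Prod>\<mu>\<in>V - {0}. x - \<mu>)"
    using fin by (subst prod.remove[of _ 0]) auto
  also have "(\<Prod>\<mu>\<in>V - {0}. x - \<mu>) = (\<Prod>\<mu>\<in>V - {0}. (0 - \<mu>) * (1 - x / \<mu>))"
    by (intro prod.cong) (auto simp: field_simps)
  also have "\<dots> = (\<Prod>\<mu>\<in>V - {0}. 0 - \<mu>) * (\<Prod>\<mu>\<in>V - {0}. 1 - x / \<mu>)"
    by (rule prod.distrib)
  also have "(\<Prod>\<mu>\<in>V - {0}. 0 - \<mu>) = \<Prod>(V - {0})"
    by (rule prod_differences_subgroup[OF V fin(2)])
  finally show ?thesis by (simp add: poly_exp_poly)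
qed

text \<open>Partial fractions: interpolate the constant 1 on \<open>V\<close> and divide by the
  product of all \<open>x - \<mu>\<close>.\<close>

lemma sum_inverse_eq_exp_poly:
  fixes V :: "'a::field set"
  assumes V: "finite_subgroup V" and x: "x \<notin> V"
  shows "(\<Sum>\<kappa>\<in>V. 1 / (x - \<kappa>)) = 1 / poly (exp_poly V) x"
proof -
  note fin = finite_subgroupD[OF V]
  let ?c = "\<Prod>(V - {0})"
  have "1 = poly 1 x" by simp
  also have "(1::'a poly) = (\<Sum>s\<in>V. smult (poly 1 s / ?c) (\<Prod>\<mu>\<in>V-{s}. [:-\<mu>, 1:]))"
    using lagrange_interpolation[of V 1] fin by (simp add: prod_differences_subgroup[OF V])
  also have "poly \<dots> x = (\<Sum>s\<in>V. (\<Prod>\<mu>\<in>V-{s}. x - \<mu>) / ?c)"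
    by (simp add: poly_sum poly_prod)
  also have "\<dots> = (\<Sum>s\<in>V. poly (exp_poly V) x * (1 / (x - s)))"
  proof (intro sum.cong refl)
    fix s assume s: "s \<in> V"
    have "(x - s) * (\<Prod>\<mu>\<in>V-{s}. x - \<mu>) = ?c * poly (exp_poly V) x"
      using prod_diff_eq_exp_poly[OF V, of x] prod.remove[OF fin(1) s, of "\<lambda>\<mu>. x - \<mu>"] by simp
    moreover have "x - s \<noteq> 0" using s x by auto
    ultimately show "(\<Prod>\<mu>\<in>V-{s}. x - \<mu>) / ?c = poly (exp_poly V) x * (1 / (x - s))"
      using prod_nonzero_subgroup[OF V] by (simp add: field_simps)
  qed
  also have "\<dots> = poly (exp_poly V) x * (\<Sum>s\<in>V. 1 / (x - s))"
    by (simp add: sum_distrib_left)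
  finally have "poly (exp_poly V) x * (\<Sum>s\<in>V. 1 / (x - s)) = 1" ..
  moreover have "poly (exp_poly V) x \<noteq> 0" using exp_poly_eq_0_iff[OF V] x by simp
  ultimately show ?thesis by (simp add: field_simps)
qed

lemma exp_poly_add_subgroup:
  fixes V :: "'a::field set"
  assumes V: "finite_subgroup V" and v: "v \<in> V"
  shows "poly (exp_poly V) (v + x) = poly (exp_poly V) x"
proof -
  note fin = finite_subgroupD[OF V]
  have "(\<Prod>\<mu>\<in>V. v + x - \<mu>) = (\<Prod>\<mu>\<in>V. x - \<mu>)"
    by (rule prod.reindex_bij_witness[of _ "\<lambda>\<mu>. v + \<mu>" "\<lambda>\<mu>. \<mu> - v"])
      (use fin v in \<open>auto simp: algebra_simps\<close>)
  then show ?thesis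
    using prod_nonzero_subgroup[OF V] by (simp add: prod_diff_eq_exp_poly[OF V])
qed

text \<open>As polynomials in \<open>x\<close> both sides have degree at most \<open>card V\<close>
  and the same coefficient there, since adding a constant does not touch it. They agree on the
  \<open>card V\<close> points of \<open>V\<close>, where \<open>exp_poly V\<close> vanishes and has
  \<open>V\<close> as periods.\<close>

lemma exp_poly_add:
  fixes V :: "'a::field set"
  assumes V: "finite_subgroup V"
  shows "poly (exp_poly V) (x + y) = poly (exp_poly V) x + poly (exp_poly V) y"
proof -
  note fin = finite_subgroupD[OF V]
  let ?e = "exp_poly V"
  have e0: "poly ?e v = 0" if "v \<in> V" for v
    using exp_poly_eq_0_iff[OF V] that by simp
  have "pcompose ?e [:y, 1:] = ?e + [:poly ?e y:]"
  proof (rule poly_eqI_degree_lead_coeff[of _ "card V" _ V])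
    have "lead_coeff (pcompose ?e [:y, 1:]) = lead_coeff ?e"
      by (subst lead_coeff_comp) auto
    then show "coeff (pcompose ?e [:y, 1:]) (card V) = coeff (?e + [:poly ?e y:]) (card V)"
      using fin by (simp add: coeff_eq_0[of "[:poly ?e y:]"] degree_pcompose degree_exp_poly[OF V])
    show "degree (?e + [:poly ?e y:]) \<le> card V"
      by (intro degree_add_le) (simp_all add: degree_exp_poly[OF V])
    fix v assume "v \<in> V"
    then show "poly (pcompose ?e [:y, 1:]) v = poly (?e + [:poly ?e y:]) v"
      using exp_poly_add_subgroup[OF V, of v y] e0 by (simp add: poly_pcompose add.commute)
  qed (auto simp: degree_pcompose degree_exp_poly[OF V])
  then have "poly (pcompose ?e [:y, 1:]) x = poly (?e + [:poly ?e y:]) x" by simp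
  then show ?thesis by (simp add: poly_pcompose add.commute)
qed

text \<open>
  The recursion for the Goss polynomials of a lattice whose exponential function has the
  power series coefficients \<open>\<alpha>\<close>.
\<close>

function goss :: "(nat \<Rightarrow> 'a::field) \<Rightarrow> nat \<Rightarrow> 'a poly" where
  "goss \<alpha> n = pCons 0 ((if n = 1 then 1 else 0) + (\<Sum>i\<in>{1..<n}. smult (\<alpha> i) (goss \<alpha> (n - i))))"
  by auto
termination by (relation "Wellfounded.measure snd") auto

declare goss.simps [simp del]

lemma poly_goss:
  "poly (goss \<alpha> n) x = x * ((if n = 1 then 1 else 0) + (\<Sum>i\<in>{1..<n}. \<alpha> i * poly (goss \<alpha> (n - i)) x))"
  by (subst goss.simps) (simp add: poly_sum)

lemma coeff_goss_0 [simp]: "coeff (goss \<alpha> n) 0 = 0"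
  by (subst goss.simps) simp

lemma poly_eq_sum_lessThan:
  fixes p :: "'a::comm_semiring_1 poly"
  assumes "degree p < N"
  shows "poly p x = (\<Sum>i<N. coeff p i * x ^ i)"
  unfolding poly_altdef using assms by (intro sum.mono_neutral_left) (auto simp: coeff_eq_0)

text \<open>
  From \<open>1 = t e(x - \<kappa>)\<close>, valid for all \<open>\<kappa>\<close> in the lattice, one obtains the recursion after division
  by \<open>(x - \<kappa>)\<^sup>n\<close> and summation; the nonnegative powers of \<open>x - \<kappa>\<close> sum to zero.
\<close>

lemma sum_inverse_power_eq_goss:
  fixes V :: "'a::field set"
  assumes V: "finite_subgroup V" and x: "x \<notin> V" and n: "n > 0"
  shows "(\<Sum>\<kappa>\<in>V. 1 / (x - \<kappa>) ^ n) = poly (goss (coeff (exp_poly V)) n) (1 / poly (exp_poly V) x)"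
  using n
proof (induction n rule: less_induct)
  case (less n)
  note fin = finite_subgroupD[OF V]
  define e where "e = exp_poly V"
  define t where "t = 1 / poly e x"
  \<comment> \<open>\<open>N\<close> exceeds both the degree of \<open>e\<close> and
    \<open>n\<close>, so the sum over \<open>i < N\<close> contains the whole exponential polynomial
    as well as the range \<open>{1..<n}\<close> to which it is cut down.\<close>
  define N where "N = n + card V + 1"
  have nz: "poly e x \<noteq> 0" using exp_poly_eq_0_iff[OF V] x by (simp add: e_def)
  show ?case
  proof (cases "n = 1")
    case True
    then show ?thesis
      using sum_inverse_eq_exp_poly[OF V x] by (subst poly_goss) simp
  next
    case False
    then have n: "n > 1" using less.prems by simp
    have "1 / (x - \<kappa>) ^ n = t * (\<Sum>i<N. coeff e i * ((x - \<kappa>) ^ i / (x - \<kappa>) ^ n))" if "\<kappa> \<in> V" for \<kappa>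
    proof -
      have "poly e x = poly e (x - \<kappa>)"
        using exp_poly_add_subgroup[OF V that, of "x - \<kappa>"] by (simp add: e_def)
      also have "\<dots> = (\<Sum>i<N. coeff e i * (x - \<kappa>) ^ i)"
        by (rule poly_eq_sum_lessThan) (simp add: e_def N_def degree_exp_poly[OF V])
      finally have "1 = t * (\<Sum>i<N. coeff e i * (x - \<kappa>) ^ i)"
        using nz by (simp add: t_def)
      then show ?thesis by (simp flip: sum_divide_distrib)
    qed
    then have "(\<Sum>\<kappa>\<in>V. 1 / (x - \<kappa>) ^ n)
        = (\<Sum>\<kappa>\<in>V. t * (\<Sum>i<N. coeff e i * ((x - \<kappa>) ^ i / (x - \<kappa>) ^ n)))"
      by (rule sum.cong[OF refl])
    also have "\<dots> = t * (\<Sum>i<N. coeff e i * (\<Sum>\<kappa>\<in>V. (x - \<kappa>) ^ i / (x - \<kappa>) ^ n))"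
      unfolding sum_distrib_left by (subst sum.swap) (rule refl)
    also have "(\<Sum>i<N. coeff e i * (\<Sum>\<kappa>\<in>V. (x - \<kappa>) ^ i / (x - \<kappa>) ^ n))
        = (\<Sum>i\<in>{1..<n}. coeff e i * (\<Sum>\<kappa>\<in>V. (x - \<kappa>) ^ i / (x - \<kappa>) ^ n))"
    proof (rule sum.mono_neutral_right)
      show "\<forall>i\<in>{..<N} - {1..<n}. coeff e i * (\<Sum>\<kappa>\<in>V. (x - \<kappa>) ^ i / (x - \<kappa>) ^ n) = 0"
      proof
        fix i assume i: "i \<in> {..<N} - {1..<n}"
        consider "i = 0" | "i > card V" | "n \<le> i" "i \<le> card V" using i by force
        then show "coeff e i * (\<Sum>\<kappa>\<in>V. (x - \<kappa>) ^ i / (x - \<kappa>) ^ n) = 0"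
        proof cases
          case 1
          then show ?thesis by (simp add: e_def)
        next
          case 2
          then show ?thesis by (simp add: e_def coeff_eq_0 degree_exp_poly[OF V])
        next
          case 3
          have "(\<Sum>\<kappa>\<in>V. (x - \<kappa>) ^ i / (x - \<kappa>) ^ n) = (\<Sum>\<kappa>\<in>V. poly ([:x, -1:] ^ (i - n)) \<kappa>)"
          proof (rule sum.cong)
            fix \<kappa> assume "\<kappa> \<in> V"
            then have "x - \<kappa> \<noteq> 0" using x by auto
            then show "(x - \<kappa>) ^ i / (x - \<kappa>) ^ n = poly ([:x, -1:] ^ (i - n)) \<kappa>"
              using power_diff[of "x - \<kappa>" n i] 3 by simp
          qed simp
          \<comment> \<open>Here \<open>i - n <= card V - n\<close> and \<open>n > 1\<close> keep
            the degree below \<open>card V - 1\<close>. For \<open>n = 1\<close> and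
            \<open>i = card V\<close> the critical degree would be reached, which is why
            \<open>n = 1\<close> is settled separately by partial fractions.\<close>
          also have "\<dots> = 0"
          proof (rule sum_poly_subgroup_eq_0[OF V])
            show "degree ([:x, - 1:] ^ (i - n)) + 1 < card V"
              using 3 n degree_power_le[of "[:x, -1:]" "i - n"] by simp
          qed
          finally show ?thesis by simp
        qed
      qed
    qed (auto simp: N_def)
    also have "\<dots> = (\<Sum>i\<in>{1..<n}. coeff e i * poly (goss (coeff e) (n - i)) t)"
    proof (intro sum.cong refl)
      fix i assume i: "i \<in> {1..<n}"
      have "(\<Sum>\<kappa>\<in>V. (x - \<kappa>) ^ i / (x - \<kappa>) ^ n) = (\<Sum>\<kappa>\<in>V. 1 / (x - \<kappa>) ^ (n - i))"
      proof (rule sum.cong)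
        fix \<kappa> assume "\<kappa> \<in> V"
        then have "x - \<kappa> \<noteq> 0" using x by auto
        then show "(x - \<kappa>) ^ i / (x - \<kappa>) ^ n = 1 / (x - \<kappa>) ^ (n - i)"
          using i by (simp add: power_diff)
      qed simp
      also have "\<dots> = poly (goss (coeff e) (n - i)) t"
        using less.IH[of "n - i"] i by (simp add: e_def t_def)
      finally show "coeff e i * (\<Sum>\<kappa>\<in>V. (x - \<kappa>) ^ i / (x - \<kappa>) ^ n)
          = coeff e i * poly (goss (coeff e) (n - i)) t" by simp
    qed
    finally show ?thesis
      unfolding e_def[symmetric] t_def[symmetric] using n by (subst poly_goss) simp
  qed
qed

text \<open>Carries the Goss identity from the finite subgroups to the full lattice: the recursion
  for a fixed \<open>n\<close> involves only finitely many coefficients.\<close>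

lemma goss_tendsto:
  fixes \<alpha> :: "nat \<Rightarrow> 'c::complete_nonarch_field"
  assumes "\<And>i. (\<lambda>m. A m i) \<longlonglongrightarrow> \<alpha> i" "x \<longlonglongrightarrow> y"
  shows "(\<lambda>m. poly (goss (A m) n) (x m)) \<longlonglongrightarrow> poly (goss \<alpha> n) y"
proof (induction n rule: less_induct)
  case (less n)
  show ?case
    unfolding poly_goss[of _ n]
    by (intro tendsto_mult_nonarch assms tendsto_add tendsto_const tendsto_sum less) auto
qed

section \<open>Bounds for values and coefficients of polynomials\<close>

lemma poly_bound:
  fixes g :: "'c::complete_nonarch_field poly"
  assumes "coeff g 0 = 0"
  shows "\<exists>B>0. \<forall>x. abs_val x \<le> 1 \<longrightarrow> abs_val (poly g x) \<le> B * abs_val x"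
proof -
  obtain h where h: "g = pCons 0 h"
    using assms by (cases g) auto
  define B where "B = 1 + (\<Sum>i\<le>degree h. abs_val (coeff h i))"
  have B: "B > 0" unfolding B_def by (smt (verit) sum_nonneg abs_val_nonneg)
  have "abs_val (poly h x) \<le> B" if "abs_val x \<le> 1" for x
    unfolding poly_altdef
  proof (rule abs_val_sum_le)
    fix i assume i: "i \<in> {..degree h}"
    have "abs_val (coeff h i * x ^ i) \<le> abs_val (coeff h i)"
      using that by (simp add: abs_val_mult abs_val_power mult_left_le power_le_one)
    also have "\<dots> \<le> (\<Sum>i\<le>degree h. abs_val (coeff h i))"
      using i by (intro member_le_sum) auto
    finally show "abs_val (coeff h i * x ^ i) \<le> B" by (simp add: B_def)
  qed (use B in simp)
  then show ?thesis
    using B by (intro exI[of _ B]) (auto simp: h abs_val_mult intro!: mult_left_mono simp: mult.commute[of B])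
qed

text \<open>For \<open>s > 0\<close> this says that the Gauss norm of \<open>P\<close> on the disc
  of radius \<open>1/s\<close> is at most 1, a condition closed under products.\<close>

definition geometric_poly :: "real \<Rightarrow> 'c::complete_nonarch_field poly \<Rightarrow> bool" where
  "geometric_poly s P \<longleftrightarrow> (\<forall>i. abs_val (coeff P i) \<le> s ^ i)"

lemma geometric_poly_mult:
  assumes "s \<ge> 0" "geometric_poly s P" "geometric_poly s Q"
  shows "geometric_poly s (P * Q)"
  unfolding geometric_poly_def
proof
  fix i
  show "abs_val (coeff (P * Q) i) \<le> s ^ i"
    unfolding coeff_mult
  proof (rule abs_val_sum_le)
    fix j assume "j \<in> {..i}"
    then have "s ^ i = s ^ j * s ^ (i - j)" by (simp flip: power_add)
    then show "abs_val (coeff P j * coeff Q (i - j)) \<le> s ^ i"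
      using assms unfolding geometric_poly_def by (simp add: abs_val_mult mult_mono)
  qed (use assms in simp)
qed

lemma geometric_poly_prod:
  assumes "s \<ge> 0" "\<And>x. x \<in> S \<Longrightarrow> geometric_poly s (f x)"
  shows "geometric_poly s (\<Prod>x\<in>S. f x)"
proof -
  have "geometric_poly s 1"
    using assms(1) by (auto simp: geometric_poly_def one_pCons coeff_pCons split: nat.splits)
  then show ?thesis using assms
    by (induction S rule: infinite_finite_induct) (auto intro: geometric_poly_mult)
qed

lemma geometric_poly_linear:
  assumes "s \<ge> 0" "abs_val a \<le> s"
  shows "geometric_poly s [:1, a:]"
  unfolding geometric_poly_def
proof
  fix i show "abs_val (coeff [:1, a:] i) \<le> s ^ i"
    by (cases i; cases "i - 1") (use assms in auto)
qed

lemma exp_poly_coeff_bound: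
  fixes V :: "'c::complete_nonarch_field set"
  assumes "s \<ge> 0" "\<And>\<mu>. \<mu> \<in> V - {0} \<Longrightarrow> 1 / abs_val \<mu> \<le> s"
  shows "abs_val (coeff (exp_poly V) (Suc i)) \<le> s ^ i"
proof -
  have "geometric_poly s (\<Prod>\<mu>\<in>V - {0}. [:1, - 1 / \<mu>:])"
    using assms by (intro geometric_poly_prod geometric_poly_linear) (auto simp: abs_val_divide)
  then show ?thesis by (simp add: exp_poly_def geometric_poly_def)
qed

text \<open>Passing from \<open>V\<close> to \<open>W\<close> multiplies by \<open>?Q\<close>, whose
  constant term 1 reproduces the old coefficient. Every other contribution contains a coefficient of
  \<open>?Q\<close> of positive index, and with it at least one factor
  \<open>\<delta>\<close>.\<close>

lemma exp_poly_coeff_diff: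
  fixes V :: "'c::complete_nonarch_field set"
  assumes "finite W" "V \<subseteq> W" "0 \<in> V" "s \<ge> 0" "0 \<le> \<delta>" "\<delta> \<le> 1"
    and "\<And>\<mu>. \<mu> \<in> V - {0} \<Longrightarrow> 1 / abs_val \<mu> \<le> s"
    and "\<And>\<mu>. \<mu> \<in> W - V \<Longrightarrow> 1 / abs_val \<mu> \<le> s * \<delta>"
  shows "abs_val (coeff (exp_poly W) (Suc i) - coeff (exp_poly V) (Suc i)) \<le> \<delta> * s ^ i"
proof -
  let ?P = "\<Prod>\<mu>\<in>V - {0}. [:1, - 1 / \<mu>:]" and ?Q = "\<Prod>\<mu>\<in>W - V. [:1, - 1 / \<mu>:]"
  have P: "geometric_poly s ?P"
    using assms by (intro geometric_poly_prod geometric_poly_linear) (auto simp: abs_val_divide)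
  have Q: "geometric_poly (s * \<delta>) ?Q"
    using assms by (intro geometric_poly_prod geometric_poly_linear) (auto simp: abs_val_divide)
  have Q0: "coeff ?Q 0 = 1" by (simp flip: poly_0_coeff_0 add: poly_prod)
  have split: "W - {0} = (V - {0}) \<union> (W - V)" using assms by auto
  have "(\<Prod>\<mu>\<in>W - {0}. [:1, - 1 / \<mu>:]) = ?P * ?Q"
    unfolding split using assms by (intro prod.union_disjoint) (auto intro: finite_subset)
  then have "coeff (exp_poly W) (Suc i) - coeff (exp_poly V) (Suc i)
      = (\<Sum>j\<le>i. coeff ?P j * coeff ?Q (i - j)) - coeff ?P i"
    by (simp add: exp_poly_def coeff_mult)
  also have "\<dots> = (\<Sum>j<i. coeff ?P j * coeff ?Q (i - j))"
    using Q0 by (simp flip: lessThan_Suc_atMost)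
  also have "abs_val \<dots> \<le> \<delta> * s ^ i"
  proof (rule abs_val_sum_le)
    fix j assume j: "j \<in> {..<i}"
    have "abs_val (coeff ?P j * coeff ?Q (i - j)) \<le> s ^ j * (s * \<delta>) ^ (i - j)"
      using P Q assms unfolding geometric_poly_def abs_val_mult by (intro mult_mono) auto
    also have "\<dots> = s ^ i * \<delta> ^ (i - j)"
      using j by (simp add: power_mult_distrib flip: power_add mult.assoc)
    also have "\<dots> \<le> s ^ i * \<delta> ^ 1"
      using assms j by (intro mult_left_mono power_decreasing) auto
    finally show "abs_val (coeff ?P j * coeff ?Q (i - j)) \<le> \<delta> * s ^ i" by (simp add: mult.commute)
  qed (use assms in auto)
  finally show ?thesis .
qed

section \<open>Polynomials of bounded degree over a finite field\<close>

text \<open>Phrased by coefficients and not by \<open>degree\<close>, because 0 has to belong even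
  to \<open>polys_lt 0\<close>. In this form each set is an additive group with \<open>q^M\<close>
  elements.\<close>

definition polys_lt :: "nat \<Rightarrow> 'f::zero poly set" where
  "polys_lt M = {a. \<forall>i\<ge>M. coeff a i = 0}"

lemma polys_lt_iff: "a \<in> polys_lt M \<longleftrightarrow> a = 0 \<or> degree a < M"
proof
  assume "a \<in> polys_lt M"
  then show "a = 0 \<or> degree a < M"
    unfolding polys_lt_def by (metis (mono_tags, lifting) leading_coeff_0_iff mem_Collect_eq not_le)
qed (auto simp: polys_lt_def coeff_eq_0)

lemma zero_in_polys_lt [simp]: "0 \<in> polys_lt M"
  by (simp add: polys_lt_iff)

lemma polys_lt_0 [simp]: "polys_lt 0 = {0}"
  by (auto simp: polys_lt_iff)

lemma polys_lt_mono: "M \<le> N \<Longrightarrow> polys_lt M \<subseteq> polys_lt N"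
  by (auto simp: polys_lt_iff)

lemma UN_polys_lt: "(\<Union>M. polys_lt M) = UNIV"
  by (auto simp: polys_lt_iff)

lemma polys_lt_Suc: "polys_lt (Suc M) = (\<lambda>(c, a). pCons c a) ` (UNIV \<times> polys_lt M)"
proof (intro set_eqI iffI)
  fix a :: "'a poly" assume a: "a \<in> polys_lt (Suc M)"
  obtain c b where cb: "a = pCons c b" by (cases a)
  then have "b \<in> polys_lt M"
    using a unfolding polys_lt_def by (force simp: coeff_pCons split: nat.splits)
  then show "a \<in> (\<lambda>(c, a). pCons c a) ` (UNIV \<times> polys_lt M)" using cb by auto
qed (auto simp: polys_lt_def coeff_pCons split: nat.splits)

lemma finite_polys_lt [simp]: "finite (polys_lt M :: 'f::{finite,zero} poly set)"
  by (induction M) (auto simp: polys_lt_Suc)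

lemma card_polys_lt: "card (polys_lt M :: 'f::{finite,zero} poly set) = CARD('f) ^ M"
proof (induction M)
  case (Suc M)
  have "inj_on (\<lambda>(c, a). pCons c a) (UNIV \<times> (polys_lt M :: 'f poly set))"
    by (auto simp: inj_on_def)
  then show ?case by (simp add: polys_lt_Suc card_image card_cartesian_product Suc)
qed simp

lemma polys_lt_diff: "a \<in> polys_lt M \<Longrightarrow> b \<in> polys_lt M \<Longrightarrow> a - b \<in> polys_lt M"
  for a b :: "'f::ab_group_add poly"
  by (auto simp: polys_lt_def)

lemma polys_lt_smult: "a \<in> polys_lt M \<Longrightarrow> smult c a \<in> polys_lt M"
  by (auto simp: polys_lt_def)

lemma finite_field_power_card:
  fixes x :: "'f::{field,finite}"
  shows "x ^ CARD('f) = x"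
proof (cases "x = 0")
  case False
  have "x * (\<Prod>y\<in>UNIV-{0}. x * y) = x * x ^ (CARD('f) - 1) * \<Prod>(UNIV-{0})"
    by (simp add: prod.distrib mult_ac)
  also have "x * x ^ (CARD('f) - 1) = x ^ CARD('f)"
    by (simp add: power_eq_if)
  also have "(\<Prod>y\<in>UNIV-{0}. x * y) = (\<Prod>y\<in>UNIV-{0}. y)"
    by (rule prod.reindex_bij_witness[of _ "\<lambda>y. y / x" "\<lambda>y. x * y"]) (use False in auto)
  finally show ?thesis by simp
qed (simp add: power_0_left)

lemma finite_field_power_card_minus_1:
  fixes x :: "'f::{field,finite}"
  assumes "x \<noteq> 0"
  shows "x ^ (CARD('f) - 1) = 1"
proof -
  have "x * x ^ (CARD('f) - 1) = x ^ CARD('f)"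
    by (simp add: power_eq_if)
  then show ?thesis using finite_field_power_card[of x] assms by simp
qed

lemma card_field_gt_1: "CARD('f::{field,finite}) > 1"
proof -
  have "card {0::'f, 1} \<le> CARD('f)" by (intro card_mono) auto
  then show ?thesis by simp
qed

lemma of_nat_card_finite_field: "of_nat CARD('f) = (0 :: 'f::{field,finite})"
proof -
  have "(\<Sum>x\<in>UNIV. x + 1) = (\<Sum>x\<in>UNIV. x :: 'f)"
    by (rule sum.reindex_bij_witness[of _ "\<lambda>x. x - 1" "\<lambda>x. x + 1"]) auto
  then show ?thesis by (simp add: sum.distrib)
qed

lemma power_int_less_iff:
  fixes x :: real
  assumes "x > 1"
  shows "x powi m < x powi n \<longleftrightarrow> m < n"
  using power_int_strict_increasing[of m n x] power_int_increasing[of n m x] assms by force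

section \<open>The field of Laurent series inside its completed algebraic closure\<close>

locale c_infinity =
  fixes \<iota> :: "'f::{field,finite} fls \<Rightarrow> 'c::complete_nonarch_field" and q :: nat
  assumes C_infinity: "is_C_infinity \<iota>" and card_field: "CARD('f) = q"
begin

abbreviation T :: 'c where "T \<equiv> \<iota> fls_X_inv"
abbreviation emb :: "'f poly \<Rightarrow> 'c" where "emb \<equiv> emb_A \<iota>"
abbreviation im :: "'c \<Rightarrow> real" where "im \<equiv> imaginary_abs \<iota>"

lemma q_gt_1: "q > 1"
  using card_field_gt_1[where 'f = 'f] unfolding card_field .

lemma iota_1 [simp]: "\<iota> 1 = 1"
  using C_infinity unfolding is_C_infinity_def by (elim conjE)

lemma iota_add: "\<iota> (x + y) = \<iota> x + \<iota> y"
  using C_infinity unfolding is_C_infinity_def by (elim conjE) simp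

lemma iota_mult: "\<iota> (x * y) = \<iota> x * \<iota> y"
  using C_infinity unfolding is_C_infinity_def by (elim conjE) simp

lemma abs_iota: "x \<noteq> 0 \<Longrightarrow> abs_val (\<iota> x) = real q powi (- fls_subdegree x)"
  using C_infinity unfolding is_C_infinity_def card_field by (elim conjE) simp

lemma iota_0 [simp]: "\<iota> 0 = 0"
  by (metis add_0 add_right_imp_eq iota_add)

lemma iota_minus: "\<iota> (- x) = - \<iota> x"
  using iota_add[of x "-x"] by (simp add: eq_neg_iff_add_eq_0 add.commute)

lemma iota_diff: "\<iota> (x - y) = \<iota> x - \<iota> y"
  using iota_add[of x "-y"] by (simp add: iota_minus)

lemma iota_eq_0_iff [simp]: "\<iota> x = 0 \<longleftrightarrow> x = 0"
proof
  assume "\<iota> x = 0"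
  then have "x \<noteq> 0 \<Longrightarrow> False" using iota_mult[of x "inverse x"] by simp
  then show "x = 0" by blast
qed simp

lemma iota_eq_iff [simp]: "\<iota> x = \<iota> y \<longleftrightarrow> x = y"
  using iota_eq_0_iff[of "x - y"] by (simp add: iota_diff)

lemma iota_divide: "\<iota> (x / y) = \<iota> x / \<iota> y"
proof (cases "y = 0")
  case False
  then show ?thesis using iota_mult[of "x / y" y] by (simp add: field_simps)
qed simp

lemma abs_T: "abs_val T = q"
  using abs_iota[of fls_X_inv] by simp

lemma abs_iota_const: "c \<noteq> 0 \<Longrightarrow> abs_val (\<iota> (fls_const c)) = 1"
  using abs_iota[of "fls_const c"] by simp

lemma emb_0 [simp]: "emb 0 = 0"
  by (simp add: emb_A_def)

lemma emb_pCons: "emb (pCons c a) = \<iota> (fls_const c) + T * emb a"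
  by (simp add: emb_A_def map_poly_pCons iota_add iota_mult)

lemma emb_const: "emb [:c:] = \<iota> (fls_const c)"
  by (simp add: emb_pCons)

lemma emb_1 [simp]: "emb 1 = 1"
  unfolding one_pCons emb_const by simp

lemma emb_add: "emb (a + b) = emb a + emb b"
proof (induction a b rule: poly_induct2)
  case (pCons c a d b)
  have "\<iota> (fls_const (c + d)) = \<iota> (fls_const c) + \<iota> (fls_const d)"
    by (subst iota_add[symmetric]) (intro arg_cong[of _ _ \<iota>] fls_eqI, simp)
  then show ?case by (simp add: emb_pCons pCons algebra_simps)
qed simp

lemma emb_minus: "emb (- a) = - emb a"
  using emb_add[of a "-a"] by (simp add: eq_neg_iff_add_eq_0 add.commute)

lemma emb_diff: "emb (a - b) = emb a - emb b"
  using emb_add[of a "-b"] by (simp add: emb_minus)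

lemma emb_smult: "emb (smult c a) = \<iota> (fls_const c) * emb a"
  by (induction a) (simp_all add: emb_pCons iota_mult algebra_simps flip: fls_const_mult_const)

lemma emb_mult: "emb (a * b) = emb a * emb b"
  by (induction a) (simp_all add: emb_pCons emb_add emb_smult algebra_simps)

lemma emb_power: "emb (a ^ n) = emb a ^ n"
  by (induction n) (simp_all add: emb_mult)

lemma emb_sum: "emb (\<Sum>i\<in>S. f i) = (\<Sum>i\<in>S. emb (f i))"
  by (induction S rule: infinite_finite_induct) (simp_all add: emb_add)

lemma emb_T: "emb [:0, 1:] = T"
  by (simp add: emb_pCons)

lemma abs_emb: "a \<noteq> 0 \<Longrightarrow> abs_val (emb a) = real q ^ degree a"
proof (induction a)
  case (pCons c a)
  have c: "abs_val (\<iota> (fls_const c)) \<le> 1" by (cases "c = 0") (simp_all add: abs_iota_const)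
  show ?case
  proof (cases "a = 0")
    case True
    then show ?thesis using pCons by (simp add: emb_const abs_iota_const)
  next
    case False
    then have "abs_val (T * emb a) = q * real q ^ degree a"
      by (simp add: abs_val_mult abs_T pCons)
    moreover have "1 < q * real q ^ degree a"
      using q_gt_1 by (intro less_1_mult' ) (auto intro: one_le_power)
    ultimately have "abs_val (T * emb a + \<iota> (fls_const c)) = q * real q ^ degree a"
      using c abs_val_add_eq_left[of "\<iota> (fls_const c)" "T * emb a"] by simp
    then show ?thesis using False by (simp add: emb_pCons add.commute)
  qed
qed simp

lemma emb_eq_0_iff [simp]: "emb a = 0 \<longleftrightarrow> a = 0"
  using abs_emb[of a] q_gt_1 by (cases "a = 0") auto

lemma emb_eq_iff [simp]: "emb a = emb b \<longleftrightarrow> a = b"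
  using emb_eq_0_iff[of "a - b"] by (simp add: emb_diff)

lemma abs_emb_ge_1: "a \<noteq> 0 \<Longrightarrow> abs_val (emb a) \<ge> 1"
  using q_gt_1 by (simp add: abs_emb one_le_power)

lemma abs_emb_lt: "a \<in> polys_lt M \<Longrightarrow> abs_val (emb a) * q \<le> real q ^ M"
  using q_gt_1 unfolding polys_lt_iff
  by (cases "a = 0") (auto simp: abs_emb mult.commute simp flip: power_Suc intro!: power_increasing)

lemma abs_emb_le: "a \<in> polys_lt M \<Longrightarrow> abs_val (emb a) \<le> real q ^ M"
  using abs_emb_lt[of a M] mult_left_mono[of 1 "real q" "abs_val (emb a)"] q_gt_1 by simp

lemma abs_emb_ge: "a \<notin> polys_lt M \<Longrightarrow> real q ^ M \<le> abs_val (emb a)"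
  using q_gt_1 unfolding polys_lt_iff by (auto simp: abs_emb intro!: power_increasing)

lemma emb_in_range: "emb a \<in> range \<iota>"
  by (simp add: emb_A_def)

lemma ex_q_power_gt: "\<exists>M. R < real q ^ M"
  using q_gt_1 by (intro real_arch_pow) simp

lemma ex_q_power_less:
  assumes "0 < \<epsilon>"
  shows "\<exists>N. real q powi (- int N) < \<epsilon>"
proof -
  obtain N where "inverse (real q) ^ N < \<epsilon>"
    using q_gt_1 real_arch_pow_inv[OF assms, of "inverse (real q)"] by (auto simp: inverse_less_1_iff)
  then show ?thesis by (intro exI[of _ N]) (simp add: power_int_minus power_inverse)
qed

lemma finite_subgroup_emb_polys_lt: "finite_subgroup ((\<lambda>a. w * emb a) ` polys_lt M)"
  unfolding finite_subgroup_def
proof (intro conjI ballI)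
  show "0 \<in> (\<lambda>a. w * emb a) ` polys_lt M" by (rule image_eqI[of _ _ 0]) auto
  fix x y assume "x \<in> (\<lambda>a. w * emb a) ` polys_lt M" "y \<in> (\<lambda>a. w * emb a) ` polys_lt M"
  then obtain a b where "x = w * emb a" "y = w * emb b" "a \<in> polys_lt M" "b \<in> polys_lt M" by auto
  then show "x - y \<in> (\<lambda>a. w * emb a) ` polys_lt M"
    by (intro image_eqI[of _ _ "a - b"]) (auto simp: emb_diff algebra_simps polys_lt_diff)
qed auto

lemma null_family_polys:
  fixes f :: "'f poly \<Rightarrow> 'c"
  assumes "\<And>\<epsilon>. \<epsilon> > 0 \<Longrightarrow> \<exists>M. \<forall>a\<in>A. a \<notin> polys_lt M \<longrightarrow> abs_val (f a) < \<epsilon>"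
  shows "null_family f A"
  unfolding null_family_def
proof (intro allI impI)
  fix \<epsilon> :: real assume "\<epsilon> > 0"
  then obtain M where "\<forall>a\<in>A. a \<notin> polys_lt M \<longrightarrow> abs_val (f a) < \<epsilon>" using assms by blast
  then have "{a\<in>A. \<epsilon> \<le> abs_val (f a)} \<subseteq> polys_lt M" by (auto simp: not_less[symmetric])
  then show "finite {a\<in>A. \<epsilon> \<le> abs_val (f a)}" by (rule finite_subset) simp
qed

lemma abs_iota_less_iff:
  "abs_val (\<iota> x) < real q powi (- int N) \<longleftrightarrow> (\<forall>i\<le>int N. fls_nth x i = 0)"
proof (cases "x = 0")
  case True
  then show ?thesis using q_gt_1 by simp
next
  case False
  have "abs_val (\<iota> x) < real q powi (- int N) \<longleftrightarrow> int N < fls_subdegree x"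
    using q_gt_1 by (simp add: abs_iota[OF False] power_int_less_iff)
  also have "\<dots> \<longleftrightarrow> (\<forall>i\<le>int N. fls_nth x i = 0)"
    using nth_fls_subdegree_nonzero[OF False] by (metis fls_eq0_below_subdegree le_less_trans not_le)
  finally show ?thesis .
qed

lemma abs_iota_less_1_iff: "abs_val (\<iota> x) < 1 \<longleftrightarrow> (\<forall>i\<le>0. fls_nth x i = 0)"
  using abs_iota_less_iff[of x 0] by simp

text \<open>The approximant is the polynomial part of \<open>x\<close> in \<open>T\<close>: the
  coefficients at indices up to 0 belong to nonnegative powers of \<open>T\<close> and are stripped
  off one at a time from the top.\<close>

lemma iota_approx_emb: "\<exists>a. abs_val (\<iota> x - emb a) < 1"
proof -
  have "\<exists>a. abs_val (\<iota> x - emb a) < 1" if "\<And>i. i \<le> - int N \<Longrightarrow> fls_nth x i = 0" for N x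
    using that
  proof (induction N arbitrary: x)
    case 0
    then show ?case by (intro exI[of _ 0]) (simp add: abs_iota_less_1_iff)
  next
    case (Suc N)
    define c where "c = fls_nth x (- int N)"
    define y where "y = x - fls_const c * fls_X_inv ^ N"
    have "fls_nth y i = 0" if "i \<le> - int N" for i
      using Suc.prems[of i] that by (cases "i = - int N") (auto simp: y_def c_def)
    then obtain a where a: "abs_val (\<iota> y - emb a) < 1" using Suc.IH by blast
    have "emb (monom c N) = \<iota> (fls_const c) * T ^ N"
      by (induction N) (simp_all add: monom_Suc monom_0 emb_pCons)
    moreover have "\<iota> (fls_X_inv ^ N) = T ^ N" by (induction N) (simp_all add: iota_mult)
    ultimately have "\<iota> y - emb a = \<iota> x - emb (a + monom c N)"
      by (simp add: y_def iota_diff iota_mult emb_add)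
    then show ?case using a by auto
  qed
  moreover have "fls_nth x i = 0" if "i \<le> - int (nat (1 - fls_subdegree x))" for i
    using that by (intro fls_eq0_below_subdegree) linarith
  ultimately show ?thesis by blast
qed

section \<open>The distance from the Laurent series field\<close>

lemma im_le: "im z \<le> abs_val (z - \<iota> x)"
  unfolding imaginary_abs_def dist_eq_abs_val[symmetric] by (rule infdist_le) simp

lemma im_le_emb: "im z \<le> abs_val (z - emb a)"
  unfolding emb_A_def by (rule im_le)

lemma im_ge: "(\<And>x. R \<le> abs_val (z - \<iota> x)) \<Longrightarrow> R \<le> im z"
  unfolding imaginary_abs_def by (subst infdist_notempty) (auto intro!: cINF_greatest simp: dist_eq_abs_val)

lemma im_nonneg: "im z \<ge> 0"
  unfolding imaginary_abs_def by (rule infdist_nonneg)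

lemma im_less_iff: "im z < R \<longleftrightarrow> (\<exists>x. abs_val (z - \<iota> x) < R)"
proof
  show "im z < R \<Longrightarrow> \<exists>x. abs_val (z - \<iota> x) < R"
    using im_ge[of R z] by (auto simp flip: not_less)
  show "\<exists>x. abs_val (z - \<iota> x) < R \<Longrightarrow> im z < R"
    using im_le[of z] by (auto intro: le_less_trans)
qed

lemma im_emb_mult: "im (emb a * z) \<ge> abs_val (emb a) * im z"
proof (cases "a = 0")
  case False
  show ?thesis
  proof (rule im_ge)
    fix x
    obtain y where y: "emb a = \<iota> y" using emb_in_range[of a] by auto
    then have "y \<noteq> 0" using False by (metis emb_eq_0_iff iota_0)
    have "abs_val (emb a) * im z \<le> abs_val (emb a) * abs_val (z - \<iota> (x / y))"
      by (intro mult_left_mono im_le) simp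
    also have "\<dots> = abs_val (emb a * z - \<iota> x)"
      using \<open>y \<noteq> 0\<close> by (simp flip: abs_val_mult add: y iota_divide right_diff_distrib)
    finally show "abs_val (emb a) * im z \<le> abs_val (emb a * z - \<iota> x)" .
  qed
qed (simp add: im_nonneg)

text \<open>This amounts to the closedness of the Laurent series field. Approximants within
  \<open>q^(-N)\<close> of \<open>z\<close> share all coefficients up to index \<open>N\<close>, so
  they determine a series at distance 0 from \<open>z\<close>.\<close>

lemma im_pos_iff: "im z > 0 \<longleftrightarrow> z \<in> upper_half_plane \<iota>"
proof
  assume "im z > 0"
  then have "z \<noteq> \<iota> x" for x
    using im_le[of z x] by auto
  then show "z \<in> upper_half_plane \<iota>"
    by (auto simp: upper_half_plane_def)
next
  assume z: "z \<in> upper_half_plane \<iota>"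
  show "im z > 0"
  proof (rule ccontr)
    assume "\<not> im z > 0"
    then have "im z < real q powi (- int N)" for N
      using q_gt_1 zero_less_power_int[of "real q" "- int N"] by linarith
    then have "\<forall>N. \<exists>x. abs_val (z - \<iota> x) < real q powi (- int N)"
      unfolding im_less_iff by blast
    from choice[OF this] obtain x where "\<forall>N. abs_val (z - \<iota> (x N)) < real q powi (- int N)" ..
    then have x: "abs_val (z - \<iota> (x N)) < real q powi (- int N)" for N by simp
    have agree: "fls_nth (x M) i = fls_nth (x N) i" if "N \<le> M" "i \<le> int N" for M N i
    proof -
      have "real q powi (- int M) \<le> real q powi (- int N)"
        using that q_gt_1 by (intro power_int_increasing) auto
      then have "abs_val ((z - \<iota> (x N)) - (z - \<iota> (x M))) < real q powi (- int N)"
        using x[of M] x[of N] by (intro abs_val_diff_less[of "z - \<iota> (x N)" _ "z - \<iota> (x M)"]) linarith+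
      then have "abs_val (\<iota> (x M - x N)) < real q powi (- int N)"
        by (simp add: iota_diff)
      then show ?thesis using that by (simp add: abs_iota_less_iff)
    qed
    \<comment> \<open>A power series carries only nonnegative indices; at these the coefficient is
      taken from \<open>x i\<close>. At negative indices all approximants already agree with
      \<open>x 0\<close>.\<close>
    define y where "y = x 0 + fps_to_fls (Abs_fps (\<lambda>i. fls_nth (x i - x 0) i))"
    have y: "fls_nth y i = fls_nth (x N) i" if "i \<le> int N" for i N
    proof (cases "i \<ge> 0")
      case True
      then have "fls_nth y i = fls_nth (x (nat i)) i" by (simp add: y_def)
      then show ?thesis using True that agree[of "nat i" N i] by simp
    next
      case False
      then show ?thesis using agree[of 0 N i] by (simp add: y_def)
    qed
    have small: "abs_val (z - \<iota> y) < real q powi (- int N)" for N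
    proof -
      have "abs_val (\<iota> (x N - y)) < real q powi (- int N)"
        unfolding abs_iota_less_iff using y by simp
      then show ?thesis
        using abs_val_add_less[OF x[of N], of "\<iota> (x N - y)"] by (simp add: iota_diff)
    qed
    have "abs_val (z - \<iota> y) = 0"
    proof (rule ccontr)
      assume "abs_val (z - \<iota> y) \<noteq> 0"
      then have "abs_val (z - \<iota> y) > 0" by simp
      from ex_q_power_less[OF this] obtain N where "real q powi (- int N) < abs_val (z - \<iota> y)" ..
      then show False using small[of N] by simp
    qed
    then show False using z by (auto simp: upper_half_plane_def)
  qed
qed

text \<open>
  If \<open>y\<close> is nearer to \<open>z\<close> than \<open>x\<close>, then \<open>|z - x| = |x - y|\<close> is a power of \<open>q\<close>; this discreteness
  forces the infimum to be attained.
\<close>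

lemma im_attained:
  assumes z: "im z > 0"
  shows "\<exists>x. abs_val (z - \<iota> x) = im z"
proof (rule ccontr)
  assume "\<not> ?thesis"
  then have gt: "im z < abs_val (z - \<iota> x)" for x
    using im_le[of z x] by (metis less_eq_real_def)
  from ex_q_power_less[OF z] obtain N where N: "real q powi (- int N) < im z" ..
  have pow: "\<exists>j::nat. abs_val (z - \<iota> x) = real q powi (int j - int N)" for x
  proof -
    obtain y where y: "abs_val (z - \<iota> y) < abs_val (z - \<iota> x)"
      using gt[of x] unfolding im_less_iff by blast
    then have *: "abs_val (\<iota> (x - y)) = abs_val (z - \<iota> x)"
      using abs_val_diff_eq_right[OF y] by (simp add: iota_diff)
    then have "x - y \<noteq> 0" using gt[of x] z by auto
    then have eq: "abs_val (z - \<iota> x) = real q powi (- fls_subdegree (x - y))"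
      using abs_iota * by simp
    then have "real q powi (- int N) < real q powi (- fls_subdegree (x - y))"
      using N gt[of x] by linarith
    then have "- int N < - fls_subdegree (x - y)"
      using q_gt_1 by (simp add: power_int_less_iff)
    then show ?thesis
      using eq by (intro exI[of _ "nat (- fls_subdegree (x - y) + int N)"]) simp
  qed
  define j where "j = (LEAST j::nat. \<exists>x. abs_val (z - \<iota> x) = real q powi (int j - int N))"
  have "\<exists>j::nat. \<exists>x. abs_val (z - \<iota> x) = real q powi (int j - int N)" using pow by blast
  from LeastI_ex[OF this, folded j_def] obtain x0 where x0: "abs_val (z - \<iota> x0) = real q powi (int j - int N)" ..
  have "abs_val (z - \<iota> x0) \<le> abs_val (z - \<iota> x)" for x
  proof -
    obtain j' where j': "abs_val (z - \<iota> x) = real q powi (int j' - int N)" using pow[of x] ..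
    then have "\<exists>x. abs_val (z - \<iota> x) = real q powi (int j' - int N)" ..
    then have "j \<le> j'" unfolding j_def by (rule Least_le)
    then show ?thesis unfolding x0 j' using q_gt_1 by (intro power_int_increasing) auto
  qed
  then have "abs_val (z - \<iota> x0) \<le> im z" by (rule im_ge)
  then show False using gt[of x0] by simp
qed

text \<open>Replacing a nearest Laurent series by its polynomial part moves it by less than 1, which
  does not affect a distance of at least 1.\<close>

lemma im_attained_emb:
  assumes z: "im z \<ge> 1"
  shows "\<exists>a. abs_val (z - emb a) = im z"
proof -
  obtain x where x: "abs_val (z - \<iota> x) = im z" using im_attained[of z] z by auto
  obtain a where a: "abs_val (\<iota> x - emb a) < 1" using iota_approx_emb by blast
  have "abs_val ((z - \<iota> x) + (\<iota> x - emb a)) = im z"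
    using abs_val_add_eq_left[of "\<iota> x - emb a" "z - \<iota> x"] a x z by simp
  then show ?thesis by auto
qed

text \<open>A square root of \<open>T\<close> exists in the algebraic closure, and it is not a
  Laurent series because \<open>T\<close> has odd valuation. Without a point in the upper half plane
  the description of \<open>goss_poly\<close> would not single out a polynomial.\<close>

lemma exists_im_pos: "\<exists>z. im z > 0"
proof -
  have alg: "algebraic_over \<iota> (\<iota> x)" for x
    unfolding algebraic_over_def by (intro exI[of _ "[:-x, 1:]"]) (simp add: map_poly_pCons iota_minus)
  have "degree [:- T, 0, 1:] > 0 \<and> (\<forall>i. algebraic_over \<iota> (coeff [:- T, 0, 1:] i))"
    using alg[of 0] alg[of 1] alg[of "- fls_X_inv"]
    by (auto simp: coeff_pCons iota_minus split: nat.splits)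
  moreover have "\<forall>P. degree P > 0 \<and> (\<forall>i. algebraic_over \<iota> (coeff P i)) \<longrightarrow>
      (\<exists>x. algebraic_over \<iota> x \<and> poly P x = 0)"
    using C_infinity unfolding is_C_infinity_def by (elim conjE)
  ultimately obtain z where z: "poly [:- T, 0, 1:] z = 0" by blast
  have "z \<notin> range \<iota>"
  proof
    assume "z \<in> range \<iota>"
    then obtain x where "z = \<iota> x" by blast
    then have "\<iota> (x * x) = \<iota> fls_X_inv" using z by (simp add: iota_mult)
    then have eq: "x * x = fls_X_inv" by (simp only: iota_eq_iff)
    then have "x \<noteq> 0" by auto
    then have "2 * fls_subdegree x = -1" using arg_cong[OF eq, of fls_subdegree] by simp
    then show False by presburger
  qed
  then show ?thesis unfolding im_pos_iff by (auto simp: upper_half_plane_def)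
qed

end

section \<open>The Carlitz exponential and the Goss polynomials\<close>

locale carlitz = c_infinity \<iota> q for \<iota> :: "'f::{field,finite} fls \<Rightarrow> 'c::complete_nonarch_field" and q +
  fixes \<omega> :: 'c
  assumes period: "carlitz_period \<iota> \<omega>"
begin

abbreviation ex :: "'c \<Rightarrow> 'c" where "ex \<equiv> lattice_exp (lattice_A \<iota> \<omega>)"
abbreviation t :: "'c \<Rightarrow> 'c" where "t \<equiv> t_param \<iota> \<omega>"
abbreviation \<Omega> :: "'c set" where "\<Omega> \<equiv> upper_half_plane \<iota>"

definition lattice_lt :: "nat \<Rightarrow> 'c set" where
  "lattice_lt M = (\<lambda>a. \<omega> * emb a) ` polys_lt M"

definition exp_lt :: "nat \<Rightarrow> 'c poly" where
  "exp_lt M = exp_poly (lattice_lt M)"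

lemma omega_nonzero [simp]: "\<omega> \<noteq> 0"
  using period by (simp add: carlitz_period_def)

lemma ex_T: "ex (T * z) = T * ex z + ex z ^ q"
  using period by (simp add: carlitz_period_def card_field)

lemma subgroup_lattice_lt: "finite_subgroup (lattice_lt M)"
  unfolding lattice_lt_def by (rule finite_subgroup_emb_polys_lt)

lemma finite_lattice_lt [simp]: "finite (lattice_lt M)"
  by (simp add: lattice_lt_def)

lemma lattice_lt_mono: "M \<le> N \<Longrightarrow> lattice_lt M \<subseteq> lattice_lt N"
  unfolding lattice_lt_def by (intro image_mono polys_lt_mono)

lemma UN_lattice_lt: "(\<Union>M. lattice_lt M) = lattice_A \<iota> \<omega>"
  unfolding lattice_lt_def lattice_A_def image_UN[symmetric] UN_polys_lt by simp

lemma omega_emb_in_lattice_lt: "\<omega> * emb a \<in> lattice_lt M \<longleftrightarrow> a \<in> polys_lt M"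
  by (auto simp: lattice_lt_def)

lemma lattice_lt_minus_0: "lattice_lt M - {0} = (\<lambda>a. \<omega> * emb a) ` (polys_lt M - {0})"
  by (auto simp: lattice_lt_def)

lemma inj_omega_emb: "inj_on (\<lambda>a. \<omega> * emb a) A"
  by (auto simp: inj_on_def)

lemma poly_exp_lt:
  "poly (exp_lt M) (\<omega> * w) = \<omega> * w * (\<Prod>a\<in>polys_lt M - {0}. 1 - w / emb a)"
  unfolding exp_lt_def poly_exp_poly lattice_lt_minus_0
  by (subst prod.reindex[OF inj_omega_emb]) (simp add: o_def)

lemma abs_lattice_ge: "\<mu> \<in> lattice_A \<iota> \<omega> \<Longrightarrow> \<mu> \<notin> lattice_lt M \<Longrightarrow> abs_val \<omega> * real q ^ M \<le> abs_val \<mu>"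
  unfolding lattice_A_def using abs_emb_ge[of _ M]
  by (auto simp: omega_emb_in_lattice_lt abs_val_mult intro!: mult_left_mono)

lemma abs_lattice_ge_omega: "\<mu> \<in> lattice_A \<iota> \<omega> \<Longrightarrow> \<mu> \<noteq> 0 \<Longrightarrow> abs_val \<omega> \<le> abs_val \<mu>"
  using abs_lattice_ge[of \<mu> 0] by (auto simp: lattice_lt_def)

text \<open>The net of all finite partial products converges because \<open>z / \<mu>\<close> tends
  to zero along the lattice. Restricted to the lattice points of bounded degree it becomes a
  sequence of exponential polynomials of subgroups, to which the algebraic identities apply.\<close>

lemma exp_lt_tendsto: "(\<lambda>M. poly (exp_lt M) z) \<longlonglongrightarrow> ex z"
proof -
  let ?L = "lattice_A \<iota> \<omega> - {0}"
  have "null_family (\<lambda>\<mu>. - z / \<mu>) ?L"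
    unfolding null_family_def
  proof (intro allI impI)
    fix \<epsilon> :: real assume e: "\<epsilon> > 0"
    obtain M where M: "abs_val z / (abs_val \<omega> * \<epsilon>) < real q ^ M" using ex_q_power_gt by blast
    have "{\<mu>\<in>?L. abs_val (- z / \<mu>) \<ge> \<epsilon>} \<subseteq> lattice_lt M"
    proof (rule subsetI)
      fix \<mu> assume "\<mu> \<in> {\<mu>\<in>?L. abs_val (- z / \<mu>) \<ge> \<epsilon>}"
      then have mu: "\<mu> \<in> lattice_A \<iota> \<omega>" "\<mu> \<noteq> 0" "\<epsilon> \<le> abs_val (- z / \<mu>)" by auto
      show "\<mu> \<in> lattice_lt M"
      proof (rule ccontr)
        assume "\<mu> \<notin> lattice_lt M"
        then have "abs_val \<omega> * real q ^ M \<le> abs_val \<mu>" using mu by (intro abs_lattice_ge) auto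
        moreover have "abs_val z < \<epsilon> * (abs_val \<omega> * real q ^ M)"
          using M e by (simp add: field_simps)
        moreover have "\<epsilon> * abs_val \<mu> \<le> abs_val z"
          using mu by (simp add: abs_val_divide field_simps)
        ultimately show False using e by (smt (verit) mult_left_mono)
      qed
    qed
    then show "finite {\<mu>\<in>?L. abs_val (- z / \<mu>) \<ge> \<epsilon>}" by (rule finite_subset) simp
  qed
  then obtain l where l: "((\<lambda>S. \<Prod>\<mu>\<in>S. 1 + - z / \<mu>) \<longlongrightarrow> l) (finite_subsets_at_top ?L)"
    using null_family_prod_convergent by blast
  then have l': "((\<lambda>S. \<Prod>\<mu>\<in>S. 1 - z / \<mu>) \<longlongrightarrow> l) (finite_subsets_at_top ?L)" by simp
  then have "Lim (finite_subsets_at_top ?L) (\<lambda>S. \<Prod>\<mu>\<in>S. 1 - z / \<mu>) = l"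
    by (intro tendsto_Lim) simp_all
  then have ex: "ex z = z * l" by (simp add: lattice_exp_def)
  have "filterlim (\<lambda>M. lattice_lt M - {0}) (finite_subsets_at_top ?L) sequentially"
  proof (rule exhausting_filterlim)
    show "lattice_lt M - {0} \<subseteq> lattice_lt (Suc M) - {0}" for M
      using lattice_lt_mono[of M "Suc M"] by auto
  qed (auto simp flip: UN_lattice_lt)
  from filterlim_compose[OF l' this] show ?thesis
    unfolding ex exp_lt_def poly_exp_poly by (intro tendsto_mult_nonarch tendsto_const)
qed

lemma ex_add: "ex (x + y) = ex x + ex y"
proof (rule LIMSEQ_unique)
  show "(\<lambda>M. poly (exp_lt M) (x + y)) \<longlonglongrightarrow> ex x + ex y"
    unfolding exp_lt_def exp_poly_add[OF subgroup_lattice_lt]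
    by (intro tendsto_add exp_lt_tendsto[unfolded exp_lt_def])
qed (rule exp_lt_tendsto)

lemma ex_omega_emb: "ex (\<omega> * emb a) = 0"
proof (rule LIMSEQ_unique[OF exp_lt_tendsto])
  obtain M where M: "a \<in> polys_lt M" using UN_polys_lt by blast
  have "poly (exp_lt N) (\<omega> * emb a) = 0" if "N \<ge> M" for N
    using M polys_lt_mono[OF that] unfolding exp_lt_def
    by (subst exp_poly_eq_0_iff[OF subgroup_lattice_lt]) (auto simp: omega_emb_in_lattice_lt)
  then show "(\<lambda>M. poly (exp_lt M) (\<omega> * emb a)) \<longlonglongrightarrow> 0"
    by (intro tendsto_eventually) (auto simp: eventually_at_top_linorder)
qed

lemma ex_const_mult: "ex (\<iota> (fls_const c) * z) = \<iota> (fls_const c) * ex z"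
proof (cases "c = 0")
  case True
  then show ?thesis using ex_omega_emb[of 0] by simp
next
  case False
  define k where "k = \<iota> (fls_const c)"
  have k: "k \<noteq> 0" using False by (simp add: k_def)
  have k_inv: "\<iota> (fls_const (inverse c)) * k = 1"
    unfolding k_def using False by (simp flip: iota_mult)
  have "poly (exp_lt M) (k * z) = k * poly (exp_lt M) z" for M
  proof -
    have "(\<Prod>\<mu>\<in>lattice_lt M - {0}. 1 - k * z / \<mu>) = (\<Prod>\<mu>\<in>lattice_lt M - {0}. 1 - z / \<mu>)"
    proof (rule prod.reindex_bij_witness[of _ "\<lambda>\<mu>. k * \<mu>" "\<lambda>\<mu>. \<iota> (fls_const (inverse c)) * \<mu>"])
      fix \<mu> assume "\<mu> \<in> lattice_lt M - {0}"
      then obtain a where a: "\<mu> = \<omega> * emb a" "a \<noteq> 0" "a \<in> polys_lt M" by (auto simp: lattice_lt_def)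
      have smult: "\<iota> (fls_const d) * \<mu> = \<omega> * emb (smult d a)" for d
        by (simp add: a emb_smult algebra_simps)
      have "\<iota> (fls_const d) * \<mu> \<in> lattice_lt M - {0}" if "d \<noteq> 0" for d
        unfolding smult using that a(2,3) by (auto simp: omega_emb_in_lattice_lt polys_lt_smult)
      then show "\<iota> (fls_const (inverse c)) * \<mu> \<in> lattice_lt M - {0}" "k * \<mu> \<in> lattice_lt M - {0}"
        unfolding k_def using False by auto
      show "k * (\<iota> (fls_const (inverse c)) * \<mu>) = \<mu>" "\<iota> (fls_const (inverse c)) * (k * \<mu>) = \<mu>"
        using k_inv by (simp_all flip: mult.assoc add: mult.commute[of k])
      have "inverse k = \<iota> (fls_const (inverse c))" using k_inv k by (simp add: field_simps)
      then show "1 - z / (\<iota> (fls_const (inverse c)) * \<mu>) = 1 - k * z / \<mu>"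
        using k unfolding \<open>inverse k = _\<close>[symmetric] by (simp add: field_simps)
    qed
    then show ?thesis by (simp add: exp_lt_def poly_exp_poly)
  qed
  then have "(\<lambda>M. k * poly (exp_lt M) z) \<longlonglongrightarrow> ex (k * z)"
    using exp_lt_tendsto[of "k * z"] by simp
  from LIMSEQ_unique[OF this tendsto_mult_nonarch[OF tendsto_const exp_lt_tendsto]]
  show ?thesis unfolding k_def .
qed

text \<open>The factors with \<open>|a| > |w|\<close> have absolute value 1, so the absolute values
  of the partial products are eventually constant, and this constant is nonzero.\<close>

lemma ex_omega_nonzero:
  assumes w: "w \<in> \<Omega>"
  shows "ex (\<omega> * w) \<noteq> 0"
proof -
  have notin: "\<omega> * w \<notin> lattice_lt M" for M
    using w emb_in_range by (auto simp: lattice_lt_def upper_half_plane_def)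
  obtain M where M: "abs_val w < real q ^ M" using ex_q_power_gt by blast
  have const: "abs_val (poly (exp_lt N) (\<omega> * w)) = abs_val (poly (exp_lt M) (\<omega> * w))" if "N \<ge> M" for N
  proof -
    have "abs_val (1 - w / emb a) = 1" if "a \<notin> polys_lt M" for a
    proof -
      have "abs_val w < abs_val (emb a)" using abs_emb_ge[OF that] M by linarith
      then have "abs_val (w / emb a) < 1" by (auto simp: abs_val_divide divide_less_eq_1)
      then show ?thesis using abs_val_diff_eq_left[of "w / emb a" 1] by simp
    qed
    then have "(\<Prod>a\<in>polys_lt M - {0}. abs_val (1 - w / emb a)) = (\<Prod>a\<in>polys_lt N - {0}. abs_val (1 - w / emb a))"
      using polys_lt_mono[OF that] by (intro prod.mono_neutral_left) auto
    then show ?thesis unfolding poly_exp_lt by (simp add: abs_val_mult abs_val_prod)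
  qed
  have "(\<lambda>N. abs_val (poly (exp_lt N) (\<omega> * w))) \<longlonglongrightarrow> abs_val (poly (exp_lt M) (\<omega> * w))"
    by (intro tendsto_eventually eventually_sequentiallyI[of M] const)
  from LIMSEQ_unique[OF tendsto_abs_val[OF exp_lt_tendsto] this]
  have "abs_val (ex (\<omega> * w)) = abs_val (poly (exp_lt M) (\<omega> * w))" .
  moreover have "poly (exp_lt M) (\<omega> * w) \<noteq> 0"
    unfolding exp_lt_def using exp_poly_eq_0_iff[OF subgroup_lattice_lt] notin by simp
  ultimately show ?thesis by (metis abs_val_eq_0_iff)
qed

text \<open>
  By periodicity \<open>w\<close> may be replaced by the translate nearest to \<open>0\<close>; then every factor
  \<open>1 - w / a\<close> of the product has absolute value \<open>max 1 |w / a|\<close>.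
\<close>

lemma abs_ex_ge:
  assumes w: "im w \<ge> 1"
  shows "abs_val \<omega> * im w ^ (q ^ L) \<le> abs_val (ex (\<omega> * w)) * (\<Prod>a\<in>polys_lt L - {0}. abs_val (emb a))"
proof -
  obtain a0 where a0: "abs_val (w - emb a0) = im w" using im_attained_emb[OF w] by blast
  define v where "v = w - emb a0"
  have v: "abs_val v = im w" by (simp add: v_def a0)
  have "\<omega> * w = \<omega> * v + \<omega> * emb a0" by (simp add: v_def algebra_simps)
  then have ex: "ex (\<omega> * w) = ex (\<omega> * v)" by (simp add: ex_add ex_omega_emb)
  have ge: "abs_val (emb a - v) \<ge> abs_val v" "abs_val (emb a - v) \<ge> abs_val (emb a)" for a
  proof -
    have "im w \<le> abs_val (w - emb (a0 + a))" by (rule im_le_emb)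
    also have "w - emb (a0 + a) = - (emb a - v)" by (simp add: v_def emb_add)
    finally show 1: "abs_val (emb a - v) \<ge> abs_val v" unfolding v abs_val_minus .
    show "abs_val (emb a - v) \<ge> abs_val (emb a)"
      using 1 abs_val_diff_eq_left[of v "emb a"] by (cases "abs_val v < abs_val (emb a)") auto
  qed
  let ?P = "\<Prod>a\<in>polys_lt L - {0}. abs_val (emb a)"
  have "abs_val \<omega> * im w ^ (q ^ L) \<le> abs_val (poly (exp_lt M) (\<omega> * v)) * ?P" if "M \<ge> L" for M
  proof -
    have fac: "abs_val (1 - v / emb a) = abs_val (emb a - v) / abs_val (emb a)" if "a \<noteq> 0" for a
    proof -
      have "1 - v / emb a = (emb a - v) / emb a" using that by (simp add: field_simps)
      then show ?thesis by (simp add: abs_val_divide)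
    qed
    have "abs_val v ^ card (polys_lt L - {0 :: 'f poly}) = (\<Prod>a\<in>polys_lt L - {0 :: 'f poly}. abs_val v)"
      by simp
    also have "\<dots> \<le> (\<Prod>a\<in>polys_lt L - {0}. abs_val (1 - v / emb a) * abs_val (emb a))"
      using ge(1) by (intro prod_mono) (auto simp: fac)
    also have "\<dots> = (\<Prod>a\<in>polys_lt L - {0}. abs_val (1 - v / emb a)) * ?P"
      by (rule prod.distrib)
    also have "(\<Prod>a\<in>polys_lt L - {0}. abs_val (1 - v / emb a)) \<le>
        (\<Prod>a\<in>polys_lt L - {0}. abs_val (1 - v / emb a)) * (\<Prod>a\<in>polys_lt M - polys_lt L. abs_val (1 - v / emb a))"
    proof -
      have "1 \<le> (\<Prod>a\<in>polys_lt M - polys_lt L. abs_val (1 - v / emb a))"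
      proof (intro prod_ge_1)
        fix a :: "'f poly" assume "a \<in> polys_lt M - polys_lt L"
        then have "a \<noteq> 0" by auto
        then show "1 \<le> abs_val (1 - v / emb a)"
          using ge(2)[of a] by (simp add: fac)
      qed
      then show ?thesis
        using mult_left_mono[of 1 _ "\<Prod>a\<in>polys_lt L - {0}. abs_val (1 - v / emb a)"] by (simp add: prod_nonneg)
    qed
    also have "\<dots> = (\<Prod>a\<in>polys_lt M - {0}. abs_val (1 - v / emb a))"
    proof -
      have split: "polys_lt M - {0 :: 'f poly} = (polys_lt L - {0}) \<union> (polys_lt M - polys_lt L)"
        using polys_lt_mono[OF that] by auto
      show ?thesis unfolding split by (subst prod.union_disjoint) auto
    qed
    finally have *: "abs_val v ^ card (polys_lt L - {0::'f poly}) \<le> (\<Prod>a\<in>polys_lt M - {0}. abs_val (1 - v / emb a)) * ?P"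
      by (simp add: mult_right_mono prod_nonneg)
    \<comment> \<open>The nonzero polynomials account for \<open>q^L - 1\<close> factors
      \<open>|v|\<close>; the factor \<open>\<omega> * v\<close> in front of the product supplies
      the last one.\<close>
    have card: "q ^ L = Suc (card (polys_lt L - {0::'f poly}))"
      using q_gt_1 by (simp add: card_polys_lt card_field)
    have "abs_val \<omega> * im w ^ (q ^ L) = abs_val \<omega> * abs_val v * abs_val v ^ card (polys_lt L - {0::'f poly})"
      unfolding card v by simp
    also have "\<dots> \<le> abs_val \<omega> * abs_val v * ((\<Prod>a\<in>polys_lt M - {0}. abs_val (1 - v / emb a)) * ?P)"
      by (intro mult_left_mono *) simp
    also have "\<dots> = abs_val (poly (exp_lt M) (\<omega> * v)) * ?P"
      by (simp add: poly_exp_lt abs_val_mult abs_val_prod)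
    finally show ?thesis .
  qed
  then have ev: "\<forall>\<^sub>F M in sequentially. abs_val \<omega> * im w ^ (q ^ L) \<le> abs_val (poly (exp_lt M) (\<omega> * v)) * ?P"
    by (auto simp: eventually_at_top_linorder)
  have "(\<lambda>M. abs_val (poly (exp_lt M) (\<omega> * v)) * ?P) \<longlonglongrightarrow> abs_val (ex (\<omega> * v)) * ?P"
    by (intro tendsto_intros tendsto_abs_val exp_lt_tendsto)
  from tendsto_lowerbound[OF this ev] show ?thesis unfolding ex by simp
qed

text \<open>The exponent \<open>q^L\<close> is at our disposal: later it is chosen to outweigh the
  growth of \<open>a^K\<close>.\<close>

lemma t_bound: "\<exists>C>0. \<forall>w. im w \<ge> 1 \<longrightarrow> abs_val (t w) \<le> C / im w ^ (q ^ L)"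
proof -
  define P where "P = (\<Prod>a\<in>polys_lt L - {0}. abs_val (emb a))"
  have P: "P > 0" unfolding P_def by (intro prod_pos) auto
  have "abs_val (t w) \<le> (P / abs_val \<omega>) / im w ^ (q ^ L)" if w: "im w \<ge> 1" for w
  proof -
    have "ex (\<omega> * w) \<noteq> 0" using w im_pos_iff[of w] by (intro ex_omega_nonzero) simp
    moreover have "abs_val \<omega> * im w ^ (q ^ L) \<le> abs_val (ex (\<omega> * w)) * P"
      unfolding P_def by (rule abs_ex_ge[OF w])
    ultimately show ?thesis using P w
      by (simp add: t_param_def abs_val_divide field_simps)
  qed
  then show ?thesis using P by (intro exI[of _ "P / abs_val \<omega>"]) simp
qed

lemma t_nonzero: "w \<in> \<Omega> \<Longrightarrow> t w \<noteq> 0"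
  using ex_omega_nonzero[of w] by (simp add: t_param_def)

text \<open>\<open>t\<close> never vanishes on the upper half plane but tends to zero along
  \<open>T^m z\<close>, so finitely many values are impossible. A polynomial is therefore determined
  by its values at \<open>t z\<close>, which makes the Goss polynomial unique.\<close>

lemma infinite_t_values: "infinite (t ` \<Omega>)"
proof
  assume fin: "finite (t ` \<Omega>)"
  obtain z where z: "im z > 0" using exists_im_pos by blast
  obtain C where C: "C > 0" "\<And>w. im w \<ge> 1 \<Longrightarrow> abs_val (t w) \<le> C / im w ^ (q ^ 0)"
    using t_bound[of 0] by blast
  define S where "S = abs_val ` t ` \<Omega>"
  have S: "finite S" "S \<noteq> {}" "\<And>x. x \<in> S \<Longrightarrow> x > 0"
    using fin z t_nonzero unfolding S_def im_pos_iff by auto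
  define \<delta> where "\<delta> = Min S"
  have d: "\<delta> > 0" using S by (simp add: \<delta>_def)
  obtain m where m: "max 1 (C / \<delta> + 1) / im z < real q ^ m" using ex_q_power_gt by blast
  have "emb ([:0, 1:] ^ m) = T ^ m" by (simp add: emb_power emb_T)
  then have "im (T ^ m * z) \<ge> real q ^ m * im z"
    using im_emb_mult[of "[:0, 1:] ^ m" z] by (simp add: abs_val_power abs_T)
  moreover have "real q ^ m * im z > max 1 (C / \<delta> + 1)"
    using m z by (simp add: field_simps)
  ultimately have im: "im (T ^ m * z) > max 1 (C / \<delta> + 1)" by linarith
  then have "abs_val (t (T ^ m * z)) \<le> C / im (T ^ m * z)"
    using C(2)[of "T ^ m * z"] by simp
  also have "\<dots> < \<delta>"
  proof -
    have "im (T ^ m * z) > C / \<delta>" "im (T ^ m * z) > 0" using im by linarith+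
    then show ?thesis using d by (simp add: field_simps)
  qed
  finally have "abs_val (t (T ^ m * z)) < \<delta>" .
  moreover have "abs_val (t (T ^ m * z)) \<in> S"
    unfolding S_def using im im_pos_iff[of "T ^ m * z"] by (intro imageI) simp
  ultimately show False unfolding \<delta>_def using S(1) by (meson Min_le not_less)
qed

section \<open>Power series coefficients of the Carlitz exponential\<close>

lemma abs_coeff_exp_lt: "abs_val (coeff (exp_lt M) (Suc i)) \<le> (1 / abs_val \<omega>) ^ i"
  unfolding exp_lt_def using UN_lattice_lt
  by (intro exp_poly_coeff_bound) (auto intro!: divide_left_mono abs_lattice_ge_omega)

definition exp_coeff :: "nat \<Rightarrow> 'c" where
  "exp_coeff i = lim (\<lambda>M. coeff (exp_lt M) i)"

lemma exp_coeff_tendsto: "(\<lambda>M. coeff (exp_lt M) i) \<longlonglongrightarrow> exp_coeff i"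
proof -
  have "convergent (\<lambda>M. coeff (exp_lt M) i)"
  proof (cases i)
    case 0
    then show ?thesis by (simp add: exp_lt_def convergent_const)
  next
    case (Suc j)
    show ?thesis
    proof (rule Cauchy_if_abs_val_diff_le)
      fix m n :: nat assume "m \<le> n"
      \<comment> \<open>New lattice points satisfy \<open>|\<mu>| >= |\<omega>| q^m\<close>, whence
        \<open>q^(-m)\<close> in the role of \<open>\<delta>\<close> with
        \<open>s = 1 / |\<omega>|\<close>.\<close>
      show "abs_val (coeff (exp_lt n) i - coeff (exp_lt m) i) \<le> inverse (real q) ^ m * (1 / abs_val \<omega>) ^ j"
        unfolding exp_lt_def Suc
      proof (rule exp_poly_coeff_diff)
        show "lattice_lt m \<subseteq> lattice_lt n" by (rule lattice_lt_mono) fact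
        show "inverse (real q) ^ m \<le> 1" using q_gt_1 by (intro power_le_one) (auto simp: inverse_le_1_iff)
        show "1 / abs_val \<mu> \<le> 1 / abs_val \<omega>" if "\<mu> \<in> lattice_lt m - {0}" for \<mu>
          using that UN_lattice_lt by (intro divide_left_mono abs_lattice_ge_omega) auto
        show "1 / abs_val \<mu> \<le> 1 / abs_val \<omega> * inverse (real q) ^ m" if "\<mu> \<in> lattice_lt n - lattice_lt m" for \<mu>
        proof -
          have "abs_val \<omega> * real q ^ m \<le> abs_val \<mu>"
            using that UN_lattice_lt by (intro abs_lattice_ge) auto
          moreover have "abs_val \<omega> * real q ^ m > 0" using q_gt_1 by simp
          ultimately show ?thesis
            using frac_le[of 1 1 "abs_val \<omega> * real q ^ m" "abs_val \<mu>"]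
            by (simp add: inverse_eq_divide power_divide)
        qed
      qed (use finite_subgroupD[OF subgroup_lattice_lt] in auto)
    next
      have "(\<lambda>m. inverse (real q) ^ m) \<longlonglongrightarrow> 0"
        using q_gt_1 by (intro LIMSEQ_realpow_zero) (auto simp: inverse_less_1_iff)
      then show "(\<lambda>m. inverse (real q) ^ m * (1 / abs_val \<omega>) ^ j) \<longlonglongrightarrow> 0"
        by (intro tendsto_mult_left_zero)
    qed
  qed
  then show ?thesis unfolding exp_coeff_def by (simp add: convergent_LIMSEQ_iff)
qed

section \<open>Inverse power sums over the lattice and Goss polynomials\<close>

abbreviation inv_power :: "nat \<Rightarrow> 'c \<Rightarrow> 'f poly \<Rightarrow> 'c" where
  "inv_power n z b \<equiv> 1 / (\<omega> * z + \<omega> * emb b) ^ n"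

abbreviation G :: "nat \<Rightarrow> 'c poly" where "G \<equiv> goss exp_coeff"

text \<open>Far out one has \<open>|z + b| = |b|\<close>. The cutoff \<open>M\<close> is uniform on
  \<open>|z| <= R\<close>, as approximation on an affinoid requires.\<close>

lemma inverse_power_tail:
  assumes n: "n > 0" and e: "\<epsilon> > 0"
  shows "\<exists>M. \<forall>z b. abs_val z \<le> R \<longrightarrow> b \<notin> polys_lt M \<longrightarrow> abs_val (inv_power n z b) < \<epsilon>"
proof -
  obtain M where M: "max R (max (1 / abs_val \<omega>) (1 / (abs_val \<omega> * \<epsilon>))) < real q ^ M"
    using ex_q_power_gt by blast
  have "abs_val (inv_power n z b) < \<epsilon>" if "abs_val z \<le> R" "b \<notin> polys_lt M" for z b
  proof -
    have b: "real q ^ M \<le> abs_val (emb b)" by (rule abs_emb_ge[OF that(2)])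
    then have "abs_val (emb b + z) = abs_val (emb b)"
      using that M by (intro abs_val_add_eq_left) linarith
    moreover have "\<omega> * z + \<omega> * emb b = \<omega> * (emb b + z)" by (simp add: algebra_simps)
    ultimately have eq: "abs_val (\<omega> * z + \<omega> * emb b) = abs_val \<omega> * abs_val (emb b)"
      by (simp add: abs_val_mult)
    have gt: "abs_val \<omega> * abs_val (emb b) > 1" "abs_val \<omega> * abs_val (emb b) > 1 / \<epsilon>"
    proof -
      have "abs_val (emb b) > 1 / abs_val \<omega>" "abs_val (emb b) > 1 / (abs_val \<omega> * \<epsilon>)"
        using b M by linarith+
      then show "abs_val \<omega> * abs_val (emb b) > 1" "abs_val \<omega> * abs_val (emb b) > 1 / \<epsilon>"
        using e by (simp_all add: field_simps)
    qed
    have "abs_val \<omega> * abs_val (emb b) \<le> (abs_val \<omega> * abs_val (emb b)) ^ n"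
      using gt n power_increasing[of 1 n "abs_val \<omega> * abs_val (emb b)"] by simp
    then have "1 / \<epsilon> < (abs_val \<omega> * abs_val (emb b)) ^ n" using gt by linarith
    moreover have "0 < (abs_val \<omega> * abs_val (emb b)) ^ n" using gt by (intro zero_less_power) linarith
    ultimately show ?thesis
      using e unfolding abs_val_divide abs_val_power eq by (simp add: field_simps)
  qed
  then show ?thesis by blast
qed

lemma null_family_inverse_power:
  assumes "n > 0"
  shows "null_family (\<lambda>b. inv_power n z b) UNIV"
proof (rule null_family_polys)
  fix \<epsilon> :: real assume "\<epsilon> > 0"
  from inverse_power_tail[OF assms this, of "abs_val z"]
  show "\<exists>M. \<forall>b\<in>UNIV. b \<notin> polys_lt M \<longrightarrow> abs_val (inv_power n z b) < \<epsilon>" by blast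
qed

lemma infsum_inverse_power_tendsto:
  assumes "n > 0"
  shows "(\<lambda>M. \<Sum>b\<in>polys_lt M. inv_power n z b)
    \<longlonglongrightarrow> (\<Sum>\<^sub>\<infinity>b\<in>UNIV. inv_power n z b)"
proof (rule infsum_exhausting_tendsto[OF null_family_inverse_power[OF assms]])
  show "polys_lt M \<subseteq> polys_lt (Suc M)" for M by (rule polys_lt_mono) simp
qed (auto simp: UN_polys_lt)

lemma infsum_inverse_power:
  assumes z: "z \<in> \<Omega>" and n: "n > 0"
  shows "(\<Sum>\<^sub>\<infinity>b\<in>UNIV. inv_power n z b) = poly (G n) (t z)"
proof (rule LIMSEQ_unique[OF infsum_inverse_power_tendsto[OF n]])
  have "(\<Sum>b\<in>polys_lt M. inv_power n z b)
      = poly (goss (coeff (exp_lt M)) n) (1 / poly (exp_lt M) (\<omega> * z))" for M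
  proof -
    have "(\<Sum>b\<in>polys_lt M. inv_power n z b) = (\<Sum>b\<in>polys_lt M. 1 / (\<omega> * z - \<omega> * emb b) ^ n)"
      by (rule sum.reindex_bij_witness[of _ uminus uminus]) (auto simp: emb_minus polys_lt_iff)
    also have "\<dots> = (\<Sum>\<mu>\<in>lattice_lt M. 1 / (\<omega> * z - \<mu>) ^ n)"
      unfolding lattice_lt_def by (subst sum.reindex[OF inj_omega_emb]) simp
    also have "\<dots> = poly (goss (coeff (exp_lt M)) n) (1 / poly (exp_lt M) (\<omega> * z))"
      unfolding exp_lt_def
      using z emb_in_range
      by (intro sum_inverse_power_eq_goss[OF subgroup_lattice_lt _ n])
        (auto simp: lattice_lt_def upper_half_plane_def)
    finally show ?thesis .
  qed
  moreover have "(\<lambda>M. 1 / poly (exp_lt M) (\<omega> * z)) \<longlonglongrightarrow> t z"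
    unfolding t_param_def divide_inverse mult_1
    by (intro tendsto_inverse_nonarch exp_lt_tendsto ex_omega_nonzero z)
  ultimately show "(\<lambda>M. \<Sum>b\<in>polys_lt M. inv_power n z b) \<longlonglongrightarrow> poly (G n) (t z)"
    by (simp add: goss_tendsto exp_coeff_tendsto)
qed

lemma goss_poly_eq:
  assumes n: "n > 0"
  shows "goss_poly \<iota> \<omega> n = G n"
  unfolding goss_poly_def
proof (rule the_equality)
  show "\<forall>z\<in>\<Omega>. poly (G n) (t z) = (\<Sum>\<^sub>\<infinity>b\<in>UNIV. inv_power n z b)"
    using infsum_inverse_power[OF _ n] by simp
  fix P assume P: "\<forall>z\<in>\<Omega>. poly P (t z) = (\<Sum>\<^sub>\<infinity>b\<in>UNIV. inv_power n z b)"
  have "t ` \<Omega> \<subseteq> {x. poly (P - G n) x = 0}"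
    using P infsum_inverse_power[OF _ n] by auto
  then have "infinite {x. poly (P - G n) x = 0}" using infinite_t_values finite_subset by blast
  then have "P - G n = 0" using poly_roots_finite by blast
  then show "P = G n" by simp
qed

end

section \<open>Behaviour of the A-expansion under inversion\<close>

text \<open>\<open>D^2\<close> is the number of geometric terms that will be kept in
  \<open>power_sum_tail\<close>. It is small enough for the degree \<open>K + n * D^2\<close> to
  stay below \<open>q^D\<close>, and large enough for \<open>\<rho>^(D^2)\<close> to beat every
  exponential \<open>x^D\<close>.\<close>

lemma eventually_quadratic_less_power:
  fixes q :: nat
  assumes "q > 1"
  shows "\<forall>\<^sub>F D in sequentially. K + n * D\<^sup>2 + 1 < q ^ D"
proof -
  have "((\<lambda>D::nat. (real K + real n * real D ^ 2 + 1) / 2 ^ D) \<longlongrightarrow> 0) at_top"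
    by real_asymp
  then have "\<forall>\<^sub>F D::nat in sequentially. (real K + real n * real D ^ 2 + 1) / 2 ^ D < 1"
    by (rule order_tendstoD(2)) simp
  then show ?thesis
  proof eventually_elim
    case (elim D)
    then have "real (K + n * D\<^sup>2 + 1) < real (2 ^ D)" by (simp add: divide_less_eq_1)
    then have "K + n * D\<^sup>2 + 1 < 2 ^ D" by (simp only: of_nat_less_iff)
    also have "(2::nat) ^ D \<le> q ^ D" using assms by (intro power_mono) auto
    finally show ?case .
  qed
qed

lemma power_mult_superpower_tendsto_0:
  fixes x \<rho> :: real
  assumes "x \<ge> 0" "0 \<le> \<rho>" "\<rho> < 1"
  shows "(\<lambda>D. x ^ D * \<rho> ^ (D\<^sup>2)) \<longlonglongrightarrow> 0"
proof -
  have "(\<lambda>D. x * \<rho> ^ D) \<longlonglongrightarrow> x * 0"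
    using assms by (intro tendsto_mult tendsto_const LIMSEQ_realpow_zero) auto
  then have "\<forall>\<^sub>F D in sequentially. x * \<rho> ^ D < 1 / 2"
    by (intro order_tendstoD(2)) auto
  then have ev: "\<forall>\<^sub>F D in sequentially. x ^ D * \<rho> ^ (D\<^sup>2) \<le> (1 / 2) ^ D"
  proof eventually_elim
    case (elim D)
    have "x ^ D * \<rho> ^ (D\<^sup>2) = (x * \<rho> ^ D) ^ D"
      by (simp add: power_mult_distrib power2_eq_square power_mult)
    also have "\<dots> \<le> (1 / 2) ^ D" using elim assms by (intro power_mono) auto
    finally show ?case .
  qed
  show ?thesis
    by (rule tendsto_sandwich[OF _ ev tendsto_const LIMSEQ_realpow_zero])
      (use assms in \<open>auto intro!: always_eventually\<close>)
qed

context carlitz begin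

definition monic :: "'f poly set" where "monic = {a. lead_coeff a = 1}"

abbreviation A_term :: "nat \<Rightarrow> nat \<Rightarrow> 'c \<Rightarrow> 'f poly \<Rightarrow> 'c" where
  "A_term K n z a \<equiv> emb a ^ K * poly (G n) (t (emb a * z))"

definition A_exp :: "nat \<Rightarrow> nat \<Rightarrow> 'c \<Rightarrow> 'c" where
  "A_exp K n z = (\<Sum>\<^sub>\<infinity>a\<in>monic. A_term K n z a)"

lemma F_form_eq_A_exp: "n > 0 \<Longrightarrow> F_form \<iota> \<omega> k n l z = A_exp ((k - n) * q ^ l) n z"
  by (simp add: F_form_def A_exp_def goss_poly_eq monic_def card_field)

text \<open>Since \<open>t\<close> decays at least like the power \<open>K + 1\<close> of
  \<open>im (a z)\<close>, it outweighs \<open>a^K\<close> by one factor \<open>|a|\<close>. The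
  cutoff is uniform on \<open>im z >= r\<close>, again with the affinoids in view.\<close>

lemma A_exp_tail:
  assumes r: "r > 0" and e: "\<epsilon> > 0"
  shows "\<exists>D. \<forall>z a. r \<le> im z \<longrightarrow> a \<notin> polys_lt D \<longrightarrow> abs_val (A_term K n z a) < \<epsilon>"
proof -
  obtain B where B: "B > 0" "\<And>x. abs_val x \<le> 1 \<Longrightarrow> abs_val (poly (G n) x) \<le> B * abs_val x"
    using poly_bound[of "G n"] by auto
  define N where "N = q ^ Suc K"
  have "Suc K < 2 ^ Suc K" by (rule less_exp)
  also have "(2::nat) ^ Suc K \<le> N" unfolding N_def using q_gt_1 by (intro power_mono) auto
  finally have N: "Suc K \<le> N" by simp
  obtain C where C: "C > 0" "\<And>w. im w \<ge> 1 \<Longrightarrow> abs_val (t w) \<le> C / im w ^ N"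
    using t_bound[of "Suc K"] unfolding N_def by blast
  \<comment> \<open>The first bound gives \<open>|a| r > 1\<close>, so powers grow with the
    exponent. The second brings \<open>t\<close> into the unit disc, where the bound on the Goss
    polynomial holds. The third is the final estimate by \<open>\<epsilon>\<close>.\<close>
  obtain D where D: "max (1 / r) (max (C / r) (B * C / (r ^ Suc K * \<epsilon>))) < real q ^ D"
    using ex_q_power_gt by blast
  have "abs_val (A_term K n z a) < \<epsilon>"
    if z: "r \<le> im z" and a: "a \<notin> polys_lt D" for z a
  proof -
    define A where "A = abs_val (emb a)"
    have "real q ^ D \<le> A" unfolding A_def by (rule abs_emb_ge[OF a])
    then have A': "A > 1 / r" "A > C / r" "A > B * C / (r ^ Suc K * \<epsilon>)" using D by linarith+
    then have A: "A * r > 1" "A * r > C" "A * (r ^ Suc K * \<epsilon>) > B * C"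
      using r e by (simp_all add: field_simps)
    have "A * r \<le> A * im z" using z by (intro mult_left_mono) (simp_all add: A_def)
    also have "\<dots> \<le> im (emb a * z)" unfolding A_def by (rule im_emb_mult)
    finally have im: "A * r \<le> im (emb a * z)" .
    have A_pos: "A > 0" using A'(1) r by (meson less_trans zero_less_divide_1_iff)
    have "abs_val (t (emb a * z)) \<le> C / im (emb a * z) ^ N" using im A by (intro C) linarith
    also have "\<dots> \<le> C / (A * r) ^ N"
      using im A A_pos r C by (intro divide_left_mono power_mono mult_pos_pos zero_less_power) auto
    also have "\<dots> \<le> C / (A * r) ^ Suc K"
      using A A_pos r C N by (intro divide_left_mono power_increasing mult_pos_pos zero_less_power) auto
    finally have t: "abs_val (t (emb a * z)) \<le> C / (A * r) ^ Suc K" .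
    have "A * r \<le> (A * r) ^ Suc K" using A power_increasing[of 1 "Suc K" "A * r"] by simp
    then have "C / (A * r) ^ Suc K \<le> 1" using A by (simp add: divide_le_eq_1)
    then have "abs_val (poly (G n) (t (emb a * z))) \<le> B * abs_val (t (emb a * z))"
      using t by (intro B) linarith
    also have "\<dots> \<le> B * (C / (A * r) ^ Suc K)" using B t by (intro mult_left_mono) auto
    finally have "abs_val (A_term K n z a) \<le> A ^ K * (B * (C / (A * r) ^ Suc K))"
      unfolding abs_val_mult abs_val_power A_def by (intro mult_left_mono) auto
    also have "\<dots> = B * C / (A * r ^ Suc K)"
      using A_pos r by (simp add: field_simps power_mult_distrib)
    also have "\<dots> < \<epsilon>"
      using A(3) A_pos r by (simp add: field_simps)
    finally show ?thesis .
  qed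
  then show ?thesis by blast
qed

lemma null_family_A_exp:
  assumes z: "z \<in> \<Omega>"
  shows "null_family (\<lambda>a. A_term K n z a) A"
proof (rule null_family_polys)
  fix \<epsilon> :: real assume "\<epsilon> > 0"
  from A_exp_tail[OF _ this, of "im z" K n]
  show "\<exists>M. \<forall>a\<in>A. a \<notin> polys_lt M \<longrightarrow> abs_val (A_term K n z a) < \<epsilon>"
    using z unfolding im_pos_iff[symmetric] by blast
qed

lemma A_exp_tendsto:
  assumes z: "z \<in> \<Omega>"
  shows "(\<lambda>D. \<Sum>a\<in>polys_lt D \<inter> monic. A_term K n z a) \<longlonglongrightarrow> A_exp K n z"
  unfolding A_exp_def
proof (rule infsum_exhausting_tendsto[OF null_family_A_exp[OF z]])
  show "polys_lt M \<inter> monic \<subseteq> polys_lt (Suc M) \<inter> monic" for M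
    using polys_lt_mono[of M "Suc M"] by auto
qed (use UN_polys_lt in auto)

section \<open>Homotheties by constants and the sum over all polynomials\<close>

abbreviation \<kappa> :: "'f \<Rightarrow> 'c" where "\<kappa> c \<equiv> \<iota> (fls_const c)"

lemma kappa_mult: "\<kappa> (c * d) = \<kappa> c * \<kappa> d"
  by (simp flip: fls_const_mult_const add: iota_mult)

lemma kappa_power: "\<kappa> (c ^ n) = \<kappa> c ^ n"
  by (induction n) (simp_all add: kappa_mult)

lemma kappa_power_q_minus_1: "c \<noteq> 0 \<Longrightarrow> \<kappa> c ^ (q - 1) = 1"
  using finite_field_power_card_minus_1[of c] by (simp flip: kappa_power add: card_field)

lemma kappa_power_eq_1: "c \<noteq> 0 \<Longrightarrow> q - 1 dvd j \<Longrightarrow> \<kappa> c ^ j = 1"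
  by (auto elim!: dvdE simp: power_mult kappa_power_q_minus_1 simp del: One_nat_def)

lemma of_nat_q: "of_nat q = (0::'c)"
proof -
  have "\<kappa> (of_nat j) = of_nat j" for j
  proof (induction j)
    case (Suc j)
    have "fls_const (1 + of_nat j) = 1 + fls_const (of_nat j :: 'f)" by (rule fls_eqI) simp
    then show ?case using Suc by (simp add: iota_add)
  qed simp
  from this[of q] show ?thesis
    using of_nat_card_finite_field[where 'f = 'f] by (simp add: card_field)
qed

lemma emb_mult_Omega: "z \<in> \<Omega> \<Longrightarrow> a \<noteq> 0 \<Longrightarrow> emb a * z \<in> \<Omega>"
  using im_emb_mult[of a z] unfolding im_pos_iff[symmetric]
  by (smt (verit) abs_emb_ge_1 mult_pos_pos)

text \<open>The substitution \<open>b -> c b\<close> permutes the polynomials of bounded degree, and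
  it pulls a factor \<open>c\<close> out of each \<open>c w + c b\<close>.\<close>

lemma G_t_const_mult:
  assumes w: "w \<in> \<Omega>" and c: "c \<noteq> 0" and n: "n > 0"
  shows "poly (G n) (t (\<kappa> c * w)) = poly (G n) (t w) / \<kappa> c ^ n"
proof -
  have kw: "\<kappa> c * w \<in> \<Omega>" using emb_mult_Omega[OF w, of "[:c:]"] c by (simp add: emb_const)
  have k_inv: "\<kappa> c * \<kappa> (inverse c) = 1" using c by (simp flip: kappa_mult)
  have "(\<Sum>b\<in>polys_lt M. 1 / (\<omega> * (\<kappa> c * w) + \<omega> * emb b) ^ n)
      = (\<Sum>b\<in>polys_lt M. 1 / (\<omega> * w + \<omega> * emb b) ^ n) * (1 / \<kappa> c ^ n)" for M
  proof -
    have "(\<Sum>b\<in>polys_lt M. 1 / (\<omega> * (\<kappa> c * w) + \<omega> * emb b) ^ n)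
        = (\<Sum>b\<in>polys_lt M. 1 / (\<omega> * (\<kappa> c * w) + \<omega> * emb (smult c b)) ^ n)"
      by (rule sum.reindex_bij_witness[of _ "smult c" "smult (inverse c)"])
        (use c in \<open>auto simp: polys_lt_smult\<close>)
    also have "\<dots> = (\<Sum>b\<in>polys_lt M. 1 / (\<omega> * w + \<omega> * emb b) ^ n * (1 / \<kappa> c ^ n))"
    proof (intro sum.cong refl)
      fix b
      have "\<omega> * (\<kappa> c * w) + \<omega> * emb (smult c b) = (\<omega> * w + \<omega> * emb b) * \<kappa> c"
        by (simp add: emb_smult algebra_simps)
      then show "1 / (\<omega> * (\<kappa> c * w) + \<omega> * emb (smult c b)) ^ n
          = 1 / (\<omega> * w + \<omega> * emb b) ^ n * (1 / \<kappa> c ^ n)"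
        by (simp add: power_mult_distrib)
    qed
    finally show ?thesis by (simp add: sum_divide_distrib)
  qed
  then have "(\<lambda>M. \<Sum>b\<in>polys_lt M. 1 / (\<omega> * (\<kappa> c * w) + \<omega> * emb b) ^ n)
      \<longlonglongrightarrow> poly (G n) (t w) * (1 / \<kappa> c ^ n)"
    using tendsto_mult_nonarch[OF infsum_inverse_power_tendsto[OF n, of w] tendsto_const, of "1 / \<kappa> c ^ n"]
    by (simp add: infsum_inverse_power[OF w n])
  from LIMSEQ_unique[OF infsum_inverse_power_tendsto[OF n, of "\<kappa> c * w"] this]
  show ?thesis by (simp add: infsum_inverse_power[OF kw n])
qed

text \<open>Each nonzero polynomial is a constant times a monic one, and the \<open>q - 1\<close>
  constants count as \<open>-1\<close> in characteristic \<open>p\<close>. Sums over all polynomials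
  are needed because power sums vanish over subgroups only.\<close>

lemma sum_monic:
  fixes g :: "'f poly \<Rightarrow> 'c"
  assumes g0: "g 0 = 0" and g: "\<And>c a. c \<noteq> 0 \<Longrightarrow> a \<in> monic \<Longrightarrow> g (smult c a) = g a"
  shows "(\<Sum>a\<in>polys_lt D. g a) = - (\<Sum>a\<in>polys_lt D \<inter> monic. g a)"
proof -
  have "(\<Sum>a\<in>polys_lt D. g a) = (\<Sum>a\<in>polys_lt D - {0}. g a)"
    using g0 by (intro sum.mono_neutral_right) auto
  also have "\<dots> = (\<Sum>(c, a)\<in>(UNIV - {0 :: 'f}) \<times> (polys_lt D \<inter> monic). g a)"
  proof (rule sum.reindex_bij_witness[of _ "\<lambda>(c, a :: 'f poly). smult c a"
        "\<lambda>a :: 'f poly. (lead_coeff a, smult (inverse (lead_coeff a)) a)"])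
    fix a :: "'f poly" assume "a \<in> polys_lt D - {0}"
    then have a: "a \<noteq> 0" "a \<in> polys_lt D" by auto
    then show m: "(lead_coeff a, smult (inverse (lead_coeff a)) a) \<in> (UNIV - {0}) \<times> (polys_lt D \<inter> monic)"
      by (auto simp: monic_def polys_lt_smult)
    show "(case (lead_coeff a, smult (inverse (lead_coeff a)) a) of (c, a) \<Rightarrow> g a) = g a"
      using m g[of "lead_coeff a" "smult (inverse (lead_coeff a)) a"] a by simp
  qed (auto simp: monic_def polys_lt_smult)
  also have "\<dots> = (\<Sum>c\<in>UNIV - {0::'f}. \<Sum>a\<in>polys_lt D \<inter> monic. g a)"
    by (rule sum.cartesian_product[symmetric])
  also have "\<dots> = of_nat (q - 1) * (\<Sum>a\<in>polys_lt D \<inter> monic. g a)"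
    by (simp add: card_field)
  also have "of_nat (q - 1) = (- 1 :: 'c)"
    using q_gt_1 of_nat_q by simp
  finally show ?thesis by simp
qed

lemma sum_all_tendsto:
  assumes z: "z \<in> \<Omega>" and n: "n > 0" and K: "n \<le> K" "q - 1 dvd K - n"
  shows "(\<lambda>D. \<Sum>a\<in>polys_lt D. A_term K n z a) \<longlonglongrightarrow> - A_exp K n z"
proof -
  have "emb (smult c a) ^ K * poly (G n) (t (emb (smult c a) * z)) = A_term K n z a"
    if c: "c \<noteq> 0" and a: "a \<in> monic" for c a
  proof -
    have az: "emb a * z \<in> \<Omega>" using a z by (intro emb_mult_Omega) (auto simp: monic_def)
    \<comment> \<open>The divisibility of \<open>K - n\<close> by \<open>q - 1\<close> makes
      \<open>c^K\<close> cancel the factor \<open>c^n\<close> from the homothety.\<close>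
    have "\<kappa> c ^ K = \<kappa> c ^ (K - n) * \<kappa> c ^ n" using K(1) by (simp flip: power_add)
    then have "\<kappa> c ^ K = \<kappa> c ^ n" using kappa_power_eq_1[OF c K(2)] by simp
    then show ?thesis
      using G_t_const_mult[OF az c n] c by (simp add: emb_smult mult.assoc power_mult_distrib)
  qed
  from sum_monic[OF _ this] n K(1) show ?thesis
    using tendsto_uminus_nonarch[OF A_exp_tendsto[OF z]] by (simp add: power_0_left)
qed

text \<open>With \<open>y a = - a z / b\<close> the summand is \<open>a^K / (1 - y a)^n\<close> up
  to the factor \<open>b^n\<close>. The first \<open>J\<close> terms of the geometric series form a
  polynomial \<open>P\<close> in \<open>a\<close>, and \<open>a^K P^n\<close> has too small a degree
  to have a nonzero sum. Subtracting it leaves an error \<open>\<rho>^J\<close>, while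
  \<open>|a|^K\<close> costs at most \<open>q^(K D)\<close> and dividing by \<open>b^n\<close> does
  not enlarge anything.\<close>

lemma power_sum_tail:
  assumes b: "b \<noteq> 0" and rho: "0 \<le> \<rho>" "\<rho> < 1"
    and le: "\<And>a. a \<in> polys_lt D \<Longrightarrow> abs_val (emb a * z) \<le> \<rho> * abs_val (emb b)"
    and card: "K + n * J + 1 < q ^ D"
  shows "abs_val (\<Sum>a\<in>polys_lt D. emb a ^ K / (emb a * z + emb b) ^ n) \<le> (real q ^ K) ^ D * \<rho> ^ J"
proof -
  define y where "y a = - (emb a * z) / emb b" for a
  define P where "P = (\<Sum>i<J. [:0, - z / emb b:] ^ i)"
  have poly_P: "poly P (emb a) = (\<Sum>i<J. y a ^ i)" for a
    by (simp add: P_def poly_sum y_def)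
  have y: "abs_val (y a) \<le> \<rho>" if "a \<in> polys_lt D" for a
    using le[OF that] b by (simp add: y_def abs_val_divide divide_le_eq)
  have "degree P \<le> J"
    unfolding P_def
  proof (rule degree_sum_le)
    fix i assume "i \<in> {..<J}"
    then show "degree ([:0, - z / emb b:] ^ i) \<le> J"
      using degree_power_le[of "[:0, - z / emb b:]" i] by (auto split: if_splits)
  qed simp
  then have "degree (P ^ n) \<le> n * J"
    by (intro order_trans[OF degree_power_le]) (simp add: mult.commute)
  then have deg: "degree (monom 1 K * P ^ n) \<le> K + n * J"
    using degree_mult_le[of "monom 1 K" "P ^ n"] degree_monom_le[of "1::'c" K] by linarith
  have sub: "finite_subgroup (emb ` polys_lt D)"
    using finite_subgroup_emb_polys_lt[of 1 D] by simp
  have inj: "inj_on emb (polys_lt D)" by (auto simp: inj_on_def)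
  have "(\<Sum>x\<in>emb ` polys_lt D. poly (monom 1 K * P ^ n) x) = 0"
    using card deg
    by (intro sum_poly_subgroup_eq_0[OF sub]) (simp add: card_image[OF inj] card_polys_lt card_field)
  then have zero: "(\<Sum>a\<in>polys_lt D. emb a ^ K * poly P (emb a) ^ n) = 0"
    by (simp add: sum.reindex[OF inj] poly_monom)
  have "(\<Sum>a\<in>polys_lt D. emb a ^ K / (emb a * z + emb b) ^ n)
      = (\<Sum>a\<in>polys_lt D. emb a ^ K * (1 / (1 - y a)) ^ n / emb b ^ n)"
  proof (intro sum.cong refl)
    fix a
    have "emb a * z + emb b = (1 - y a) * emb b" using b by (simp add: y_def field_simps)
    then show "emb a ^ K / (emb a * z + emb b) ^ n = emb a ^ K * (1 / (1 - y a)) ^ n / emb b ^ n"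
      by (simp add: power_mult_distrib power_divide)
  qed
  also have "\<dots> = (\<Sum>a\<in>polys_lt D. emb a ^ K * (1 / (1 - y a)) ^ n / emb b ^ n)
      - (\<Sum>a\<in>polys_lt D. emb a ^ K * poly P (emb a) ^ n) / emb b ^ n"
    by (simp add: zero)
  also have "\<dots> = (\<Sum>a\<in>polys_lt D. emb a ^ K * ((1 / (1 - y a)) ^ n - poly P (emb a) ^ n) / emb b ^ n)"
    by (simp add: sum_divide_distrib sum_subtractf diff_divide_distrib right_diff_distrib)
  also have "abs_val \<dots> \<le> (real q ^ K) ^ D * \<rho> ^ J"
  proof (rule abs_val_sum_le)
    fix a :: "'f poly" assume a: "a \<in> polys_lt D"
    have 1: "abs_val (1 - y a) = 1"
      using y[OF a] rho by (subst abs_val_diff_eq_left) auto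
    have P: "abs_val (poly P (emb a)) \<le> 1"
      unfolding poly_P using y[OF a] rho
      by (intro abs_val_sum_le) (auto simp: abs_val_power intro!: power_le_one)
    have "(1 - y a) * poly P (emb a) = 1 - y a ^ J"
      unfolding poly_P by (rule one_diff_power_eq[symmetric])
    moreover have "1 - y a \<noteq> 0" using 1 by auto
    ultimately have "1 / (1 - y a) - poly P (emb a) = y a ^ J / (1 - y a)"
      by (simp add: field_simps)
    then have "abs_val (1 / (1 - y a) - poly P (emb a)) \<le> \<rho> ^ J"
      using y[OF a] 1 by (simp add: abs_val_divide abs_val_power power_mono)
    moreover have "abs_val ((1 / (1 - y a)) ^ n - poly P (emb a) ^ n) \<le> abs_val (1 / (1 - y a) - poly P (emb a))"
      using 1 P by (intro abs_val_power_diff_le) (auto simp: abs_val_divide)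
    ultimately have 2: "abs_val ((1 / (1 - y a)) ^ n - poly P (emb a) ^ n) \<le> \<rho> ^ J" by linarith
    have 3: "abs_val (emb a) ^ K \<le> (real q ^ K) ^ D"
      using power_mono[OF abs_emb_le[OF a], of K] by (simp add: mult.commute flip: power_mult)
    have 4: "abs_val (emb b) ^ n \<ge> 1" using abs_emb_ge_1[OF b] by (intro one_le_power)
    have "abs_val (emb a ^ K * ((1 / (1 - y a)) ^ n - poly P (emb a) ^ n) / emb b ^ n)
        = abs_val (emb a) ^ K * abs_val ((1 / (1 - y a)) ^ n - poly P (emb a) ^ n) / abs_val (emb b) ^ n"
      by (simp add: abs_val_divide abs_val_mult abs_val_power)
    also have "\<dots> \<le> (real q ^ K) ^ D * \<rho> ^ J / 1"
      using 2 3 4 rho by (intro frac_le mult_mono) auto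
    finally show "abs_val (emb a ^ K * ((1 / (1 - y a)) ^ n - poly P (emb a) ^ n) / emb b ^ n)
        \<le> (real q ^ K) ^ D * \<rho> ^ J" by simp
  qed (use rho in simp)
  finally show ?thesis .
qed

text \<open>The hypothesis on \<open>h\<close> and \<open>h'\<close> says that
  \<open>|a z| < |b|\<close> whenever \<open>a\<close> is in the box and \<open>b\<close> outside.
  Completing every row of the box to all \<open>b\<close> therefore adds only columns controlled by
  \<open>power_sum_tail\<close>, and the completed rows sum to the form.\<close>

lemma double_sum_tendsto:
  assumes z: "z \<in> \<Omega>" and n: "n > 0" and K: "n \<le> K" "q - 1 dvd K - n"
    and h: "abs_val z * real q ^ h < real q ^ Suc h'"
  shows "(\<lambda>j. \<Sum>a\<in>polys_lt (j + h). \<Sum>b\<in>polys_lt (j + h'). emb a ^ K / (\<omega> * (emb a * z + emb b)) ^ n)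
    \<longlonglongrightarrow> - A_exp K n z"
proof -
  define u where "u a b = emb a ^ K / (\<omega> * (emb a * z + emb b)) ^ n" for a b
  define g where "g a = A_term K n z a" for a
  \<comment> \<open>The quotient of the largest \<open>|a z|\<close> in the box, at most
    \<open>|z| q^(j + h - 1)\<close>, by the smallest \<open>|b|\<close> outside,
    \<open>q^(j + h')\<close>. It does not depend on \<open>j\<close>.\<close>
  define \<rho> where "\<rho> = abs_val z * real q ^ h / real q ^ Suc h'"
  have rho: "0 \<le> \<rho>" "\<rho> < 1" using h q_gt_1 by (simp_all add: \<rho>_def divide_less_eq_1)
  have g_lim: "(\<lambda>M. \<Sum>b\<in>polys_lt M. u a b) \<longlonglongrightarrow> g a" for a
  proof (cases "a = 0")
    \<comment> \<open>Because \<open>K > 0\<close> all terms with \<open>a = 0\<close> vanish; for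
      \<open>a = b = 0\<close> this also relies on division by zero giving 0.\<close>
    case True
    then show ?thesis using n K by (simp add: u_def g_def power_0_left)
  next
    case False
    have eq: "u a b = emb a ^ K * (1 / (\<omega> * (emb a * z) + \<omega> * emb b) ^ n)" for b
      by (simp add: u_def algebra_simps)
    show ?thesis
      unfolding eq sum_distrib_left[symmetric] g_def infsum_inverse_power[OF emb_mult_Omega[OF z False] n, symmetric]
      by (intro tendsto_mult_nonarch tendsto_const infsum_inverse_power_tendsto[OF n])
  qed
  define B where "B D = (real q ^ K) ^ D * \<rho> ^ (D\<^sup>2) / abs_val \<omega> ^ n" for D
  have "\<forall>\<^sub>F D in sequentially. K + n * D\<^sup>2 + 1 < q ^ D"
    using q_gt_1 by (rule eventually_quadratic_less_power)
  then have "\<forall>\<^sub>F j in sequentially. K + n * (j + h)\<^sup>2 + 1 < q ^ (j + h)"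
    using eventually_sequentially_seg[of "\<lambda>D. K + n * D\<^sup>2 + 1 < q ^ D" h] by simp
  then have est: "\<forall>\<^sub>F j in sequentially. abs_val ((\<Sum>a\<in>polys_lt (j + h). \<Sum>b\<in>polys_lt (j + h'). u a b)
      - (\<Sum>a\<in>polys_lt (j + h). g a)) \<le> B (j + h)"
  proof eventually_elim
    case (elim j)
    let ?V = "polys_lt (j + h) :: 'f poly set" and ?W = "polys_lt (j + h') :: 'f poly set"
    have col: "abs_val (\<Sum>a\<in>?V. u a b) \<le> B (j + h)" if b: "b \<notin> ?W" for b
    proof -
      have "b \<noteq> 0" using b by auto
      then have "abs_val (\<Sum>a\<in>?V. emb a ^ K / (emb a * z + emb b) ^ n) \<le> (real q ^ K) ^ (j + h) * \<rho> ^ ((j + h)\<^sup>2)"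
      proof (rule power_sum_tail[OF _ rho _ elim])
        fix a assume a: "a \<in> ?V"
        have qpos: "real q > 0" using q_gt_1 by simp
        have "abs_val (emb a * z) * q \<le> real q ^ (j + h) * abs_val z"
          using mult_right_mono[OF abs_emb_lt[OF a], of "abs_val z"] by (simp add: abs_val_mult algebra_simps)
        also have "\<dots> = \<rho> * real q ^ (j + h') * q"
          using qpos by (simp add: \<rho>_def power_add field_simps)
        also have "\<dots> \<le> \<rho> * abs_val (emb b) * q"
          using abs_emb_ge[OF b] rho by (intro mult_right_mono mult_left_mono) auto
        finally show "abs_val (emb a * z) \<le> \<rho> * abs_val (emb b)" using qpos by simp
      qed
      moreover have "(\<Sum>a\<in>?V. u a b) = (\<Sum>a\<in>?V. emb a ^ K / (emb a * z + emb b) ^ n) / \<omega> ^ n"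
        by (simp add: u_def sum_divide_distrib power_mult_distrib mult.commute)
      ultimately show ?thesis
        by (simp add: B_def abs_val_divide abs_val_power divide_right_mono)
    qed
    have lim: "(\<lambda>M. (\<Sum>a\<in>?V. \<Sum>b\<in>?W. u a b) - (\<Sum>a\<in>?V. \<Sum>b\<in>polys_lt M. u a b))
        \<longlonglongrightarrow> (\<Sum>a\<in>?V. \<Sum>b\<in>?W. u a b) - (\<Sum>a\<in>?V. g a)"
      by (intro tendsto_diff_nonarch tendsto_const tendsto_sum g_lim)
    show ?case
    \<comment> \<open>The rows are completed only up to degree \<open>M\<close>, where both sums are
      finite and may be swapped. The column bound does not involve \<open>M\<close>, so it persists
      in the limit.\<close>
    proof (rule abs_val_limit_le[OF lim sequentially_bot], rule eventually_sequentiallyI[of "j + h'"])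
      fix M assume "j + h' \<le> M"
      then have sub: "?W \<subseteq> polys_lt M" by (rule polys_lt_mono)
      have "(\<Sum>a\<in>?V. \<Sum>b\<in>?W. u a b) - (\<Sum>a\<in>?V. \<Sum>b\<in>polys_lt M. u a b)
          = - (\<Sum>a\<in>?V. \<Sum>b\<in>polys_lt M - ?W. u a b)"
        by (simp add: sum_diff[OF _ sub] sum_subtractf)
      also have "\<dots> = - (\<Sum>b\<in>polys_lt M - ?W. \<Sum>a\<in>?V. u a b)"
        by (subst sum.swap) (rule refl)
      also have "abs_val \<dots> \<le> B (j + h)"
        unfolding abs_val_minus
      proof (rule abs_val_sum_le)
        show "0 \<le> B (j + h)" using rho by (simp add: B_def)
      qed (auto intro: col)
      finally show "abs_val ((\<Sum>a\<in>?V. \<Sum>b\<in>?W. u a b) - (\<Sum>a\<in>?V. \<Sum>b\<in>polys_lt M. u a b)) \<le> B (j + h)" .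
    qed
  qed
  have "B \<longlonglongrightarrow> 0 / abs_val \<omega> ^ n"
    unfolding B_def using rho by (intro tendsto_divide tendsto_const power_mult_superpower_tendsto_0) auto
  then have Blim: "(\<lambda>j. B (j + h)) \<longlonglongrightarrow> 0" using LIMSEQ_ignore_initial_segment[of B 0 h] by simp
  have "(\<lambda>j. (\<Sum>a\<in>polys_lt (j + h). \<Sum>b\<in>polys_lt (j + h'). u a b) - (\<Sum>a\<in>polys_lt (j + h). g a)) \<longlonglongrightarrow> 0"
    unfolding tendsto_abs_val_iff[of _ 0] diff_0_right
    by (rule tendsto_sandwich[OF _ est tendsto_const Blim]) simp
  moreover have "(\<lambda>j. \<Sum>a\<in>polys_lt (j + h). g a) \<longlonglongrightarrow> - A_exp K n z"
    using LIMSEQ_ignore_initial_segment[OF sum_all_tendsto[OF z n K], of h] by (simp add: g_def)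
  ultimately show ?thesis
    using tendsto_add[of _ 0 sequentially] unfolding u_def by fastforce
qed

end

text \<open>
  The hypothesis \<open>n \<le> p\<^sup>s\<close> enters here: as \<open>x\<^sup>K - y\<^sup>K\<close> is a \<open>p\<^sup>s\<close>-th power, \<open>(x - y)\<^sup>n\<close> divides it.
\<close>

lemma power_diff_quotient:
  fixes x y :: "'a::field"
  assumes char: "prime CHAR('a)" and P: "P = CHAR('a) ^ s" and K: "K = P * r" and n: "n > 0" "n \<le> P" "n < K"
    and xy: "x = y \<Longrightarrow> x = 0"
  shows "(x ^ K - y ^ K) / (x - y) ^ n = (x - y) ^ (P - n) * (\<Sum>i<r. y ^ (r - Suc i) * x ^ i) ^ P"
proof (cases "x = y")
  case True
  then have 0: "x = 0" "y = 0" using xy by auto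
  show ?thesis
  proof (cases "n = P")
    case False
    then show ?thesis using n 0 by (simp add: power_0_left)
  next
    case True
    \<comment> \<open>For \<open>n = P\<close> the first factor is \<open>0^0 = 1\<close>. The
      condition \<open>n < K\<close> then forces \<open>r > 1\<close>, and each summand of the
      second factor contains a positive power of 0.\<close>
    then have "r > 1" using n K by (cases r; cases "r - 1") auto
    then have "(\<Sum>i<r. (0::'a) ^ (r - Suc i) * 0 ^ i) = 0"
      by (intro sum.neutral) (auto simp: power_0_left)
    then show ?thesis using 0 n True K by (simp add: power_0_left)
  qed
next
  case False
  have "(x ^ r - y ^ r + y ^ r) ^ P = (x ^ r - y ^ r) ^ P + (y ^ r) ^ P"
    by (rule freshmans_dream'[OF char P])
  then have "x ^ K - y ^ K = (x ^ r - y ^ r) ^ P"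
    unfolding K by (simp add: mult.commute[of P] power_mult)
  also have "\<dots> = (x - y) ^ P * (\<Sum>i<r. y ^ (r - Suc i) * x ^ i) ^ P"
    by (subst power_diff_sumr2) (rule power_mult_distrib)
  also have "(x - y) ^ P = (x - y) ^ (P - n) * (x - y) ^ n"
    using n by (simp flip: power_add)
  finally show ?thesis using False by simp
qed

context carlitz begin

text \<open>For fixed \<open>b\<close> the quotient is the value at \<open>a\<close> of a polynomial
  of degree at most \<open>K\<close>, so its power sum vanishes once \<open>q^D\<close> is
  large.\<close>

lemma swapped_sums_eq:
  assumes z: "z \<in> \<Omega>" and char: "prime CHAR('c)" and P: "P = CHAR('c) ^ s" and K: "K = P * r"
    and n: "n > 0" "n \<le> P" "n < K" and D: "K + 1 < q ^ D"
  shows "(\<Sum>a\<in>polys_lt D. ((emb a * z) ^ K - (- emb b) ^ K) / (emb a * z + emb b) ^ n) = 0"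
proof -
  define f where "f = [:emb b, z:] ^ (P - n) * (\<Sum>i<r. [:- emb b:] ^ (r - Suc i) * [:0, z:] ^ i) ^ P"
  \<comment> \<open>As \<open>z\<close> is not a Laurent series, the denominator vanishes at
    \<open>a = b = 0\<close> only. There the quotient is 0 by convention and the polynomial takes
    the same value.\<close>
  have zero: "a = 0" if "emb a * z = - emb b" for a
  proof (rule ccontr)
    assume a: "a \<noteq> 0"
    obtain x y where xy: "emb a = \<iota> x" "emb b = \<iota> y" using emb_in_range by blast
    moreover have "x \<noteq> 0" using a xy(1) by (metis emb_eq_0_iff iota_0)
    ultimately have "z = \<iota> (- y / x)" using a that by (simp add: iota_divide iota_minus field_simps) 
    then show False using z by (auto simp: upper_half_plane_def)
  qed
  have "((emb a * z) ^ K - (- emb b) ^ K) / (emb a * z + emb b) ^ n = poly f (emb a)" for a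
  proof -
    have "emb a * z = 0" if "emb a * z = - emb b" using zero[OF that] by simp
    from power_diff_quotient[OF char P K n, of "emb a * z" "- emb b", OF this]
    show ?thesis by (simp add: f_def poly_sum add.commute)
  qed
  then have "(\<Sum>a\<in>polys_lt D. ((emb a * z) ^ K - (- emb b) ^ K) / (emb a * z + emb b) ^ n)
      = (\<Sum>x\<in>emb ` polys_lt D. poly f x)"
    by (subst sum.reindex) (auto simp: inj_on_def)
  also have "\<dots> = 0"
  proof (rule sum_poly_subgroup_eq_0)
    show "finite_subgroup (emb ` polys_lt D)" using finite_subgroup_emb_polys_lt[of 1 D] by simp
    have r: "r > 0" using n K by (cases r) auto
    have "degree (\<Sum>i<r. [:- emb b:] ^ (r - Suc i) * [:0, z:] ^ i) \<le> r - 1"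
    proof (rule degree_sum_le)
      fix i assume i: "i \<in> {..<r}"
      have "degree ([:- emb b:] ^ (r - Suc i) * [:0, z:] ^ i) \<le> degree ([:- emb b:] ^ (r - Suc i)) + degree ([:0, z:] ^ i)"
        by (rule degree_mult_le)
      also have "\<dots> \<le> 0 + i"
        using degree_power_le[of "[:- emb b:]" "r - Suc i"] degree_power_le[of "[:0, z:]" i]
        by (intro add_mono) (auto split: if_splits)
      finally show "degree ([:- emb b:] ^ (r - Suc i) * [:0, z:] ^ i) \<le> r - 1" using i by auto
    qed simp
    then have "degree ((\<Sum>i<r. [:- emb b:] ^ (r - Suc i) * [:0, z:] ^ i) ^ P) \<le> (r - 1) * P"
      by (intro order_trans[OF degree_power_le] mult_le_mono1)
    moreover have "degree ([:emb b, z:] ^ (P - n)) \<le> P - n"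
      using degree_power_le[of "[:emb b, z:]" "P - n"] by (auto split: if_splits)
    ultimately have "degree f \<le> (P - n) + (r - 1) * P"
      unfolding f_def by (intro order_trans[OF degree_mult_le] add_mono)
    also have "\<dots> \<le> P + (r - 1) * P" by simp
    also have "\<dots> = K" using r K by (cases r) auto
    finally show "degree f + 1 < card (emb ` polys_lt D)"
      using D by (subst card_image) (auto simp: inj_on_def card_polys_lt card_field)
  qed
  finally show ?thesis .
qed

lemma Omega_nonzero: "z \<in> \<Omega> \<Longrightarrow> z \<noteq> 0"
  by (metis DiffE UNIV_I iota_0 rangeI upper_half_plane_def)

lemma inversion_Omega: "z \<in> \<Omega> \<Longrightarrow> - 1 / z \<in> \<Omega>"
proof -
  assume z: "z \<in> \<Omega>"
  have "- 1 / z \<noteq> \<iota> x" for x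
  proof
    assume *: "- 1 / z = \<iota> x"
    moreover have "x \<noteq> 0" using * Omega_nonzero[OF z] by auto
    ultimately have "z = \<iota> (- 1 / x)"
      using Omega_nonzero[OF z] by (auto simp: iota_divide iota_minus field_simps)
    then show False using z by (auto simp: upper_half_plane_def)
  qed
  then show ?thesis by (auto simp: upper_half_plane_def)
qed

text \<open>
  On both sides the double sum over \<open>(a, b)\<close> may be taken over boxes of the same shape. The inversion
  swaps the two coordinates, and the difference of the two sums vanishes by \<open>swapped_sums_eq\<close>.
\<close>

lemma A_exp_inversion:
  assumes z: "z \<in> \<Omega>" and char: "prime CHAR('c)" and P: "P = CHAR('c) ^ s" and K: "K = P * r"
    and n: "n > 0" "n \<le> P" "n < K" and dvd: "q - 1 dvd K - n"
  shows "A_exp K n (- 1 / z) = z ^ (K + n) * A_exp K n z"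
proof -
  have z0: "z \<noteq> 0" by (rule Omega_nonzero[OF z])
  have q1: "real q > 1" using q_gt_1 by simp
  \<comment> \<open>\<open>q^i <= |z| < q^(i+1)\<close>, and \<open>i\<close> is split as
    \<open>h' - h\<close> with natural numbers. The upper bound gives the box condition for
    \<open>z\<close>, the lower bound the one for \<open>-1/z\<close> with \<open>h\<close> and
    \<open>h'\<close> exchanged.\<close>
  define i where "i = \<lfloor>log q (abs_val z)\<rfloor>"
  have i: "real q powr i \<le> abs_val z" "abs_val z < real q powr (i + 1)"
    using z0 q1 by (simp_all add: i_def powr_le_iff less_powr_iff)
  define h where "h = nat (- i)"
  define h' where "h' = nat i"
  have ih: "i = int h' - int h" by (simp add: h_def h'_def)
  have pw: "real q powr i = real q ^ h' / real q ^ h"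
    using q1 by (simp add: ih powr_diff powr_realpow)
  have le: "real q ^ h' \<le> abs_val z * real q ^ h"
    using i(1) q1 unfolding pw by (simp add: field_simps)
  have lt: "abs_val z * real q ^ h < real q ^ Suc h'"
    using i(2) q1 pw by (simp add: powr_add field_simps)
  define S where "S j = (\<Sum>a\<in>polys_lt (j + h). \<Sum>b\<in>polys_lt (j + h'). emb a ^ K / (\<omega> * (emb a * z + emb b)) ^ n)" for j
  define S' where "S' j = (\<Sum>a\<in>polys_lt (j + h'). \<Sum>b\<in>polys_lt (j + h). emb a ^ K / (\<omega> * (emb a * (- 1 / z) + emb b)) ^ n)" for j
  have "S \<longlonglongrightarrow> - A_exp K n z"
    unfolding S_def using n dvd lt by (intro double_sum_tendsto z) auto
  then have lim: "(\<lambda>j. z ^ (K + n) * S j) \<longlonglongrightarrow> z ^ (K + n) * - A_exp K n z"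
    by (intro tendsto_mult_nonarch tendsto_const)
  have lim': "S' \<longlonglongrightarrow> - A_exp K n (- 1 / z)"
  proof -
    have "abs_val z * real q ^ h < abs_val z * (real q ^ h * real q)"
      using z0 q1 by simp
    then have "real q ^ h' < abs_val z * (real q ^ h * real q)" using le by linarith
    then have "abs_val (- 1 / z) * real q ^ h' < real q ^ Suc h"
      using z0 by (simp add: abs_val_divide field_simps)
    then show ?thesis
      unfolding S'_def using n dvd by (intro double_sum_tendsto inversion_Omega z) auto
  qed
  have "\<forall>\<^sub>F D in sequentially. K + 0 * D\<^sup>2 + 1 < q ^ D"
    using q_gt_1 by (rule eventually_quadratic_less_power)
  then have "\<forall>\<^sub>F j in sequentially. K + 1 < q ^ (j + h)"
    using eventually_sequentially_seg[of "\<lambda>D. K + 1 < q ^ D" h] by simp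
  then have "\<forall>\<^sub>F j in sequentially. z ^ (K + n) * S j = S' j"
  proof eventually_elim
    case (elim j)
    let ?V = "polys_lt (j + h) :: 'f poly set" and ?W = "polys_lt (j + h') :: 'f poly set"
    \<comment> \<open>Renaming the outer variable to \<open>-b\<close> and the inner one to
      \<open>a\<close> turns the linear form into \<open>(a z + b) / z\<close>, the denominator of
      \<open>S\<close> up to \<open>z\<close>.\<close>
    have "S' j = (\<Sum>b\<in>?W. \<Sum>a\<in>?V. (- emb b) ^ K / (\<omega> * (emb (- b) * (- 1 / z) + emb a)) ^ n)"
      unfolding S'_def
      by (rule sum.reindex_bij_witness[of _ uminus uminus]) (auto simp: polys_lt_iff emb_minus)
    also have "\<dots> = (\<Sum>b\<in>?W. \<Sum>a\<in>?V. z ^ n / \<omega> ^ n * ((- emb b) ^ K / (emb a * z + emb b) ^ n))"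
    proof (intro sum.cong refl)
      fix a b
      have "\<omega> * (emb (- b) * (- 1 / z) + emb a) = \<omega> * (emb a * z + emb b) / z"
        using z0 by (simp add: emb_minus field_simps)
      then show "(- emb b) ^ K / (\<omega> * (emb (- b) * (- 1 / z) + emb a)) ^ n
          = z ^ n / \<omega> ^ n * ((- emb b) ^ K / (emb a * z + emb b) ^ n)"
        by (simp add: power_mult_distrib power_divide)
    qed
    finally have S': "S' j = z ^ n / \<omega> ^ n * (\<Sum>b\<in>?W. \<Sum>a\<in>?V. (- emb b) ^ K / (emb a * z + emb b) ^ n)"
      by (simp add: sum_distrib_left)
    have "z ^ (K + n) * S j = (\<Sum>a\<in>?V. \<Sum>b\<in>?W. z ^ n / \<omega> ^ n * ((emb a * z) ^ K / (emb a * z + emb b) ^ n))"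
      unfolding S_def sum_distrib_left
      by (intro sum.cong refl) (simp add: power_mult_distrib power_add mult_ac)
    also have "\<dots> = z ^ n / \<omega> ^ n * (\<Sum>b\<in>?W. \<Sum>a\<in>?V. (emb a * z) ^ K / (emb a * z + emb b) ^ n)"
      unfolding sum_distrib_left by (rule sum.swap)
    finally have "z ^ (K + n) * S j - S' j = z ^ n / \<omega> ^ n *
        (\<Sum>b\<in>?W. \<Sum>a\<in>?V. ((emb a * z) ^ K - (- emb b) ^ K) / (emb a * z + emb b) ^ n)"
      unfolding S' by (simp add: sum_subtractf diff_divide_distrib right_diff_distrib)
    also have "\<dots> = 0"
      using swapped_sums_eq[OF z char P K n elim] by simp
    finally show ?case by simp
  qed
  from LIMSEQ_unique[OF Lim_transform_eventually[OF lim this] lim']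
  show ?thesis by simp
qed

end

section \<open>Modularity and rigid analyticity\<close>

lemma infsum_minus_partial_sum_le:
  fixes f :: "'i \<Rightarrow> 'c::complete_nonarch_field"
  assumes "null_family f A" "\<And>m. finite (V m)" "\<And>m. V m \<subseteq> V (Suc m)" "(\<Union>m. V m) = A"
    and "0 \<le> \<epsilon>" "\<And>i. i \<in> A \<Longrightarrow> i \<notin> V m \<Longrightarrow> abs_val (f i) \<le> \<epsilon>"
  shows "abs_val (infsum f A - (\<Sum>i\<in>V m. f i)) \<le> \<epsilon>"
proof (rule abs_val_limit_le)
  show "(\<lambda>N. (\<Sum>i\<in>V N. f i) - (\<Sum>i\<in>V m. f i)) \<longlonglongrightarrow> infsum f A - (\<Sum>i\<in>V m. f i)"
    by (intro tendsto_diff_nonarch tendsto_const infsum_exhausting_tendsto assms)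
  show "\<forall>\<^sub>F N in sequentially. abs_val ((\<Sum>i\<in>V N. f i) - (\<Sum>i\<in>V m. f i)) \<le> \<epsilon>"
  proof (rule eventually_sequentiallyI[of m])
    fix N assume "m \<le> N"
    then have "V m \<subseteq> V N" using lift_Suc_mono_le[of V, OF assms(3)] by simp
    then have "(\<Sum>i\<in>V N. f i) - (\<Sum>i\<in>V m. f i) = (\<Sum>i\<in>V N - V m. f i)"
      by (simp add: sum_diff assms(2))
    also have "abs_val \<dots> \<le> \<epsilon>"
      using assms(4-6) by (intro abs_val_sum_le) auto
    finally show "abs_val ((\<Sum>i\<in>V N. f i) - (\<Sum>i\<in>V m. f i)) \<le> \<epsilon>" .
  qed
qed auto

definition rational_on :: "'a::field set \<Rightarrow> ('a \<Rightarrow> 'a) \<Rightarrow> bool" where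
  "rational_on S f \<longleftrightarrow> (\<exists>P Q. \<forall>z\<in>S. poly Q z \<noteq> 0 \<and> f z = poly P z / poly Q z)"

lemma rational_on_sum:
  assumes "\<And>i. i \<in> I \<Longrightarrow> rational_on S (f i)"
  shows "rational_on S (\<lambda>z. \<Sum>i\<in>I. f i z)"
  using assms
proof (induction I rule: infinite_finite_induct)
  case (infinite I)
  then show ?case unfolding rational_on_def by (intro exI[of _ 0] exI[of _ 1]) simp
next
  case empty
  show ?case unfolding rational_on_def by (intro exI[of _ 0] exI[of _ 1]) simp
next
  case (insert i I)
  then obtain P Q P' Q' where "\<forall>z\<in>S. poly Q z \<noteq> 0 \<and> f i z = poly P z / poly Q z"
    "\<forall>z\<in>S. poly Q' z \<noteq> 0 \<and> (\<Sum>i\<in>I. f i z) = poly P' z / poly Q' z"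
    unfolding rational_on_def by (metis insertCI)
  then show ?case
    unfolding rational_on_def using insert
    by (intro exI[of _ "P * Q' + P' * Q"] exI[of _ "Q * Q'"]) (auto simp: field_simps)
qed

lemma rational_on_mult:
  assumes "rational_on S (\<lambda>z. f z)"
  shows "rational_on S (\<lambda>z. k * f z)"
proof -
  obtain P Q where "\<forall>z\<in>S. poly Q z \<noteq> 0 \<and> f z = poly P z / poly Q z"
    using assms unfolding rational_on_def by blast
  then show ?thesis unfolding rational_on_def
    by (intro exI[of _ "smult k P"] exI[of _ Q]) auto
qed

context carlitz begin

section \<open>The action of \<open>GL_2(A)\<close>\<close>

lemma A_exp_translate: "A_exp K n (z + emb b) = A_exp K n z"
proof -
  have "t (emb a * (z + emb b)) = t (emb a * z)" for a
  proof -
    have "\<omega> * (emb a * (z + emb b)) = \<omega> * (emb a * z) + \<omega> * emb (a * b)"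
      by (simp add: emb_mult algebra_simps)
    then show ?thesis by (simp add: t_param_def ex_add ex_omega_emb)
  qed
  then show ?thesis by (simp add: A_exp_def)
qed

lemma A_exp_const_mult:
  assumes z: "z \<in> \<Omega>" and c: "c \<noteq> 0" and n: "n > 0"
  shows "A_exp K n (\<kappa> c * z) = A_exp K n z / \<kappa> c ^ n"
proof -
  have cz: "\<kappa> c * z \<in> \<Omega>" using emb_mult_Omega[OF z, of "[:c:]"] c by (simp add: emb_const)
  have "emb a ^ K * poly (G n) (t (emb a * (\<kappa> c * z)))
      = A_term K n z a * (1 / \<kappa> c ^ n)" if "a \<in> monic" for a
  proof -
    have "emb a * z \<in> \<Omega>" using that z by (intro emb_mult_Omega) (auto simp: monic_def)
    from G_t_const_mult[OF this c n] show ?thesis by (simp add: mult.left_commute)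
  qed
  then have "(\<lambda>D. \<Sum>a\<in>polys_lt D \<inter> monic. emb a ^ K * poly (G n) (t (emb a * (\<kappa> c * z))))
      = (\<lambda>D. (\<Sum>a\<in>polys_lt D \<inter> monic. A_term K n z a) * (1 / \<kappa> c ^ n))"
    by (simp add: sum_divide_distrib)
  with A_exp_tendsto[OF cz, of K n]
  have "(\<lambda>D. (\<Sum>a\<in>polys_lt D \<inter> monic. A_term K n z a) * (1 / \<kappa> c ^ n))
      \<longlonglongrightarrow> A_exp K n (\<kappa> c * z)" by simp
  from LIMSEQ_unique[OF this tendsto_mult_nonarch[OF A_exp_tendsto[OF z] tendsto_const]]
  show ?thesis by simp
qed

lemma emb_linear_nonzero:
  assumes z: "z \<in> \<Omega>" and "c \<noteq> 0 \<or> d \<noteq> 0"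
  shows "emb c * z + emb d \<noteq> 0"
proof
  assume eq: "emb c * z + emb d = 0"
  show False
  proof (cases "c = 0")
    case True
    then show False using eq assms by simp
  next
    case False
    obtain x y where xy: "emb c = \<iota> x" "emb d = \<iota> y" using emb_in_range by blast
    then have "x \<noteq> 0" using False by (metis emb_eq_0_iff iota_0)
    moreover have "\<iota> x * z = - \<iota> y" using eq unfolding xy by (simp add: eq_neg_iff_add_eq_0)
    ultimately have "z = \<iota> (- y / x)" by (simp add: iota_divide iota_minus field_simps)
    then show False using z by (auto simp: upper_half_plane_def)
  qed
qed

lemma moebius_Omega:
  assumes z: "z \<in> \<Omega>" and det: "a * d - b * c \<noteq> 0"
  shows "(emb a * z + emb b) / (emb c * z + emb d) \<in> \<Omega>"
proof (rule ccontr)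
  assume "\<not> ?thesis"
  then obtain x where x: "(emb a * z + emb b) / (emb c * z + emb d) = \<iota> x"
    by (auto simp: upper_half_plane_def)
  have "emb c * z + emb d \<noteq> 0" using det by (intro emb_linear_nonzero z) auto
  then have eq: "emb a * z + emb b = \<iota> x * (emb c * z + emb d)" using x by (simp add: field_simps)
  obtain a' b' c' d' where e: "emb a = \<iota> a'" "emb b = \<iota> b'" "emb c = \<iota> c'" "emb d = \<iota> d'"
    using emb_in_range by (metis imageE)
  have "emb (a * d - b * c) = \<iota> (a' * d' - b' * c')"
    by (simp add: emb_diff emb_mult e iota_diff iota_mult)
  then have det': "a' * d' - b' * c' \<noteq> 0" using det by (metis emb_eq_0_iff iota_0)
  have eq': "\<iota> (a' - x * c') * z = \<iota> (x * d' - b')"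
    using eq unfolding e by (simp add: iota_diff iota_mult algebra_simps)
  have "a' - x * c' \<noteq> 0"
  proof
    assume 1: "a' - x * c' = 0"
    then have "x * d' - b' = 0" using eq' iota_eq_0_iff[of "x * d' - b'"] by simp
    with 1 have "a' = x * c'" "b' = x * d'" by auto
    then show False using det' by simp
  qed
  then have "z = \<iota> ((x * d' - b') / (a' - x * c'))"
    using eq' by (simp add: iota_divide field_simps)
  then show False using z by (auto simp: upper_half_plane_def)
qed

text \<open>Euclid on the first column: with \<open>a = h c + \<rho>\<close> the image point is
  \<open>h - 1 / (X / Y)\<close>, where \<open>X / Y\<close> is the image of \<open>z\<close> under
  the matrix with rows \<open>(c, d)\<close> and \<open>(-\<rho>, -b')\<close>. That matrix has the
  same determinant and a smaller lower left entry, and the factors \<open>X / Y\<close> and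
  \<open>Y\<close> multiply to \<open>X\<close>.\<close>

lemma A_exp_moebius:
  assumes z: "z \<in> \<Omega>" and char: "prime CHAR('c)" and P: "P = CHAR('c) ^ s" and K: "K = P * r"
    and n: "n > 0" "n \<le> P" "n < K" and dvd: "q - 1 dvd K - n"
    and det: "a * d - b * c = [:u:]" "u \<noteq> 0"
  shows "A_exp K n ((emb a * z + emb b) / (emb c * z + emb d)) * \<kappa> u ^ n = (emb c * z + emb d) ^ (K + n) * A_exp K n z"
  using det(1)
\<comment> \<open>The measure puts 0 below the nonzero constants, so a remainder 0 counts as
  progress even when \<open>c\<close> has degree 0.\<close>
proof (induction "if c = 0 then 0 else Suc (degree c)" arbitrary: a b c d rule: less_induct)
  case less
  show ?case
  proof (cases "c = 0")
    case True
    then have ad: "a * d = [:u:]" using less.prems by simp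
    then have "a \<noteq> 0" "d \<noteq> 0" using det(2) by auto
    then have "degree a + degree d = 0" using arg_cong[OF ad, of degree] by (simp add: degree_mult_eq)
    then obtain \<alpha> \<delta> where a: "a = [:\<alpha>:]" and d: "d = [:\<delta>:]" by (auto elim!: degree_eq_zeroE)
    have nz: "\<alpha> \<noteq> 0" "\<delta> \<noteq> 0" and u: "u = \<alpha> * \<delta>" using ad det(2) by (auto simp: a d)
    have k: "\<kappa> \<delta> * \<kappa> (1 / \<delta>) = 1" using nz by (simp flip: kappa_mult)
    have kad: "\<kappa> (\<alpha> / \<delta>) * \<kappa> \<delta> = \<kappa> \<alpha>" using nz by (simp flip: kappa_mult)
    have knz: "\<kappa> \<delta> \<noteq> 0" "\<kappa> (\<alpha> / \<delta>) \<noteq> 0" using nz by auto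
    have "(emb a * z + emb b) / (emb c * z + emb d) = \<kappa> (\<alpha> / \<delta>) * z + emb (smult (1 / \<delta>) b)"
      using knz k kad by (simp add: True a d emb_const emb_smult field_simps)
    then have "A_exp K n ((emb a * z + emb b) / (emb c * z + emb d)) = A_exp K n z / \<kappa> (\<alpha> / \<delta>) ^ n"
      using A_exp_const_mult[OF z _ n(1)] nz by (simp add: A_exp_translate)
    moreover have "\<kappa> u ^ n = \<kappa> (\<alpha> / \<delta>) ^ n * \<kappa> \<delta> ^ (2 * n)"
      unfolding u kappa_mult kad[symmetric] by (simp add: power_mult_distrib power_mult power2_eq_square)
    \<comment> \<open>By divisibility of \<open>K - n\<close> the weight factor
      \<open>\<delta>^(K + n)\<close> becomes \<open>\<delta>^(2 n)\<close>, which is what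
      \<open>u^n = (\<alpha> / \<delta>)^n \<delta>^(2 n)\<close> leaves over.\<close>
    moreover have "\<kappa> \<delta> ^ (K + n) = \<kappa> \<delta> ^ (2 * n)"
    proof -
      have "K + n = (K - n) + 2 * n" using n by simp
      then have "\<kappa> \<delta> ^ (K + n) = \<kappa> \<delta> ^ (K - n) * \<kappa> \<delta> ^ (2 * n)" by (metis power_add)
      then show ?thesis using kappa_power_eq_1[OF nz(2) dvd] by simp
    qed
    ultimately show ?thesis using knz by (simp add: True d emb_const)
  next
    case False
    define h where "h = a div c"
    define \<rho> where "\<rho> = a mod c"
    define b' where "b' = b - h * d"
    have a: "a = h * c + \<rho>" by (simp add: h_def \<rho>_def)
    have deg: "\<rho> = 0 \<or> degree \<rho> < degree c" using degree_mod_less[OF False, of a] by (simp add: \<rho>_def)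
    have det': "c * (- b') - d * (- \<rho>) = [:u:]"
      using less.prems unfolding a b'_def by (simp add: algebra_simps)
    define X where "X = emb c * z + emb d"
    define Y where "Y = emb (- \<rho>) * z + emb (- b')"
    have X: "X \<noteq> 0" unfolding X_def using False by (intro emb_linear_nonzero z) auto
    have Y: "Y \<noteq> 0" unfolding Y_def using det' det(2) by (intro emb_linear_nonzero z) auto
    have W: "X / Y \<in> \<Omega>"
      unfolding X_def Y_def by (rule moebius_Omega[OF z]) (use det' det(2) in simp)
    have "emb a * z + emb b = emb h * X - Y"
      by (simp add: X_def Y_def a b'_def emb_add emb_mult emb_minus emb_diff algebra_simps)
    then have "(emb a * z + emb b) / (emb c * z + emb d) = - 1 / (X / Y) + emb h"
      unfolding X_def[symmetric] using X Y by (simp add: field_simps)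
    then have "A_exp K n ((emb a * z + emb b) / (emb c * z + emb d)) = (X / Y) ^ (K + n) * A_exp K n (X / Y)"
      using A_exp_inversion[OF W char P K n dvd] by (simp only: A_exp_translate)
    moreover have "A_exp K n (X / Y) * \<kappa> u ^ n = Y ^ (K + n) * A_exp K n z"
      unfolding X_def Y_def by (rule less.hyps[OF _ det']) (use deg False in auto)
    ultimately have "A_exp K n ((emb a * z + emb b) / (emb c * z + emb d)) * \<kappa> u ^ n
        = (X / Y) ^ (K + n) * (Y ^ (K + n) * A_exp K n z)"
      by (simp add: mult.assoc)
    also have "\<dots> = X ^ (K + n) * A_exp K n z"
      using Y by (simp add: power_divide)
    finally show ?thesis by (simp add: X_def)
  qed
qed

text \<open>The determinant is a nonzero constant, whose \<open>(q - 1)\<close>-th power is 1. The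
  type \<open>m\<close> may therefore be replaced by \<open>n\<close>.\<close>

lemma A_exp_modular:
  assumes z: "z \<in> \<Omega>" and char: "prime CHAR('c)" and P: "P = CHAR('c) ^ s" and K: "K = P * r"
    and n: "n > 0" "n \<le> P" "n < K" and dvd: "q - 1 dvd K - n"
    and m: "[m = int n] (mod (int q - 1))" and inv: "invertible (\<gamma> :: 'f poly ^ 2 ^ 2)"
  shows "A_exp K n ((emb (\<gamma> $ 1 $ 1) * z + emb (\<gamma> $ 1 $ 2)) / (emb (\<gamma> $ 2 $ 1) * z + emb (\<gamma> $ 2 $ 2)))
    = emb (det \<gamma>) powi (- m) * (emb (\<gamma> $ 2 $ 1) * z + emb (\<gamma> $ 2 $ 2)) ^ (K + n) * A_exp K n z"
proof -
  obtain \<gamma>' where "\<gamma> ** \<gamma>' = mat 1" using inv unfolding invertible_def by blast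
  then have "det \<gamma> * det \<gamma>' = 1" using det_mul[of \<gamma> \<gamma>'] by simp
  then have "is_unit (det \<gamma>)" by (metis dvd_triv_left)
  then obtain u where u: "det \<gamma> = [:u:]" "u \<noteq> 0"
    by (metis is_unit_polyE is_unit_iff_degree degree_eq_zeroE not_is_unit_0 pCons_0_0)
  have k: "\<kappa> u \<noteq> 0" using u by simp
  from m obtain i where "int n = m + (int q - 1) * i" by (auto simp: cong_iff_lin)
  then have "m = int n + (int q - 1) * (- i)" by simp
  then obtain j where j: "m = int n + (int q - 1) * j" by blast
  have "\<kappa> u powi (int q - 1) = 1"
    using kappa_power_q_minus_1[OF u(2)] q_gt_1 by (simp add: power_int_def nat_diff_distrib)
  then have "\<kappa> u powi m = \<kappa> u ^ n"
    using k unfolding j by (simp add: power_int_add power_int_mult)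
  then have pw: "emb (det \<gamma>) powi (- m) = 1 / \<kappa> u ^ n"
    by (simp add: u emb_const power_int_minus inverse_eq_divide)
  have "\<gamma> $ 1 $ 1 * \<gamma> $ 2 $ 2 - \<gamma> $ 1 $ 2 * \<gamma> $ 2 $ 1 = [:u:]" using u by (simp add: det_2)
  from A_exp_moebius[OF z char P K n dvd this u(2)] show ?thesis
    unfolding pw using k by (simp add: field_simps)
qed

section \<open>Approximation by rational functions on affinoids\<close>

lemma A_exp_minus_partial_sum_le:
  assumes z: "z \<in> \<Omega>" and e: "0 \<le> \<epsilon>"
    and "\<And>a. a \<in> monic \<Longrightarrow> a \<notin> polys_lt D \<Longrightarrow> abs_val (A_term K n z a) \<le> \<epsilon>"
  shows "abs_val (A_exp K n z - (\<Sum>a\<in>polys_lt D \<inter> monic. A_term K n z a)) \<le> \<epsilon>"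
  unfolding A_exp_def
proof (rule infsum_minus_partial_sum_le[OF null_family_A_exp[OF z], where V = "\<lambda>D. polys_lt D \<inter> monic"])
  show "polys_lt M \<inter> monic \<subseteq> polys_lt (Suc M) \<inter> monic" for M
    using polys_lt_mono[of M "Suc M"] by auto
qed (use UN_polys_lt assms in auto)

lemma G_t_minus_partial_sum_le:
  assumes z: "z \<in> \<Omega>" and n: "n > 0" and e: "0 \<le> \<epsilon>"
    and le: "\<And>b. b \<notin> polys_lt M \<Longrightarrow> abs_val (inv_power n z b) \<le> \<epsilon>"
  shows "abs_val (poly (G n) (t z) - (\<Sum>b\<in>polys_lt M. inv_power n z b)) \<le> \<epsilon>"
  unfolding infsum_inverse_power[OF z n, symmetric]
proof (rule infsum_minus_partial_sum_le[OF null_family_inverse_power[OF n]])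
  show "polys_lt M \<subseteq> polys_lt (Suc M)" for M :: nat by (rule polys_lt_mono) simp
qed (use UN_polys_lt e le in auto)

text \<open>Two truncations, each with error at most \<open>\<epsilon> / 2\<close>: the sum over
  \<open>a\<close>, and then for each remaining \<open>a\<close> the lattice sum over
  \<open>b\<close> that represents the Goss polynomial. The result is a finite sum of rational
  functions with poles outside the upper half plane.\<close>

lemma rigid_analytic_A_exp:
  assumes n: "n > 0"
  shows "rigid_analytic \<iota> (A_exp K n)"
  unfolding rigid_analytic_def
proof (intro allI impI)
  fix N :: nat and \<epsilon> :: real assume e: "\<epsilon> > 0"
  define S where "S = affinoid \<iota> N"
  have q: "real q > 0" using q_gt_1 by simp
  have S: "abs_val z \<le> real q ^ N" "im z \<ge> 1 / real q ^ N" "z \<in> \<Omega>" if "z \<in> S" for z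
  proof -
    show 1: "abs_val z \<le> real q ^ N" "im z \<ge> 1 / real q ^ N"
      using that by (auto simp: S_def affinoid_def card_field)
    have "1 / real q ^ N > 0" using q by simp
    then show "z \<in> \<Omega>" using 1 unfolding im_pos_iff[symmetric] by linarith
  qed
  obtain D where D: "\<And>z a. 1 / real q ^ N \<le> im z \<Longrightarrow> a \<notin> polys_lt D \<Longrightarrow>
      abs_val (A_term K n z a) < \<epsilon> / 2"
    using A_exp_tail[of "1 / real q ^ N" "\<epsilon> / 2" K n] q e by auto
  \<comment> \<open>The error made here is later multiplied by \<open>|a|^K\<close>. Adding 1 to the
    divisor keeps it positive where \<open>|a|^K\<close> is 0.\<close>
  have "\<exists>M. \<forall>z b. abs_val z \<le> abs_val (emb a) * real q ^ N \<longrightarrow> b \<notin> polys_lt M \<longrightarrow>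
      abs_val (inv_power n z b) < \<epsilon> / 2 / (abs_val (emb a) ^ K + 1)" for a
    using e by (intro inverse_power_tail[OF n] divide_pos_pos add_nonneg_pos) auto
  then obtain M where M: "\<And>a z b. abs_val z \<le> abs_val (emb a) * real q ^ N \<Longrightarrow> b \<notin> polys_lt (M a) \<Longrightarrow>
      abs_val (inv_power n z b) < \<epsilon> / 2 / (abs_val (emb a) ^ K + 1)"
    by metis
  define R where "R z = (\<Sum>a\<in>polys_lt D \<inter> monic. emb a ^ K *
      (\<Sum>b\<in>polys_lt (M a). 1 / (\<omega> * (emb a * z) + \<omega> * emb b) ^ n))" for z
  have "abs_val (A_exp K n z - R z) < \<epsilon>" if z: "z \<in> S" for z
  proof -
    note zS = S[OF z]
    have 1: "abs_val (A_exp K n z - (\<Sum>a\<in>polys_lt D \<inter> monic. A_term K n z a)) \<le> \<epsilon> / 2"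
      using e zS(2) by (intro A_exp_minus_partial_sum_le zS(3) less_imp_le[OF D]) auto
    have 2: "abs_val (\<Sum>a\<in>polys_lt D \<inter> monic. emb a ^ K * (poly (G n) (t (emb a * z)) -
        (\<Sum>b\<in>polys_lt (M a). 1 / (\<omega> * (emb a * z) + \<omega> * emb b) ^ n))) \<le> \<epsilon> / 2"
    proof (rule abs_val_sum_le)
      fix a assume a: "a \<in> polys_lt D \<inter> monic"
      let ?A = "abs_val (emb a) ^ K"
      have A: "?A + 1 > 0" by (intro add_nonneg_pos) auto
      have az: "emb a * z \<in> \<Omega>" using a zS by (intro emb_mult_Omega) (auto simp: monic_def)
      have "abs_val (emb a * z) \<le> abs_val (emb a) * real q ^ N"
        using zS(1) by (simp add: abs_val_mult mult_left_mono)
      then have "abs_val (poly (G n) (t (emb a * z)) -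
          (\<Sum>b\<in>polys_lt (M a). 1 / (\<omega> * (emb a * z) + \<omega> * emb b) ^ n)) \<le> \<epsilon> / 2 / (?A + 1)"
        using e A by (intro G_t_minus_partial_sum_le az n less_imp_le[OF M]) auto
      then have "abs_val (emb a ^ K * (poly (G n) (t (emb a * z)) -
          (\<Sum>b\<in>polys_lt (M a). 1 / (\<omega> * (emb a * z) + \<omega> * emb b) ^ n))) \<le> ?A * (\<epsilon> / 2 / (?A + 1))"
        unfolding abs_val_mult abs_val_power by (intro mult_left_mono) auto
      also have "\<dots> \<le> (?A + 1) * (\<epsilon> / 2 / (?A + 1))"
        using e A by (intro mult_right_mono) auto
      also have "\<dots> = \<epsilon> / 2" using A by (subst times_divide_eq_right) (rule nonzero_mult_div_cancel_left, simp)
      finally show "abs_val (emb a ^ K * (poly (G n) (t (emb a * z)) -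
          (\<Sum>b\<in>polys_lt (M a). 1 / (\<omega> * (emb a * z) + \<omega> * emb b) ^ n))) \<le> \<epsilon> / 2" .
    qed (use e in simp)
    have "A_exp K n z - R z = (A_exp K n z - (\<Sum>a\<in>polys_lt D \<inter> monic. A_term K n z a))
        + (\<Sum>a\<in>polys_lt D \<inter> monic. emb a ^ K * (poly (G n) (t (emb a * z)) -
        (\<Sum>b\<in>polys_lt (M a). 1 / (\<omega> * (emb a * z) + \<omega> * emb b) ^ n)))"
      by (simp add: R_def sum_subtractf right_diff_distrib)
    also have "abs_val \<dots> \<le> \<epsilon> / 2" by (rule abs_val_add_le[OF 1 2])
    finally show ?thesis using e by simp
  qed
  moreover have "rational_on S R"
    unfolding R_def
  proof (intro rational_on_sum rational_on_mult)
    fix a b assume a: "a \<in> polys_lt D \<inter> monic"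
    show "rational_on S (\<lambda>z. 1 / (\<omega> * (emb a * z) + \<omega> * emb b) ^ n)"
      unfolding rational_on_def
    proof (rule exI[of _ 1], rule exI[of _ "[:\<omega> * emb b, \<omega> * emb a:] ^ n"], intro ballI conjI)
      fix z assume "z \<in> S"
      then have "emb a * z + emb b \<noteq> 0" using a by (intro emb_linear_nonzero S(3)) (auto simp: monic_def)
      moreover have "\<omega> * emb b + z * (\<omega> * emb a) = \<omega> * (emb a * z + emb b)" by (simp add: algebra_simps)
      ultimately show "poly ([:\<omega> * emb b, \<omega> * emb a:] ^ n) z \<noteq> 0" by simp
      show "1 / (\<omega> * (emb a * z) + \<omega> * emb b) ^ n = poly 1 z / poly ([:\<omega> * emb b, \<omega> * emb a:] ^ n) z"
        by (simp add: algebra_simps)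
    qed
  qed
  ultimately show "\<exists>P Q. \<forall>z\<in>affinoid \<iota> N. poly Q z \<noteq> 0 \<and> abs_val (A_exp K n z - poly P z / poly Q z) < \<epsilon>"
    unfolding rational_on_def S_def by metis
qed

end

section \<open>The t-expansion\<close>

lemma sums_mult_nonarch:
  fixes f :: "nat \<Rightarrow> 'c::complete_nonarch_field"
  assumes "f sums s"
  shows "(\<lambda>i. k * f i) sums (k * s)"
  using tendsto_mult_nonarch[OF tendsto_const assms[unfolded sums_def], of k]
  unfolding sums_def by (simp add: sum_distrib_left)

lemma sums_sum_nonarch:
  fixes f :: "'i \<Rightarrow> nat \<Rightarrow> 'c::complete_nonarch_field"
  assumes "\<And>x. x \<in> S \<Longrightarrow> f x sums s x"
  shows "(\<lambda>i. \<Sum>x\<in>S. f x i) sums (\<Sum>x\<in>S. s x)"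
  using tendsto_sum[of S "\<lambda>x n. \<Sum>i<n. f x i" s sequentially] assms
  unfolding sums_def by (subst sum.swap) auto

lemma geometric_sums_bound:
  fixes f :: "nat \<Rightarrow> 'c::complete_nonarch_field"
  assumes "f sums s" "0 \<le> B" "\<And>i. i \<ge> m \<Longrightarrow> abs_val (f i) \<le> B"
  shows "abs_val (s - (\<Sum>i<m. f i)) \<le> B"
proof (rule abs_val_limit_le)
  show "(\<lambda>N. (\<Sum>i<N. f i) - (\<Sum>i<m. f i)) \<longlonglongrightarrow> s - (\<Sum>i<m. f i)"
    using assms(1) by (intro tendsto_diff_nonarch tendsto_const) (simp add: sums_def)
  show "\<forall>\<^sub>F N in sequentially. abs_val ((\<Sum>i<N. f i) - (\<Sum>i<m. f i)) \<le> B"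
  proof (rule eventually_sequentiallyI[of m])
    fix N assume "m \<le> N"
    then have "(\<Sum>i<N. f i) - (\<Sum>i<m. f i) = (\<Sum>i\<in>{..<N} - {..<m}. f i)"
      by (subst sum_diff) auto
    then show "abs_val ((\<Sum>i<N. f i) - (\<Sum>i<m. f i)) \<le> B"
      using assms(2,3) by (auto intro!: abs_val_sum_le)
  qed
qed auto

lemma geometric_summable:
  fixes f :: "nat \<Rightarrow> 'c::complete_nonarch_field"
  assumes "0 \<le> \<theta>" "\<theta> < 1" "\<And>i. abs_val (f i) \<le> \<theta> ^ i"
  shows "\<exists>s. f sums s"
proof -
  have "convergent (\<lambda>n. \<Sum>i<n. f i)"
  proof (rule Cauchy_if_abs_val_diff_le)
    show "(\<lambda>m. \<theta> ^ m) \<longlonglongrightarrow> 0" using assms by (intro LIMSEQ_realpow_zero) auto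
    fix m n :: nat assume "m \<le> n"
    then have "(\<Sum>i<n. f i) - (\<Sum>i<m. f i) = (\<Sum>i\<in>{..<n} - {..<m}. f i)"
      by (subst sum_diff) auto
    also have "abs_val \<dots> \<le> \<theta> ^ m"
    proof (rule abs_val_sum_le)
      fix i assume "i \<in> {..<n} - {..<m}"
      then have "\<theta> ^ i \<le> \<theta> ^ m" using assms by (intro power_decreasing) auto
      then show "abs_val (f i) \<le> \<theta> ^ m" using assms(3)[of i] by simp
    qed (use assms in simp)
    finally show "abs_val ((\<Sum>i<n. f i) - (\<Sum>i<m. f i)) \<le> \<theta> ^ m" .
  qed
  then show ?thesis by (auto simp: convergent_def sums_def)
qed

text \<open>The square of pairs \<open>i, j < n\<close> differs from the triangle
  \<open>i + j < n\<close> only by pairs with \<open>i + j >= n\<close>, and each of those terms is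
  at most \<open>\<theta>^n\<close>.\<close>

lemma geometric_Cauchy_product:
  fixes f g :: "nat \<Rightarrow> 'c::complete_nonarch_field"
  assumes th: "0 \<le> \<theta>" "\<theta> < 1"
    and f: "\<And>i. abs_val (f i) \<le> \<theta> ^ i" "f sums s" and g: "\<And>i. abs_val (g i) \<le> \<theta> ^ i" "g sums s'"
  shows "(\<lambda>k. \<Sum>i\<le>k. f i * g (k - i)) sums (s * s')"
proof -
  have "abs_val ((\<Sum>k<n. \<Sum>i\<le>k. f i * g (k - i)) - (\<Sum>i<n. f i) * (\<Sum>j<n. g j)) \<le> \<theta> ^ n" for n
  proof -
    let ?T = "{(i, j). i + j < n}"
    have sub: "?T \<subseteq> {..<n} \<times> {..<n}" by auto
    have "(\<Sum>i<n. f i) * (\<Sum>j<n. g j) = (\<Sum>(i, j)\<in>{..<n} \<times> {..<n}. f i * g j)"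
      by (simp add: sum_product sum.cartesian_product)
    moreover have "(\<Sum>k<n. \<Sum>i\<le>k. f i * g (k - i)) = (\<Sum>(i, j)\<in>?T. f i * g j)"
      by (rule sum.triangle_reindex[symmetric])
    ultimately have "(\<Sum>i<n. f i) * (\<Sum>j<n. g j) - (\<Sum>k<n. \<Sum>i\<le>k. f i * g (k - i))
        = (\<Sum>(i, j)\<in>{..<n} \<times> {..<n} - ?T. f i * g j)"
      using sub by (simp add: sum_diff)
    also have "abs_val \<dots> \<le> \<theta> ^ n"
    proof (rule abs_val_sum_le)
      fix x assume "x \<in> {..<n} \<times> {..<n} - ?T"
      then obtain i j where ij: "x = (i, j)" "i + j \<ge> n" by (cases x) auto
      have "abs_val (f i * g j) \<le> \<theta> ^ i * \<theta> ^ j"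
        unfolding abs_val_mult using f g th by (intro mult_mono) auto
      also have "\<dots> \<le> \<theta> ^ n" using th ij by (simp flip: power_add add: power_decreasing)
      finally show "abs_val (case x of (i, j) \<Rightarrow> f i * g j) \<le> \<theta> ^ n" by (simp add: ij)
    qed (use th in simp)
    finally show ?thesis by (subst abs_val_minus_commute)
  qed
  then have "(\<lambda>n. (\<Sum>k<n. \<Sum>i\<le>k. f i * g (k - i)) - (\<Sum>i<n. f i) * (\<Sum>j<n. g j)) \<longlonglongrightarrow> 0"
    unfolding tendsto_abs_val_iff[of _ 0] diff_0_right
    using th by (intro tendsto_sandwich[OF _ _ tendsto_const LIMSEQ_realpow_zero[of \<theta>]]) (auto intro!: always_eventually)
  moreover have "(\<lambda>n. (\<Sum>i<n. f i) * (\<Sum>j<n. g j)) \<longlonglongrightarrow> s * s'"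
    using f(2) g(2) unfolding sums_def by (rule tendsto_mult_nonarch)
  ultimately show ?thesis
    unfolding sums_def using tendsto_add by fastforce
qed

text \<open>Taking the \<open>K\<close>-th root of \<open>\<theta>\<close> reduces this to the limit
  of \<open>j x^j\<close>.\<close>

lemma power_times_geometric_tendsto_0:
  fixes \<theta> :: real
  assumes "0 \<le> \<theta>" "\<theta> < 1"
  shows "(\<lambda>j. real j ^ K * \<theta> ^ j) \<longlonglongrightarrow> 0"
proof (cases "K = 0")
  case True
  then show ?thesis using assms by (simp add: LIMSEQ_realpow_zero)
next
  case False
  define x where "x = root K \<theta>"
  have x: "0 \<le> x" "x < 1" "x ^ K = \<theta>" using False assms by (auto simp: x_def real_root_pow_pos2)
  have "(\<lambda>j. (real j * x ^ j) ^ K) \<longlonglongrightarrow> 0 ^ K"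
    using x by (intro tendsto_power powser_times_n_limit_0) auto
  moreover have "(real j * x ^ j) ^ K = real j ^ K * \<theta> ^ j" for j
    by (simp add: power_mult_distrib mult.commute flip: x(3) power_mult)
  ultimately show ?thesis using False by (simp add: power_0_left)
qed

context carlitz begin

text \<open>
  The degree bound makes the power series converge for \<open>|t| < 1 / q\<close> and at the same time records
  that its coefficients lie in \<open>A\<close>.
\<close>

definition tame :: "'c fps \<Rightarrow> bool" where
  "tame f \<longleftrightarrow> (\<forall>j. \<exists>a. fps_nth f j = emb a \<and> degree a \<le> j)"

lemma tame_sum: "(\<And>i. i \<in> S \<Longrightarrow> tame (f i)) \<Longrightarrow> tame (\<Sum>i\<in>S. f i)"
proof (induction S rule: infinite_finite_induct)
  case (insert i S)
  show ?case unfolding tame_def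
  proof
    fix j
    obtain a b where "fps_nth (f i) j = emb a" "degree a \<le> j" "fps_nth (\<Sum>i\<in>S. f i) j = emb b" "degree b \<le> j"
      using insert unfolding tame_def by (metis insertCI)
    then show "\<exists>a. fps_nth (\<Sum>i\<in>insert i S. f i) j = emb a \<and> degree a \<le> j"
      using insert by (intro exI[of _ "a + b"]) (auto simp: emb_add intro: degree_add_le)
  qed
qed (auto simp: tame_def intro!: exI[of _ 0])

lemma tame_mult:
  assumes "tame f" "tame g"
  shows "tame (f * g)"
  unfolding tame_def
proof
  fix j
  obtain a where a: "\<And>i. fps_nth f i = emb (a i) \<and> degree (a i) \<le> i" using assms(1) unfolding tame_def by metis
  obtain b where b: "\<And>i. fps_nth g i = emb (b i) \<and> degree (b i) \<le> i" using assms(2) unfolding tame_def by metis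
  have "fps_nth (f * g) j = emb (\<Sum>i=0..j. a i * b (j - i))"
    using a b by (simp add: fps_mult_nth emb_sum emb_mult)
  moreover have "degree (\<Sum>i=0..j. a i * b (j - i)) \<le> j"
  proof (rule degree_sum_le)
    fix i assume i: "i \<in> {0..j}"
    show "degree (a i * b (j - i)) \<le> j"
      using degree_mult_le[of "a i" "b (j - i)"] a[of i] b[of "j - i"] i by auto
  qed simp
  ultimately show "\<exists>a. fps_nth (f * g) j = emb a \<and> degree a \<le> j" by blast
qed

lemma tame_monomial:
  assumes "degree c \<le> k"
  shows "tame (fps_const (emb c) * fps_X ^ k)"
  unfolding tame_def
proof
  fix j show "\<exists>a. fps_nth (fps_const (emb c) * fps_X ^ k) j = emb a \<and> degree a \<le> j"
    using assms by (cases "j = k") (auto simp: fps_X_power_nth intro: exI[of _ 0])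
qed

lemma tame_1: "tame 1"
  using tame_monomial[of 1 0] by simp

lemma tame_power: "tame f \<Longrightarrow> tame (f ^ n)"
  by (induction n) (auto intro: tame_1 tame_mult)

text \<open>With constant term 1 the recursion for the inverse involves no division, so its
  coefficients stay in \<open>A\<close>; the degrees add up along the convolution.\<close>

lemma tame_inverse:
  assumes "tame f" "fps_nth f 0 = 1"
  shows "tame (inverse f)"
proof -
  have "\<exists>a. fps_nth (inverse f) j = emb a \<and> degree a \<le> j" for j
  proof (induction j rule: less_induct)
    case (less j)
    show ?case
    proof (cases "j = 0")
      case True
      then show ?thesis using assms by (intro exI[of _ 1]) simp
    next
      case False
      obtain a where a: "\<And>i. fps_nth f i = emb (a i) \<and> degree (a i) \<le> i" using assms(1) unfolding tame_def by metis
      obtain b where b: "\<And>i. i < j \<Longrightarrow> fps_nth (inverse f) i = emb (b i) \<and> degree (b i) \<le> i"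
        using less by metis
      have "inverse f * f = 1" by (rule inverse_mult_eq_1) (use assms in simp)
      then have "(\<Sum>i=0..j. fps_nth (inverse f) i * fps_nth f (j - i)) = 0"
        using False by (metis fps_mult_nth fps_one_nth)
      moreover have "{0..j} = insert j {..<j}" by auto
      ultimately have "fps_nth (inverse f) j + (\<Sum>i<j. fps_nth (inverse f) i * fps_nth f (j - i)) = 0"
        using assms by simp
      moreover have "(\<Sum>i<j. fps_nth (inverse f) i * fps_nth f (j - i)) = emb (\<Sum>i<j. b i * a (j - i))"
        using a b by (simp add: emb_sum emb_mult)
      ultimately have "fps_nth (inverse f) j = emb (- (\<Sum>i<j. b i * a (j - i)))"
        by (simp add: emb_minus eq_neg_iff_add_eq_0)
      moreover have "degree (\<Sum>i<j. b i * a (j - i)) \<le> j"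
      proof (rule degree_sum_le)
        fix i assume i: "i \<in> {..<j}"
        show "degree (b i * a (j - i)) \<le> j"
          using degree_mult_le[of "b i" "a (j - i)"] b[of i] a[of "j - i"] i by auto
      qed simp
      ultimately show ?thesis by (intro exI[of _ "- (\<Sum>i<j. b i * a (j - i))"]) simp
    qed
  qed
  then show ?thesis by (simp add: tame_def)
qed

lemma abs_tame_nth: "tame f \<Longrightarrow> abs_val (fps_nth f j) \<le> real q ^ j"
proof -
  assume "tame f"
  then obtain a where a: "fps_nth f j = emb a" "degree a \<le> j" unfolding tame_def by blast
  show ?thesis
  proof (cases "a = 0")
    case False
    then show ?thesis using a q_gt_1 by (simp add: abs_emb power_increasing)
  qed (use a in simp)
qed

lemma abs_tame_term: "tame f \<Longrightarrow> abs_val (fps_nth f j * x ^ j) \<le> (real q * abs_val x) ^ j"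
  by (simp add: abs_val_mult abs_val_power power_mult_distrib mult_right_mono abs_tame_nth)

lemma tame_sums_mult:
  assumes "tame f" "tame g" "real q * abs_val x < 1"
    and "(\<lambda>j. fps_nth f j * x ^ j) sums s" "(\<lambda>j. fps_nth g j * x ^ j) sums s'"
  shows "(\<lambda>j. fps_nth (f * g) j * x ^ j) sums (s * s')"
proof -
  have "(\<lambda>k. \<Sum>i\<le>k. (fps_nth f i * x ^ i) * (fps_nth g (k - i) * x ^ (k - i))) sums (s * s')"
    by (rule geometric_Cauchy_product[where \<theta> = "real q * abs_val x"])
      (use assms abs_tame_term in \<open>auto simp: mult_nonneg_nonneg\<close>)
  moreover have "(\<Sum>i\<le>k. (fps_nth f i * x ^ i) * (fps_nth g (k - i) * x ^ (k - i))) = fps_nth (f * g) k * x ^ k" for k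
    unfolding fps_mult_nth sum_distrib_right atLeast0AtMost
  proof (intro sum.cong refl)
    fix i assume "i \<in> {..k}"
    then have "x ^ k = x ^ i * x ^ (k - i)" by (simp flip: power_add)
    then show "(fps_nth f i * x ^ i) * (fps_nth g (k - i) * x ^ (k - i)) = fps_nth f i * fps_nth g (k - i) * x ^ k"
      by simp
  qed
  ultimately show ?thesis by simp
qed

lemma monomial_sums: "(\<lambda>j. fps_nth (fps_const c * fps_X ^ k) j * x ^ j) sums (c * x ^ k)"
proof -
  have "(\<lambda>j. fps_nth (fps_const c * fps_X ^ k) j * x ^ j) = (\<lambda>j. if j = k then c * x ^ k else 0)"
    by (auto simp: fps_X_power_nth)
  then show ?thesis using sums_single[of k "\<lambda>j. c * x ^ k"] by simp
qed

lemma tame_sums_power: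
  assumes "tame f" "real q * abs_val x < 1" "(\<lambda>j. fps_nth f j * x ^ j) sums s"
  shows "(\<lambda>j. fps_nth (f ^ n) j * x ^ j) sums (s ^ n)"
proof (induction n)
  case 0
  show ?case using monomial_sums[of 1 0 x] by simp
next
  case (Suc n)
  show ?case unfolding power_Suc using assms Suc by (intro tame_sums_mult tame_power)
qed

section \<open>The Carlitz module and the expansion of \<open>t (emb a * z)\<close>\<close>

lemma le_power_minus_1: "(x::nat) \<le> q ^ x - 1"
proof -
  have "x < 2 ^ x" by (rule less_exp)
  also have "\<dots> \<le> q ^ x" using q_gt_1 by (intro power_mono) auto
  finally show ?thesis by linarith
qed

text \<open>The \<open>c i\<close> are the coefficients of the Carlitz polynomial of
  \<open>a\<close>. Horner's scheme \<open>a = k + T b\<close> combines with the functional equation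
  at \<open>T\<close>, and the \<open>q\<close>-th power acts termwise in characteristic
  \<open>p\<close>.\<close>

lemma carlitz_module_coeffs:
  assumes char: "prime CHAR('c)" and q: "q = CHAR('c) ^ e"
    and a: "a \<in> monic" "degree a = m"
  shows "\<exists>c. c m = 1 \<and> (\<forall>i\<le>m. degree (c i) \<le> (m - i) * q ^ i) \<and>
    (\<forall>z. ex (emb a * z) = (\<Sum>i\<le>m. emb (c i) * ex z ^ (q ^ i)))"
  using a
proof (induction m arbitrary: a)
  case 0
  then have "a = 1" by (auto simp: monic_def elim!: degree_eq_zeroE)
  then show ?case by (intro exI[of _ "\<lambda>_. 1"]) simp
next
  case (Suc m)
  obtain k b where kb: "a = pCons k b" by (cases a)
  then have "b \<noteq> 0" using Suc.prems by auto
  then have b: "b \<in> monic" "degree b = m" using Suc.prems kb by (auto simp: monic_def)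
  from Suc.IH[OF this] obtain c where c: "c m = 1" "\<And>i. i \<le> m \<Longrightarrow> degree (c i) \<le> (m - i) * q ^ i"
    "\<And>z. ex (emb b * z) = (\<Sum>i\<le>m. emb (c i) * ex z ^ (q ^ i))" by blast
  \<comment> \<open>The first summand collects \<open>k\<close> and the shifted \<open>q\<close>-th
    powers of the old coefficients, the second their multiples by \<open>T\<close>.\<close>
  define c' where "c' i = (if i = 0 then [:k:] else c (i - 1) ^ q) + (if i \<le> m then pCons 0 (c i) else 0)" for i
  have pos: "q ^ i \<ge> 1" for i using q_gt_1 by (simp add: one_le_power)
  have "c' (Suc m) = 1" by (simp add: c'_def c(1))
  moreover have "degree (c' i) \<le> (Suc m - i) * q ^ i" if "i \<le> Suc m" for i
    unfolding c'_def
  proof (rule degree_add_le)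
    show "degree (if i = 0 then [:k:] else c (i - 1) ^ q) \<le> (Suc m - i) * q ^ i"
    proof (cases "i = 0")
      case False
      then have "degree (c (i - 1) ^ q) \<le> (m - (i - 1)) * q ^ (i - 1) * q"
        using that by (intro order_trans[OF degree_power_le] mult_le_mono1 c(2)) auto
      also have "\<dots> = (Suc m - i) * q ^ i" using False by (cases i) auto
      finally show ?thesis using False by simp
    qed simp
    show "degree (if i \<le> m then pCons 0 (c i) else 0) \<le> (Suc m - i) * q ^ i"
    proof (cases "i \<le> m")
      case True
      have "degree (pCons 0 (c i)) \<le> Suc (degree (c i))" by (simp add: degree_pCons_le)
      also have "\<dots> \<le> Suc ((m - i) * q ^ i)" using c(2)[OF True] by simp
      also have "\<dots> \<le> (Suc m - i) * q ^ i" using pos[of i] True by (simp add: Suc_diff_le)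
      finally show ?thesis using True by simp
    qed simp
  qed
  moreover have "ex (emb a * z) = (\<Sum>i\<le>Suc m. emb (c' i) * ex z ^ (q ^ i))" for z
  proof -
    have "emb a * z = \<kappa> k * z + T * (emb b * z)"
      by (simp add: kb emb_pCons algebra_simps)
    then have "ex (emb a * z) = \<kappa> k * ex z + (T * ex (emb b * z) + ex (emb b * z) ^ q)"
      by (simp add: ex_add ex_const_mult ex_T)
    also have "ex (emb b * z) ^ q = (\<Sum>i\<le>m. emb (c i ^ q) * ex z ^ (q ^ Suc i))"
      unfolding c(3) by (subst freshmans_dream_sum'[OF char q])
        (simp add: power_mult_distrib emb_power mult.commute flip: power_mult)
    also have "\<kappa> k * ex z + (T * ex (emb b * z) + \<dots>) = (\<Sum>i\<le>m. T * emb (c i) * ex z ^ (q ^ i))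
        + (\<kappa> k * ex z + (\<Sum>i\<le>m. emb (c i ^ q) * ex z ^ (q ^ Suc i)))"
      unfolding c(3) by (simp add: sum_distrib_left mult.assoc)
    also have "\<kappa> k * ex z + (\<Sum>i\<le>m. emb (c i ^ q) * ex z ^ (q ^ Suc i))
        = (\<Sum>i\<le>Suc m. emb (if i = 0 then [:k:] else c (i - 1) ^ q) * ex z ^ (q ^ i))"
      by (subst sum.atMost_Suc_shift) (simp add: emb_const)
    also have "(\<Sum>i\<le>m. T * emb (c i) * ex z ^ (q ^ i))
        = (\<Sum>i\<le>Suc m. emb (if i \<le> m then pCons 0 (c i) else 0) * ex z ^ (q ^ i))"
      by (simp add: emb_pCons)
    finally show ?thesis
      by (simp add: c'_def emb_add distrib_right sum.distrib del: sum.atMost_Suc)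
  qed
  ultimately show ?case by blast
qed

text \<open>\<open>f\<close> is the Carlitz polynomial of \<open>a\<close> with its coefficients
  reversed: its value at \<open>1 / t\<close> is \<open>f(t) / t^(q^m)\<close>. As \<open>a\<close>
  is monic, \<open>f\<close> has constant term 1, so \<open>t^(q^m) / f\<close> is a power series
  over \<open>A\<close> starting at \<open>q^m\<close>.\<close>

lemma exists_t_expansion_t:
  assumes char: "prime CHAR('c)" and q: "q = CHAR('c) ^ e" and a: "a \<in> monic"
  shows "\<exists>H. tame H \<and> (\<forall>j < q ^ degree a. fps_nth H j = 0) \<and>
    (\<forall>z\<in>\<Omega>. real q * abs_val (t z) < 1 \<longrightarrow> (\<lambda>j. fps_nth H j * t z ^ j) sums t (emb a * z))"
proof -
  define m where "m = degree a"
  obtain c where c: "c m = 1" "\<And>i. i \<le> m \<Longrightarrow> degree (c i) \<le> (m - i) * q ^ i"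
    "\<And>z. ex (emb a * z) = (\<Sum>i\<le>m. emb (c i) * ex z ^ (q ^ i))"
    using carlitz_module_coeffs[OF char q a m_def[symmetric]] by blast
  have q_le: "q ^ i \<le> q ^ m" if "i \<le> m" for i using that q_gt_1 by (intro power_increasing) auto
  define f where "f = (\<Sum>i\<le>m. fps_const (emb (c i)) * fps_X ^ (q ^ m - q ^ i))"
  define H where "H = fps_X ^ (q ^ m) * inverse f"
  have "tame f"
    unfolding f_def
  proof (intro tame_sum tame_monomial)
    fix i assume "i \<in> {..m}"
    then have i: "i \<le> m" by simp
    then have "degree (c i) \<le> (m - i) * q ^ i" by (rule c)
    \<comment> \<open>From \<open>m - i <= q^(m - i) - 1\<close> the degree of \<open>c i\<close> is
      at most the exponent of its monomial in \<open>f\<close>, exactly what \<open>tame\<close>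
      asks for.\<close>
    also have "\<dots> \<le> (q ^ (m - i) - 1) * q ^ i" by (intro mult_le_mono1 le_power_minus_1)
    also have "\<dots> = q ^ m - q ^ i" using i by (simp add: diff_mult_distrib flip: power_add)
    finally show "degree (c i) \<le> q ^ m - q ^ i" .
  qed
  moreover have f0: "fps_nth f 0 = 1"
  proof -
    have "fps_nth f 0 = (\<Sum>i\<le>m. if i = m then 1 else 0)"
      unfolding f_def fps_sum_nth
    proof (intro sum.cong refl)
      fix i assume "i \<in> {..m}"
      then have "q ^ m - q ^ i = 0 \<longleftrightarrow> i = m" using q_gt_1 q_le[of i] power_inject_exp[of q i m] by auto
      then show "fps_nth (fps_const (emb (c i)) * fps_X ^ (q ^ m - q ^ i)) 0 = (if i = m then 1 else 0)"
        by (auto simp: fps_X_power_nth c(1))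
    qed
    then show ?thesis by simp
  qed
  ultimately have inv: "tame (inverse f)" by (rule tame_inverse)
  have X: "tame (fps_X ^ (q ^ m))" using tame_monomial[of 1 "q ^ m"] by simp
  have "(\<lambda>j. fps_nth H j * t z ^ j) sums t (emb a * z)" if z: "z \<in> \<Omega>" "real q * abs_val (t z) < 1" for z
  proof -
    define x where "x = t z"
    have x: "x \<noteq> 0" "ex (\<omega> * z) = 1 / x" using t_nonzero[OF z(1)] by (auto simp: x_def t_param_def)
    obtain v where v: "(\<lambda>j. fps_nth (inverse f) j * x ^ j) sums v"
      using geometric_summable[of "real q * abs_val x" "\<lambda>j. fps_nth (inverse f) j * x ^ j"]
        abs_tame_term[OF inv] z(2) by (auto simp: x_def)
    define y where "y = (\<Sum>i\<le>m. emb (c i) * x ^ (q ^ m - q ^ i))"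
    have y: "(\<lambda>j. fps_nth f j * x ^ j) sums y"
      unfolding f_def y_def fps_sum_nth sum_distrib_right by (intro sums_sum_nonarch monomial_sums)
    have "(\<lambda>j. fps_nth (inverse f * f) j * x ^ j) sums (v * y)"
      using inv \<open>tame f\<close> z(2) v y unfolding x_def[symmetric] by (intro tame_sums_mult)
    moreover have "inverse f * f = 1" by (rule inverse_mult_eq_1) (simp add: f0)
    moreover have "(\<lambda>j. fps_nth 1 j * x ^ j) sums 1" using monomial_sums[of 1 0 x] by simp
    ultimately have vy: "v * y = 1" by (metis sums_unique2)
    have "y = x ^ (q ^ m) * ex (\<omega> * (emb a * z))"
    proof -
      have "ex (\<omega> * (emb a * z)) = (\<Sum>i\<le>m. emb (c i) * (1 / x) ^ (q ^ i))"
        using c(3)[of "\<omega> * z"] x(2) by (simp add: mult.left_commute)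
      then show ?thesis
        unfolding y_def using x(1) q_le
        by (simp add: sum_distrib_left power_diff power_divide mult.commute)
    qed
    then have "ex (\<omega> * (emb a * z)) * (x ^ (q ^ m) * v) = 1"
      using vy by (simp add: mult_ac)
    from inverse_unique[OF this] have "t (emb a * z) = x ^ (q ^ m) * v"
      by (simp add: t_param_def inverse_eq_divide)
    moreover have "(\<lambda>j. fps_nth H j * x ^ j) sums (x ^ (q ^ m) * v)"
      unfolding H_def using X inv z(2) v monomial_sums[of 1 "q ^ m" x] unfolding x_def[symmetric]
      by (intro tame_sums_mult) auto
    ultimately show ?thesis by (simp add: x_def)
  qed
  moreover have "tame H" unfolding H_def by (intro tame_mult X inv)
  moreover have "\<forall>j < q ^ degree a. fps_nth H j = 0"
    by (simp add: H_def fps_X_power_mult_nth m_def)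
  ultimately show ?thesis by blast
qed

section \<open>The expansion of the form at infinity\<close>

definition t_fps :: "'f poly \<Rightarrow> 'c fps" where
  "t_fps a = (SOME H. tame H \<and> (\<forall>j < q ^ degree a. fps_nth H j = 0) \<and>
    (\<forall>z\<in>\<Omega>. real q * abs_val (t z) < 1 \<longrightarrow> (\<lambda>j. fps_nth H j * t z ^ j) sums t (emb a * z)))"

text \<open>The series \<open>t_fps a\<close> starts at \<open>q^(deg a)\<close>, which exceeds
  \<open>deg a\<close>. Monic \<open>a\<close> of degree at least \<open>j\<close> thus contribute
  nothing to the coefficient at \<open>j\<close>, and the sum is finite.\<close>

definition A_exp_coeff :: "nat \<Rightarrow> nat \<Rightarrow> nat \<Rightarrow> 'c" where
  "A_exp_coeff K n j = (\<Sum>a\<in>polys_lt j \<inter> monic. emb a ^ K * (\<Sum>i\<le>n. coeff (G n) i * fps_nth (t_fps a ^ i) j))"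

lemma degree_goss_le: "degree (goss \<alpha> n) \<le> n"
proof (induction n rule: less_induct)
  case (less n)
  have "degree ((if n = 1 then 1 else 0) + (\<Sum>i\<in>{1..<n}. smult (\<alpha> i) (goss \<alpha> (n - i)))) \<le> n - 1"
  proof (rule degree_add_le)
    show "degree (\<Sum>i\<in>{1..<n}. smult (\<alpha> i) (goss \<alpha> (n - i))) \<le> n - 1"
    proof (rule degree_sum_le)
      fix i assume i: "i \<in> {1..<n}"
      then have "degree (goss \<alpha> (n - i)) \<le> n - i" by (intro less) auto
      then show "degree (smult (\<alpha> i) (goss \<alpha> (n - i))) \<le> n - 1"
        using i degree_smult_le[of "\<alpha> i" "goss \<alpha> (n - i)"] by auto
    qed simp
  qed simp
  then show ?case
  proof (subst goss.simps, cases "n = 0")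
    case False
    assume "degree ((if n = 1 then 1 else 0) + (\<Sum>i\<in>{1..<n}. smult (\<alpha> i) (goss \<alpha> (n - i)))) \<le> n - 1"
    then show "degree (pCons 0 ((if n = 1 then 1 else 0) + (\<Sum>i\<in>{1..<n}. smult (\<alpha> i) (goss \<alpha> (n - i))))) \<le> n"
      using False by (intro order_trans[OF degree_pCons_le]) linarith
  qed simp
qed

text \<open>The sum over \<open>a\<close> has to be interchanged with the power series. Cutting both
  at \<open>m\<close> leaves, for each \<open>a\<close>, a power series tail, and these tails are
  small uniformly in \<open>a\<close>.\<close>

lemma A_exp_has_t_expansion:
  assumes char: "prime CHAR('c)" and q: "q = CHAR('c) ^ e"
  shows "has_t_expansion \<iota> \<omega> (A_exp K n) (Abs_fps (A_exp_coeff K n))"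
proof -
  have H: "tame (t_fps a)" "\<And>j. j < q ^ degree a \<Longrightarrow> fps_nth (t_fps a) j = 0"
    "\<And>z. z \<in> \<Omega> \<Longrightarrow> real q * abs_val (t z) < 1 \<Longrightarrow> (\<lambda>j. fps_nth (t_fps a) j * t z ^ j) sums t (emb a * z)"
    if "a \<in> monic" for a
    using someI_ex[OF exists_t_expansion_t[OF char q that]] unfolding t_fps_def by blast+
  define g where "g a j = (\<Sum>i\<le>n. coeff (G n) i * fps_nth (t_fps a ^ i) j)" for a j
  define B where "B = (\<Sum>i\<le>n. abs_val (coeff (G n) i))"
  have B: "B \<ge> 0" unfolding B_def by (intro sum_nonneg) simp
  have g_bound: "abs_val (g a j * x ^ j) \<le> B * (real q * abs_val x) ^ j" if "a \<in> monic" for a j x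
    unfolding g_def sum_distrib_right
  proof (rule abs_val_sum_le)
    fix i assume i: "i \<in> {..n}"
    have "abs_val (coeff (G n) i * fps_nth (t_fps a ^ i) j * x ^ j)
        = abs_val (coeff (G n) i) * abs_val (fps_nth (t_fps a ^ i) j * x ^ j)"
      by (simp add: abs_val_mult)
    also have "\<dots> \<le> B * (real q * abs_val x) ^ j"
      using i H(1)[OF that] B unfolding B_def
      by (intro mult_mono abs_tame_term tame_power member_le_sum) auto
    finally show "abs_val (coeff (G n) i * fps_nth (t_fps a ^ i) j * x ^ j) \<le> B * (real q * abs_val x) ^ j" .
  qed (use B in simp)
  have g_0: "g a j = 0" if a: "a \<in> monic" "j < q ^ degree a" for a j
    unfolding g_def
  proof (intro sum.neutral ballI)
    fix i
    show "coeff (G n) i * fps_nth (t_fps a ^ i) j = 0"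
    proof (cases i)
      case (Suc i')
      have "fps_nth (t_fps a ^ i) j = (\<Sum>l=0..j. fps_nth (t_fps a) l * fps_nth (t_fps a ^ i') (j - l))"
        unfolding Suc power_Suc by (rule fps_mult_nth)
      also have "\<dots> = 0" using H(2)[OF a(1)] a(2) by (intro sum.neutral) auto
      finally show ?thesis by simp
    qed simp
  qed
  have g_sums: "(\<lambda>j. g a j * t z ^ j) sums poly (G n) (t (emb a * z))"
    if "a \<in> monic" "z \<in> \<Omega>" "real q * abs_val (t z) < 1" for a z
  proof -
    have "(\<lambda>j. \<Sum>i\<le>n. coeff (G n) i * (fps_nth (t_fps a ^ i) j * t z ^ j)) sums (\<Sum>i\<le>n. coeff (G n) i * t (emb a * z) ^ i)"
      using that H by (intro sums_sum_nonarch sums_mult_nonarch tame_sums_power) auto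
    moreover have "(\<Sum>i\<le>n. coeff (G n) i * t (emb a * z) ^ i) = poly (G n) (t (emb a * z))"
      using poly_eq_sum_lessThan[of "G n" "Suc n"] degree_goss_le[of exp_coeff n] by (simp add: lessThan_Suc_atMost)
    ultimately show ?thesis by (simp add: g_def sum_distrib_right mult.assoc)
  qed
  obtain C where C: "C > 0" "\<And>w. im w \<ge> 1 \<Longrightarrow> abs_val (t w) \<le> C / im w ^ (q ^ 0)"
    using t_bound[of 0] by blast
  \<comment> \<open>\<open>im z >= q * C + 1\<close> forces \<open>q |t z| < 1\<close>, where tame
    series converge; the bound 1 admits \<open>t_bound\<close>.\<close>
  define R where "R = max 1 (q * C + 1)"
  have "(\<lambda>j. A_exp_coeff K n j * t z ^ j) sums A_exp K n z" if z: "im z \<ge> R" for z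
  proof -
    have im: "im z \<ge> 1" "q * C < im z" using z by (auto simp: R_def)
    then have zO: "z \<in> \<Omega>" unfolding im_pos_iff[symmetric] by linarith
    define \<theta> where "\<theta> = real q * abs_val (t z)"
    have "\<theta> \<le> q * (C / im z)" unfolding \<theta>_def using C(2)[OF im(1)] by (intro mult_left_mono) auto
    also have "\<dots> < 1" using im by (simp add: field_simps)
    finally have th: "0 \<le> \<theta>" "\<theta> < 1" by (simp_all add: \<theta>_def)
    define d where "d m = (\<Sum>a\<in>polys_lt m \<inter> monic. A_term K n z a)
        - (\<Sum>j<m. A_exp_coeff K n j * t z ^ j)" for m
    have d_eq: "d m = (\<Sum>a\<in>polys_lt m \<inter> monic. A_term K n z a - (\<Sum>j<m. emb a ^ K * (g a j * t z ^ j)))" for m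
    proof -
      have "(\<Sum>j<m. A_exp_coeff K n j * t z ^ j) = (\<Sum>j<m. \<Sum>a\<in>polys_lt m \<inter> monic. emb a ^ K * (g a j * t z ^ j))"
      proof (intro sum.cong refl)
        fix j assume j: "j \<in> {..<m}"
        have "A_exp_coeff K n j * t z ^ j = (\<Sum>a\<in>polys_lt j \<inter> monic. emb a ^ K * (g a j * t z ^ j))"
          by (simp add: A_exp_coeff_def g_def sum_distrib_right mult.assoc)
        also have "\<dots> = (\<Sum>a\<in>polys_lt m \<inter> monic. emb a ^ K * (g a j * t z ^ j))"
        proof (rule sum.mono_neutral_left)
          show "polys_lt j \<inter> monic \<subseteq> polys_lt m \<inter> monic"
            using polys_lt_mono[of j m] j by auto
          show "\<forall>a\<in>polys_lt m \<inter> monic - polys_lt j \<inter> monic. emb a ^ K * (g a j * t z ^ j) = 0"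
          proof
            fix a assume a: "a \<in> polys_lt m \<inter> monic - polys_lt j \<inter> monic"
            then have "j \<le> degree a" by (auto simp: polys_lt_iff)
            also have "degree a < q ^ degree a" using le_power_minus_1[of "degree a"] q_gt_1
              by (metis One_nat_def Suc_pred le_imp_less_Suc not_gr_zero power_eq_0_iff not_less_zero)
            finally show "emb a ^ K * (g a j * t z ^ j) = 0" using a by (simp add: g_0)
          qed
        qed simp
        finally show "A_exp_coeff K n j * t z ^ j = (\<Sum>a\<in>polys_lt m \<inter> monic. emb a ^ K * (g a j * t z ^ j))" .
      qed
      also have "\<dots> = (\<Sum>a\<in>polys_lt m \<inter> monic. \<Sum>j<m. emb a ^ K * (g a j * t z ^ j))" by (rule sum.swap)
      finally show ?thesis by (simp add: d_def sum_subtractf)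
    qed
    have "d \<longlonglongrightarrow> 0"
      unfolding tendsto_iff
    proof (intro allI impI)
      fix \<epsilon> :: real assume e: "\<epsilon> > 0"
      have "(\<lambda>j. B * (real j ^ K * \<theta> ^ j)) \<longlonglongrightarrow> B * 0"
        by (intro tendsto_mult tendsto_const power_times_geometric_tendsto_0 th)
      then have "\<forall>\<^sub>F j in sequentially. B * (real j ^ K * \<theta> ^ j) < \<epsilon> / 2"
        using e by (intro order_tendstoD(2)) auto
      then obtain m0 where m0: "\<And>j. j \<ge> m0 \<Longrightarrow> B * (real j ^ K * \<theta> ^ j) < \<epsilon> / 2"
        by (auto simp: eventually_at_top_linorder)
      have "abs_val (d m) \<le> \<epsilon> / 2" if m: "m \<ge> m0" for m
        unfolding d_eq
      proof (rule abs_val_sum_le)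
        fix a assume a: "a \<in> polys_lt m \<inter> monic"
        show "abs_val (A_term K n z a - (\<Sum>j<m. emb a ^ K * (g a j * t z ^ j))) \<le> \<epsilon> / 2"
        proof (rule geometric_sums_bound)
          show "(\<lambda>j. emb a ^ K * (g a j * t z ^ j)) sums (A_term K n z a)"
            using a zO th by (intro sums_mult_nonarch g_sums) (auto simp: \<theta>_def)
          fix j assume j: "m \<le> j"
          show "abs_val (emb a ^ K * (g a j * t z ^ j)) \<le> \<epsilon> / 2"
          proof (cases "j < q ^ degree a")
            case True
            then show ?thesis using a e by (simp add: g_0)
          next
            case False
            \<comment> \<open>The source of uniformity: a nonzero term at index \<open>j\<close>
              needs \<open>|a| <= j\<close>, so \<open>|a|^K\<close> is at most \<open>j^K\<close>,
              which loses against \<open>\<theta>^j\<close>.\<close>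
            then have "real (q ^ degree a) \<le> real j" by (intro of_nat_mono) simp
            moreover have "a \<noteq> 0" using a by (auto simp: monic_def)
            ultimately have "abs_val (emb a) \<le> real j" by (simp add: abs_emb)
            then have "abs_val (emb a) ^ K * abs_val (g a j * t z ^ j) \<le> real j ^ K * (B * \<theta> ^ j)"
              using a g_bound[of a j "t z"] unfolding \<theta>_def[symmetric] by (intro mult_mono power_mono) auto
            also have "\<dots> < \<epsilon> / 2" using m0[of j] j m by (simp add: mult.left_commute)
            finally show ?thesis by (simp only: abs_val_mult abs_val_power)
          qed
        qed (use e in simp)
      qed (use e in simp)
      then have "dist (d m) 0 < \<epsilon>" if "m \<ge> m0" for m
        using that e by (force simp: dist_eq_abs_val)
      then show "\<forall>\<^sub>F m in sequentially. dist (d m) 0 < \<epsilon>"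
        by (rule eventually_sequentiallyI)
    qed
    from tendsto_diff_nonarch[OF A_exp_tendsto[OF zO, of K n] this] show ?thesis
      by (simp add: sums_def d_def)
  qed
  then show ?thesis unfolding has_t_expansion_def by (intro exI[of _ R]) (auto simp: R_def)
qed

lemma A_exp_cusp_form:
  assumes char: "prime CHAR('c)" and q: "q = CHAR('c) ^ e"
    and P: "P = CHAR('c) ^ s" and K: "K = P * r"
    and n: "n > 0" "n \<le> P" "n < K" and dvd: "q - 1 dvd K - n" and m: "[m = int n] (mod (int q - 1))"
  shows "A_exp K n \<in> cusp_forms \<iota> \<omega> (K + n) m"
proof -
  have "fps_nth (Abs_fps (A_exp_coeff K n)) 0 = 0"
    by (auto simp: A_exp_coeff_def monic_def intro!: sum.neutral)
  then show ?thesis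
    unfolding cusp_forms_def Let_def
    using rigid_analytic_A_exp[OF n(1), of K] A_exp_has_t_expansion[OF char q, of K n]
      A_exp_modular[OF _ char P K n dvd m] by blast
qed

end

section \<open>Residues modulo a prime of \<open>A\<close>\<close>

text \<open>The count of roots over the integral domain modulo \<open>w\<close>, expressed through
  divisibility: \<open>S\<close> is a set of distinct residues, and a linear factor is split off at
  each step.\<close>

lemma card_roots_mod_prime_le:
  fixes f :: "'a::idom poly"
  assumes w: "prime_elem w" and S: "finite S" and lc: "\<not> w dvd lead_coeff f"
    and inc: "\<And>a b. a \<in> S \<Longrightarrow> b \<in> S \<Longrightarrow> a \<noteq> b \<Longrightarrow> \<not> w dvd a - b"
    and root: "\<And>a. a \<in> S \<Longrightarrow> w dvd poly f a"
  shows "card S \<le> degree f"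
  using S lc inc root
proof (induction "degree f" arbitrary: f S)
  case 0
  then obtain c where "f = [:c:]" by (metis degree_eq_zeroE)
  then have "S = {}" using 0 by auto
  then show ?case by simp
next
  case (Suc m)
  show ?case
  proof (cases "S = {}")
    case False
    then obtain s where s: "s \<in> S" by blast
    define g where "g = synthetic_div f s"
    have f: "f = [:- s, 1:] * g + [:poly f s:]"
      unfolding g_def by (rule synthetic_div_correct'[symmetric])
    have dg: "degree g = m" using Suc.hyps(2) by (simp add: g_def degree_synthetic_div)
    have "coeff f (Suc m) = coeff g m"
      by (subst f) (simp add: coeff_eq_0 dg)
    then have lcg: "\<not> w dvd lead_coeff g" using Suc.prems(2) Suc.hyps(2) dg by simp
    have "card (S - {s}) \<le> degree g"
    proof (rule Suc.hyps(1)[OF dg[symmetric] _ lcg])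
      fix a assume a: "a \<in> S - {s}"
      have "poly f a = (a - s) * poly g a + poly f s" by (subst f) (simp add: algebra_simps)
      moreover have "w dvd poly f a - poly f s" using a s Suc.prems(4) by (intro dvd_diff) auto
      ultimately have "w dvd (a - s) * poly g a" by simp
      moreover have "\<not> w dvd a - s" using a s by (intro Suc.prems(3)) auto
      ultimately show "w dvd poly g a" using w by (auto simp: prime_elem_dvd_mult_iff)
    qed (use Suc.prems in auto)
    then show ?thesis using dg Suc.hyps(2) s Suc.prems(1) by simp
  qed simp
qed

lemma prime_elem_not_dvd_polys_lt:
  fixes w :: "'f::field poly"
  assumes "a \<in> polys_lt (degree w)" "a \<noteq> 0"
  shows "\<not> w dvd a"
  using assms dvd_imp_degree_le[of w a] by (auto simp: polys_lt_iff)

text \<open>Multiplication by \<open>a\<close> permutes the nonzero residues, represented by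
  polynomials of degree less than that of \<open>w\<close>. Compare the products of all
  residues.\<close>

lemma poly_fermat:
  fixes a w :: "'f::{field,finite} poly"
  assumes w: "prime_elem w"
  shows "w dvd a ^ (CARD('f) ^ degree w) - a"
proof (cases "w dvd a")
  case True
  have "w dvd a ^ (CARD('f) ^ degree w)"
    using True by (metis dvd_power dvd_trans zero_less_card_finite zero_less_power)
  then show ?thesis using True by (rule dvd_diff)
next
  case False
  define R where "R = polys_lt (degree w) - {0 :: 'f poly}"
  have w0: "w \<noteq> 0" using w by auto
  have fin: "finite R" by (simp add: R_def)
  have card: "card R = CARD('f) ^ degree w - 1" by (simp add: R_def card_polys_lt)
  have ndvd: "\<not> w dvd r" if "r \<in> R" for r
    using that by (intro prime_elem_not_dvd_polys_lt) (auto simp: R_def)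
  have maps: "(\<lambda>r. a * r mod w) ` R \<subseteq> R"
  proof
    fix x assume "x \<in> (\<lambda>r. a * r mod w) ` R"
    then obtain r where r: "x = a * r mod w" "r \<in> R" by blast
    have "\<not> w dvd a * r" using False ndvd[OF r(2)] w by (simp add: prime_elem_dvd_mult_iff)
    then have "x \<noteq> 0" by (simp add: r dvd_eq_mod_eq_0)
    then show "x \<in> R" using degree_mod_less[OF w0, of "a * r"] r by (auto simp: R_def polys_lt_iff)
  qed
  have inj: "inj_on (\<lambda>r. a * r mod w) R"
  proof (rule inj_onI)
    fix r s assume rs: "r \<in> R" "s \<in> R" "a * r mod w = a * s mod w"
    then have "w dvd a * (r - s)" by (simp add: mod_eq_dvd_iff right_diff_distrib)
    then have "w dvd r - s" using False w by (simp add: prime_elem_dvd_mult_iff)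
    moreover have "r - s \<in> polys_lt (degree w)" using rs by (intro polys_lt_diff) (auto simp: R_def)
    ultimately show "r = s" using prime_elem_not_dvd_polys_lt[of "r - s" w] by auto
  qed
  have "(\<lambda>r. a * r mod w) ` R = R"
    using maps inj by (intro card_subset_eq[OF fin]) (simp_all add: card_image)
  then have "(\<Prod>r\<in>R. a * r mod w) = \<Prod>R"
    using prod.reindex[OF inj, of "\<lambda>x. x"] by simp
  then have "(\<Prod>r\<in>R. a * r) mod w = \<Prod>R mod w" by (metis mod_prod_eq)
  then have "w dvd (a ^ card R - 1) * \<Prod>R"
    by (simp add: prod.distrib mod_eq_dvd_iff left_diff_distrib)
  moreover have "\<not> w dvd \<Prod>R"
    using fin ndvd w by (induction R rule: finite_induct)
      (auto simp: prime_elem_dvd_mult_iff dest: prime_elem_not_unit)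
  ultimately have "w dvd a ^ card R - 1" using w by (simp add: prime_elem_dvd_mult_iff)
  then have "w dvd a * (a ^ card R - 1)" by simp
  also have "a * (a ^ card R - 1) = a ^ (CARD('f) ^ degree w) - a"
    unfolding card by (simp add: right_diff_distrib flip: power_Suc)
  finally show ?thesis .
qed

text \<open>
  Otherwise all \<open>q\<^sup>d\<close> residues, where \<open>d\<close> is the degree of the prime, would be roots of a polynomial
  of degree \<open>q\<^sup>i\<close>.
\<close>

lemma prime_not_dvd_X_power_q_minus_X:
  fixes w :: "'f::{field,finite} poly"
  assumes w: "prime_elem w" and char: "prime CHAR('f)" and q: "CARD('f) = CHAR('f) ^ e" and i: "i > 0" "i < degree w"
  shows "\<not> w dvd [:0, 1:] ^ (CARD('f) ^ i) - [:0, 1:]"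
proof
  define Q where "Q = CARD('f) ^ i"
  define X :: "'f poly" where "X = [:0, 1:]"
  assume "w dvd [:0, 1:] ^ (CARD('f) ^ i) - [:0, 1:]"
  then have dvd: "w dvd X ^ Q - X" by (simp add: X_def Q_def)
  have q1: "CARD('f) > 1" by (rule card_field_gt_1)
  have Q1: "Q > 1" unfolding Q_def using q1 i by (intro one_less_power) auto
  have Q: "Q = CHAR('f poly) ^ (e * i)" by (simp add: Q_def q power_mult)
  have c: "c ^ Q = c" for c :: 'f
    unfolding Q_def by (induction i) (simp_all add: power_mult finite_field_power_card)
  \<comment> \<open>Raising to the power \<open>Q\<close> is additive and fixes the constants, so
    the congruence spreads from the variable to every polynomial by Horner's scheme.\<close>
  have all: "w dvd a ^ Q - a" for a
  proof (induction a)
    case 0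
    then show ?case using Q1 by (simp add: power_0_left)
  next
    case (pCons c a)
    have eq: "pCons c a = [:c:] + X * a" by (simp add: X_def)
    have "([:c:] + X * a) ^ Q = [:c:] ^ Q + (X * a) ^ Q"
      using freshmans_dream'[of Q "e * i" "[:c:]" "X * a"] Q char by simp
    also have "[:c:] ^ Q = [:c:]" using c by (simp add: poly_const_pow)
    finally have "pCons c a ^ Q - pCons c a = (X ^ Q - X) * a ^ Q + X * (a ^ Q - a)"
      unfolding eq by (simp add: power_mult_distrib algebra_simps)
    then show ?case using dvd pCons by simp
  qed
  define f :: "'f poly poly" where "f = monom 1 Q - [:0, 1:]"
  have deg: "degree f = Q"
  proof -
    have "degree f = degree (monom (1 :: 'f poly) Q + - [:0, 1:])"
      by (simp only: f_def diff_conv_add_uminus)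
    also have "\<dots> = degree (monom (1 :: 'f poly) Q)"
      using Q1 by (intro degree_add_eq_left) (simp add: degree_monom_eq)
    also have "\<dots> = Q" by (simp add: degree_monom_eq)
    finally show ?thesis .
  qed
  have "card (polys_lt (degree w) :: 'f poly set) \<le> degree f"
  proof (rule card_roots_mod_prime_le[OF w])
    have "lead_coeff f = 1" unfolding deg using Q1 by (simp add: f_def coeff_pCons split: nat.splits)
    then show "\<not> w dvd lead_coeff f" using w by (simp add: prime_elem_not_unit)
    show "\<not> w dvd a - b" if "a \<in> polys_lt (degree w)" "b \<in> polys_lt (degree w)" "a \<noteq> b" for a b
      using that by (intro prime_elem_not_dvd_polys_lt polys_lt_diff) auto
    show "w dvd poly f a" for a using all[of a] by (simp add: f_def poly_monom)
  qed simp
  then have "CARD('f) ^ degree w \<le> CARD('f) ^ i" by (simp add: deg card_polys_lt Q_def)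
  from power_le_imp_le_exp[OF q1 this] show False using i by simp
qed

lemma freshmans_dream_diff:
  fixes x y :: "'a::comm_ring_1"
  assumes "prime CHAR('a)" "m = CHAR('a) ^ n"
  shows "(x - y) ^ m = x ^ m - y ^ m"
  using freshmans_dream'[OF assms, of "x - y" y] by (simp add: eq_diff_eq)

section \<open>Integrality of the Goss polynomials\<close>

text \<open>Uniqueness of power series coefficients for a pointwise limit of polynomials;
  \<open>L M\<close> is a length beyond which the \<open>M\<close>-th polynomial has no more terms.
  If all lower limits vanish, then \<open>|\<delta> j| |z|^j\<close> is at most the tail bound
  \<open>(S |z|)^(j+1)\<close>, which is uniform in \<open>M\<close>. Divide by \<open>|z|^j\<close>
  and let \<open>z\<close> shrink.\<close>

lemma coeff_limit_eq_0:
  fixes d :: "nat \<Rightarrow> nat \<Rightarrow> 'c::complete_nonarch_field"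
  assumes lim: "\<And>j. (\<lambda>M. d M j) \<longlonglongrightarrow> \<delta> j" and bound: "\<And>M j. abs_val (d M j) \<le> S ^ j" and S: "S > 0"
    and eval: "\<And>M N z. L M \<le> N \<Longrightarrow> (\<Sum>j<N. d M j * z ^ j) = v M z" "\<And>z. (\<lambda>M. v M z) \<longlonglongrightarrow> 0"
    and small: "\<And>\<epsilon>. \<epsilon> > 0 \<Longrightarrow> \<exists>z::'c. z \<noteq> 0 \<and> abs_val z < \<epsilon>"
  shows "\<delta> j = 0"
proof (induction j rule: less_induct)
  case (less j)
  have est: "abs_val (\<delta> j) \<le> S ^ Suc j * abs_val z" if z: "z \<noteq> 0" "S * abs_val z \<le> 1" for z :: 'c
  proof -
    have "(\<lambda>M. v M z - (\<Sum>i<j. d M i * z ^ i) - d M j * z ^ j) \<longlonglongrightarrow> 0 - (\<Sum>i<j. \<delta> i * z ^ i) - \<delta> j * z ^ j"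
      by (intro tendsto_diff_nonarch eval tendsto_sum tendsto_mult_nonarch lim tendsto_const)
    also have "0 - (\<Sum>i<j. \<delta> i * z ^ i) - \<delta> j * z ^ j = - (\<delta> j * z ^ j)" using less by simp
    finally have "abs_val (- (\<delta> j * z ^ j)) \<le> (S * abs_val z) ^ Suc j"
    proof (rule abs_val_limit_le[OF _ sequentially_bot], intro always_eventually allI)
      fix M
      define N where "N = L M + Suc j"
      have "(\<Sum>i=0..<Suc j. d M i * z ^ i) + (\<Sum>i=Suc j..<N. d M i * z ^ i) = (\<Sum>i=0..<N. d M i * z ^ i)"
        by (rule sum.atLeastLessThan_concat) (auto simp: N_def)
      also have "\<dots> = v M z"
        using eval(1)[of M N z] by (simp add: N_def lessThan_atLeast0)
      finally have "v M z = (\<Sum>i<Suc j. d M i * z ^ i) + (\<Sum>i=Suc j..<N. d M i * z ^ i)"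
        by (simp only: lessThan_atLeast0)
      then have "v M z - (\<Sum>i<j. d M i * z ^ i) - d M j * z ^ j = (\<Sum>i=Suc j..<N. d M i * z ^ i)"
        by simp
      also have "abs_val \<dots> \<le> (S * abs_val z) ^ Suc j"
      proof (rule abs_val_sum_le)
        fix i assume i: "i \<in> {Suc j..<N}"
        have "abs_val (d M i * z ^ i) \<le> S ^ i * abs_val z ^ i"
          unfolding abs_val_mult abs_val_power by (intro mult_right_mono bound) simp
        also have "\<dots> = (S * abs_val z) ^ i" by (simp add: power_mult_distrib)
        also have "\<dots> \<le> (S * abs_val z) ^ Suc j" using i z S by (intro power_decreasing) auto
        finally show "abs_val (d M i * z ^ i) \<le> (S * abs_val z) ^ Suc j" .
      qed (use S in simp)
      finally show "abs_val (v M z - (\<Sum>i<j. d M i * z ^ i) - d M j * z ^ j) \<le> (S * abs_val z) ^ Suc j" .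
    qed
    then have "abs_val (\<delta> j) * abs_val z ^ j \<le> S ^ Suc j * abs_val z * abs_val z ^ j"
      by (simp add: abs_val_mult abs_val_power power_mult_distrib mult_ac)
    then show ?thesis using z by simp
  qed
  show ?case
  proof (rule ccontr)
    assume "\<delta> j \<noteq> 0"
    then have "min (1 / S) (abs_val (\<delta> j) / S ^ Suc j) > 0" using S by simp
    from small[OF this]
    obtain z :: 'c where "z \<noteq> 0 \<and> abs_val z < min (1 / S) (abs_val (\<delta> j) / S ^ Suc j)" ..
    then have z: "z \<noteq> 0" and "abs_val z < 1 / S" "abs_val z < abs_val (\<delta> j) / S ^ Suc j" by simp_all
    then have "S * abs_val z \<le> 1" "S ^ Suc j * abs_val z < abs_val (\<delta> j)"
      using S by (simp_all add: field_simps)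
    then show False using est[OF z] by simp
  qed
qed

context carlitz begin

text \<open>Compare coefficients in the functional equation of \<open>ex\<close> at
  \<open>T\<close>. The finite stages satisfy it only approximately: \<open>v M\<close> is their
  defect, with coefficients \<open>d M\<close>, and it tends to zero pointwise.\<close>

lemma exp_coeff_recursion:
  assumes char: "prime CHAR('c)" and q: "q = CHAR('c) ^ e"
  shows "exp_coeff j * (T ^ j - T) = (if q dvd j then exp_coeff (j div q) ^ q else 0)"
proof -
  define d where "d M j = coeff (exp_lt M) j * T ^ j - T * coeff (exp_lt M) j
      - (if q dvd j then coeff (exp_lt M) (j div q) ^ q else 0)" for M j
  define \<delta> where "\<delta> j = exp_coeff j * T ^ j - T * exp_coeff j - (if q dvd j then exp_coeff (j div q) ^ q else 0)" for j
  define v where "v M z = poly (exp_lt M) (T * z) - T * poly (exp_lt M) z - poly (exp_lt M) z ^ q" for M z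
  \<comment> \<open>The maximum bounds the \<open>i\<close>-th coefficient of every
    \<open>exp_lt M\<close> by its \<open>i\<close>-th power; the factor \<open>q\<close> absorbs
    \<open>T^j\<close>.\<close>
  define S where "S = real q * max 1 (1 / abs_val \<omega>)"
  have S: "S \<ge> 1" unfolding S_def using q_gt_1 by (intro mult_ge1_I) auto
  have q0: "q > 0" using q_gt_1 by simp
  have "\<delta> j = 0"
  \<comment> \<open>The chosen \<open>L\<close> exceeds all exponents in \<open>v M\<close>,
    including those of the \<open>q\<close>-th power of \<open>exp_lt M\<close>.\<close>
  proof (rule coeff_limit_eq_0[where d = d and S = S and L = "\<lambda>M. q * Suc (degree (exp_lt M))" and v = v])
    show "(\<lambda>M. d M j) \<longlonglongrightarrow> \<delta> j" for j
      unfolding d_def \<delta>_def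
      by (cases "q dvd j") (simp_all, intro tendsto_diff_nonarch tendsto_mult_nonarch tendsto_power_nonarch
          exp_coeff_tendsto tendsto_const, intro tendsto_diff_nonarch tendsto_mult_nonarch exp_coeff_tendsto tendsto_const)
    show "abs_val (d M j) \<le> S ^ j" for M j
    proof -
      define s where "s = max 1 (1 / abs_val \<omega>)"
      have s: "s \<ge> 1" by (simp add: s_def)
      have co: "abs_val (coeff (exp_lt M) i) \<le> s ^ i" for i
      proof (cases i)
        case (Suc i')
        have "abs_val (coeff (exp_lt M) i) \<le> (1 / abs_val \<omega>) ^ i'" unfolding Suc by (rule abs_coeff_exp_lt)
        also have "\<dots> \<le> s ^ i'" by (intro power_mono) (auto simp: s_def)
        also have "\<dots> \<le> s ^ i" using s by (intro power_increasing) (auto simp: Suc)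
        finally show ?thesis .
      qed (simp add: exp_lt_def)
      have S': "S ^ j = s ^ j * real q ^ j" by (simp add: S_def s_def power_mult_distrib mult.commute)
      have qj: "real q ^ j \<ge> 1" using q_gt_1 by (intro one_le_power) auto
      have 1: "abs_val (coeff (exp_lt M) j * T ^ j) \<le> S ^ j"
        unfolding S' abs_val_mult abs_val_power abs_T by (intro mult_right_mono co) simp
      have 2: "abs_val (T * coeff (exp_lt M) j) \<le> S ^ j"
      proof (cases "j = 0")
        case True
        then show ?thesis by (simp add: exp_lt_def)
      next
        case False
        have "real q ^ 1 \<le> real q ^ j" using False q_gt_1 by (intro power_increasing) auto
        then have "real q * abs_val (coeff (exp_lt M) j) \<le> real q ^ j * s ^ j"
          using co[of j] by (intro mult_mono) auto
        then show ?thesis by (simp add: S' abs_val_mult abs_T mult.commute)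
      qed
      have 3: "abs_val (if q dvd j then coeff (exp_lt M) (j div q) ^ q else 0) \<le> S ^ j"
      proof (cases "q dvd j")
        case True
        have "abs_val (coeff (exp_lt M) (j div q)) ^ q \<le> (s ^ (j div q)) ^ q" by (intro power_mono co) simp
        also have "\<dots> = s ^ j" using True by (simp flip: power_mult)
        also have "\<dots> \<le> S ^ j" unfolding S' using qj s by (simp add: mult_ge1_I)
        finally show ?thesis using True by (simp add: abs_val_power)
      qed (use S in simp)
      show ?thesis unfolding d_def by (intro abs_val_diff_le 1 2 3)
    qed
    show "(\<Sum>j<N. d M j * z ^ j) = v M z" if N: "q * Suc (degree (exp_lt M)) \<le> N" for M N z
    proof -
      let ?E = "exp_lt M"
      have "Suc (degree ?E) \<le> q * Suc (degree ?E)"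
        using mult_le_mono1[of 1 q "Suc (degree ?E)"] q0 by simp
      then have dN: "degree ?E < N" using N by linarith
      have "poly ?E z ^ q = (\<Sum>i\<le>degree ?E. (coeff ?E i * z ^ i) ^ q)"
        unfolding poly_altdef by (rule freshmans_dream_sum'[OF char q])
      also have "\<dots> = (\<Sum>i\<le>degree ?E. coeff ?E i ^ q * z ^ (q * i))"
        by (simp add: power_mult_distrib mult.commute flip: power_mult)
      also have "\<dots> = (\<Sum>j\<in>(\<lambda>i. q * i) ` {..degree ?E}. coeff ?E (j div q) ^ q * z ^ j)"
        using q0 by (subst sum.reindex) (auto simp: inj_on_def)
      also have "\<dots> = (\<Sum>j<N. (if q dvd j then coeff ?E (j div q) ^ q else 0) * z ^ j)"
      proof (rule sum.mono_neutral_cong_left)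
        show "(\<lambda>i. q * i) ` {..degree ?E} \<subseteq> {..<N}"
        proof clarify
          fix i assume "i \<le> degree ?E"
          then have "q * i < q * Suc (degree ?E)" using q0 by (intro mult_less_mono2) auto
          then show "q * i < N" using N by linarith
        qed
        show "\<forall>j\<in>{..<N} - (\<lambda>i. q * i) ` {..degree ?E}. (if q dvd j then coeff ?E (j div q) ^ q else 0) * z ^ j = 0"
        proof
          fix j assume j: "j \<in> {..<N} - (\<lambda>i. q * i) ` {..degree ?E}"
          show "(if q dvd j then coeff ?E (j div q) ^ q else 0) * z ^ j = 0"
          proof (cases "q dvd j")
            case True
            then have "j = q * (j div q)" by simp
            then have "j div q > degree ?E" using j by (metis DiffD2 atMost_iff image_eqI not_less)
            then show ?thesis using q0 by (simp add: coeff_eq_0 power_0_left)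
          qed simp
        qed
      qed auto
      finally show ?thesis
        using poly_eq_sum_lessThan[OF dN, of "T * z"] poly_eq_sum_lessThan[OF dN, of z]
        by (simp add: v_def d_def left_diff_distrib sum_subtractf power_mult_distrib sum_distrib_left mult.assoc)
    qed
    show "(\<lambda>M. v M z) \<longlonglongrightarrow> 0" for z
    proof -
      have "(\<lambda>M. v M z) \<longlonglongrightarrow> ex (T * z) - T * ex z - ex z ^ q"
        unfolding v_def by (intro tendsto_diff_nonarch tendsto_mult_nonarch tendsto_power_nonarch exp_lt_tendsto tendsto_const)
      then show ?thesis by (simp add: ex_T)
    qed
    show "\<exists>z::'c. z \<noteq> 0 \<and> abs_val z < \<epsilon>" if "\<epsilon> > 0" for \<epsilon>
    proof -
      from ex_q_power_less[OF that] obtain N where "real q powi (- int N) < \<epsilon>" ..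
      then show ?thesis
        by (intro exI[of _ "inverse T ^ N"])
          (simp add: abs_val_power abs_val_inverse abs_T power_int_minus power_inverse)
    qed
  qed (use S in simp)
  then show ?thesis by (simp add: \<delta>_def algebra_simps)
qed

lemma exp_coeff_0: "exp_coeff 0 = 0"
proof (rule LIMSEQ_unique[OF exp_coeff_tendsto])
  show "(\<lambda>M. coeff (exp_lt M) 0) \<longlonglongrightarrow> 0" by (simp add: exp_lt_def)
qed

lemma exp_coeff_1: "exp_coeff 1 = 1"
proof (rule LIMSEQ_unique[OF exp_coeff_tendsto])
  show "(\<lambda>M. coeff (exp_lt M) 1) \<longlonglongrightarrow> 1" by (simp add: exp_lt_def)
qed

lemma T_power_minus_T_nonzero: "j > 1 \<Longrightarrow> T ^ j - T \<noteq> 0"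
proof
  assume j: "j > 1" and "T ^ j - T = 0"
  then have "abs_val (T ^ j) = abs_val T" by simp
  moreover have "real q ^ 1 < real q ^ j" using j q_gt_1 by (intro power_strict_increasing) auto
  ultimately show False by (simp add: abs_val_power abs_T)
qed

lemma exp_coeff_nonzero_imp_power:
  assumes char: "prime CHAR('c)" and q: "q = CHAR('c) ^ e"
  shows "exp_coeff j \<noteq> 0 \<Longrightarrow> \<exists>i. j = q ^ i"
proof (induction j rule: less_induct)
  case (less j)
  have "j \<noteq> 0" using less.prems exp_coeff_0 by metis
  then consider "j = 1" | "j > 1" by linarith
  then show ?case
  proof cases
    case 1
    then show ?thesis by (intro exI[of _ 0]) simp
  next
    case 2
    then have "exp_coeff j * (T ^ j - T) \<noteq> 0"
      using T_power_minus_T_nonzero[of j] less.prems by (simp only: mult_eq_0_iff) simp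
    then have *: "(if q dvd j then exp_coeff (j div q) ^ q else 0) \<noteq> 0"
      unfolding exp_coeff_recursion[OF char q] .
    then have dvd: "q dvd j" by (cases "q dvd j") simp_all
    have nz: "exp_coeff (j div q) \<noteq> 0" using * dvd q_gt_1 by (auto simp: power_0_left)
    have "j div q < j" using q_gt_1 2 by (intro div_less_dividend) auto
    from less.IH[OF this nz] obtain i where "j div q = q ^ i" ..
    then have "j = q ^ Suc i" using dvd by (metis dvd_mult_div_cancel power_Suc)
    then show ?thesis ..
  qed
qed

section \<open>The localization at a prime and the congruence\<close>

abbreviation ideal :: "'f poly \<Rightarrow> nat \<Rightarrow> 'c set" where "ideal \<equiv> local_ideal_power \<iota>"

lemma ideal_0: "prime_elem w \<Longrightarrow> 0 \<in> ideal w N"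
  unfolding local_ideal_power_def using prime_elem_not_unit[of w]
  by (intro CollectI exI[of _ 0] exI[of _ 1]) simp

lemma emb_in_ideal: "prime_elem w \<Longrightarrow> w ^ N dvd a \<Longrightarrow> emb a \<in> ideal w N"
proof -
  assume w: "prime_elem w" and "w ^ N dvd a"
  then obtain k where "a = w ^ N * k" by (auto elim: dvdE)
  then have "emb a = emb (w ^ N * k) / emb 1" by simp
  moreover have "\<not> w dvd 1" by (rule prime_elem_not_unit[OF w])
  ultimately show ?thesis unfolding local_ideal_power_def by blast
qed

lemma ideal_add:
  assumes w: "prime_elem w" and "x \<in> ideal w N" "y \<in> ideal w N"
  shows "x + y \<in> ideal w N"
proof -
  obtain a s b r where x: "x = emb (w ^ N * a) / emb s" "\<not> w dvd s" and y: "y = emb (w ^ N * b) / emb r" "\<not> w dvd r"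
    using assms unfolding local_ideal_power_def by blast
  have "s \<noteq> 0" "r \<noteq> 0" using x y by auto
  then have "x + y = emb (w ^ N * (a * r + b * s)) / emb (s * r)"
    by (simp add: x y emb_mult emb_add field_simps)
  moreover have "\<not> w dvd s * r" using x y w by (simp add: prime_elem_dvd_mult_iff)
  ultimately show ?thesis unfolding local_ideal_power_def by blast
qed

lemma ideal_mult:
  assumes w: "prime_elem w" and "x \<in> ideal w N" "y \<in> ideal w 0"
  shows "x * y \<in> ideal w N"
proof -
  obtain a s where x: "x = emb (w ^ N * a) / emb s" "\<not> w dvd s"
    using assms unfolding local_ideal_power_def by blast
  obtain b r where y: "y = emb b / emb r" "\<not> w dvd r"
    using assms unfolding local_ideal_power_def by auto
  have "x * y = emb (w ^ N * (a * b)) / emb (s * r)" by (simp add: x y emb_mult)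
  moreover have "\<not> w dvd s * r" using x y w by (simp add: prime_elem_dvd_mult_iff)
  ultimately show ?thesis unfolding local_ideal_power_def by blast
qed

lemma ideal_sum:
  "prime_elem w \<Longrightarrow> (\<And>i. i \<in> S \<Longrightarrow> f i \<in> ideal w N) \<Longrightarrow> (\<Sum>i\<in>S. f i) \<in> ideal w N"
  by (induction S rule: infinite_finite_induct) (auto intro: ideal_0 ideal_add)

lemma ideal_power: "prime_elem w \<Longrightarrow> x \<in> ideal w 0 \<Longrightarrow> x ^ m \<in> ideal w 0"
  using emb_in_ideal[of w 0 1] by (induction m) (auto intro: ideal_mult)

lemma exp_coeff_in_ideal:
  assumes w: "prime_elem w" and char: "prime CHAR('c)" and q: "q = CHAR('c) ^ e"
    and charf: "CHAR('f) = CHAR('c)" and j: "j < q ^ degree w"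
  shows "exp_coeff j \<in> ideal w 0"
proof (cases "exp_coeff j = 0")
  case True
  then show ?thesis using ideal_0[OF w] by simp
next
  case False
  then obtain i where i: "j = q ^ i" using exp_coeff_nonzero_imp_power[OF char q] by blast
  then have "i < degree w" using j q_gt_1 by (simp add: power_strict_increasing_iff)
  then have "exp_coeff (q ^ i) \<in> ideal w 0"
  proof (induction i)
    case 0
    then show ?case using emb_in_ideal[OF w, of 0 1] exp_coeff_1 by simp
  next
    case (Suc i)
    define X where "X = [:0, 1:] ^ (q ^ Suc i) - ([:0, 1:] :: 'f poly)"
    have ndvd: "\<not> w dvd X"
      using prime_not_dvd_X_power_q_minus_X[OF w, of e "Suc i"] char q charf Suc.prems by (simp add: X_def card_field)
    then have X0: "X \<noteq> 0" by auto
    have embX: "emb X = T ^ (q ^ Suc i) - T" by (simp add: X_def emb_diff emb_power emb_T)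
    have "exp_coeff (q ^ Suc i) * emb X = exp_coeff (q ^ i) ^ q"
      using exp_coeff_recursion[OF char q, of "q ^ Suc i"] q_gt_1 by (simp add: embX)
    then have "exp_coeff (q ^ Suc i) = exp_coeff (q ^ i) ^ q * (1 / emb X)"
      using X0 by (simp add: field_simps)
    moreover have "1 / emb X \<in> ideal w 0"
      unfolding local_ideal_power_def using ndvd by (intro CollectI exI[of _ 1] exI[of _ X]) simp
    ultimately show ?case
      using Suc by (simp only:) (intro ideal_mult ideal_power w, auto)
  qed
  then show ?thesis by (simp add: i)
qed

lemma coeff_goss_in_ideal:
  assumes w: "prime_elem w" and \<alpha>: "\<And>i. i < n \<Longrightarrow> \<alpha> i \<in> ideal w 0"
  shows "coeff (goss \<alpha> n) j \<in> ideal w 0"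
  using \<alpha>
proof (induction n arbitrary: j rule: less_induct)
  case (less n)
  have one: "1 \<in> ideal w 0" using emb_in_ideal[OF w, of 0 1] by simp
  show ?case
  proof (cases j)
    case (Suc i)
    have "coeff (if n = 1 then 1 else 0) i \<in> ideal w 0"
      using one ideal_0[OF w] by (auto simp: one_pCons coeff_pCons split: nat.splits)
    moreover have "(\<Sum>l\<in>{1..<n}. \<alpha> l * coeff (goss \<alpha> (n - l)) i) \<in> ideal w 0"
      using less by (intro ideal_sum ideal_mult w) auto
    ultimately show ?thesis
      unfolding Suc by (subst goss.simps) (simp only: coeff_pCons_Suc coeff_add coeff_sum coeff_smult ideal_add[OF w])
  qed (simp add: ideal_0[OF w])
qed

lemma tame_in_ideal: "prime_elem w \<Longrightarrow> tame f \<Longrightarrow> fps_nth f j \<in> ideal w 0"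
  unfolding tame_def using emb_in_ideal[of w 0] by (metis dvd_0_left_iff one_dvd power_0)

text \<open>The two coefficients share the Goss polynomial and the series \<open>t_fps a\<close>,
  all integral at \<open>w\<close>. The difference therefore sits entirely in
  \<open>a^K - a^K'\<close>.\<close>

lemma A_exp_coeff_diff_in_ideal:
  assumes w: "prime_elem w" and char: "prime CHAR('c)" and q: "q = CHAR('c) ^ e"
    and charf: "CHAR('f) = CHAR('c)" and n: "n < q ^ degree w"
    and dvd: "\<And>a. w ^ N dvd a ^ K - a ^ K'"
  shows "A_exp_coeff K n j - A_exp_coeff K' n j \<in> ideal w N"
proof -
  have "A_exp_coeff K n j - A_exp_coeff K' n j
      = (\<Sum>a\<in>polys_lt j \<inter> monic. emb (a ^ K - a ^ K') * (\<Sum>i\<le>n. coeff (G n) i * fps_nth (t_fps a ^ i) j))"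
    by (simp add: A_exp_coeff_def emb_diff emb_power left_diff_distrib sum_subtractf)
  also have "\<dots> \<in> ideal w N"
  proof (intro ideal_sum ideal_mult w emb_in_ideal dvd coeff_goss_in_ideal)
    fix i assume "i < n"
    then show "exp_coeff i \<in> ideal w 0" using n by (intro exp_coeff_in_ideal[OF w char q charf]) simp
  next
    fix a i assume "a \<in> polys_lt j \<inter> monic"
    then have "tame (t_fps a)"
      using someI_ex[OF exists_t_expansion_t[OF char q, of a]] unfolding t_fps_def by blast
    then show "fps_nth (t_fps a ^ i) j \<in> ideal w 0" by (intro tame_in_ideal w tame_power)
  qed
  finally show ?thesis .
qed

lemma has_t_expansion_diff:
  assumes "has_t_expansion \<iota> \<omega> F c" "has_t_expansion \<iota> \<omega> F' c'"
  shows "has_t_expansion \<iota> \<omega> (\<lambda>z. F z - F' z) (c - c')"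
proof -
  obtain R R' where R: "R > 0" "\<And>z. im z \<ge> R \<Longrightarrow> (\<lambda>j. fps_nth c j * t z ^ j) sums F z"
    and R': "R' > 0" "\<And>z. im z \<ge> R' \<Longrightarrow> (\<lambda>j. fps_nth c' j * t z ^ j) sums F' z"
    using assms unfolding has_t_expansion_def by blast
  have "(\<lambda>j. fps_nth (c - c') j * t z ^ j) sums (F z - F' z)" if "im z \<ge> max R R'" for z
    using tendsto_diff_nonarch[OF R(2)[of z, unfolded sums_def] R'(2)[of z, unfolded sums_def]] that
    by (simp add: sums_def left_diff_distrib sum_subtractf)
  then show ?thesis unfolding has_t_expansion_def using R(1) by (intro exI[of _ "max R R'"]) auto
qed

lemma A_exp_congruence:
  assumes w: "prime_elem w" and char: "prime CHAR('c)" and q: "q = CHAR('c) ^ e"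
    and charf: "CHAR('f) = CHAR('c)" and n: "n < q ^ degree w"
    and dvd: "\<And>a. w ^ N dvd a ^ K - a ^ K'"
  shows "form_cong \<iota> \<omega> w N (A_exp K n) (A_exp K' n)"
  unfolding form_cong_def
proof (intro exI conjI allI)
  show "has_t_expansion \<iota> \<omega> (\<lambda>z. A_exp K n z - A_exp K' n z) (Abs_fps (A_exp_coeff K n) - Abs_fps (A_exp_coeff K' n))"
    by (intro has_t_expansion_diff A_exp_has_t_expansion[OF char q])
  show "fps_nth (Abs_fps (A_exp_coeff K n) - Abs_fps (A_exp_coeff K' n)) j \<in> ideal w N" for j
    using A_exp_coeff_diff_in_ideal[OF w char q charf n dvd, of j] by simp
qed

end

lemma CHAR_eq_prime:
  assumes "prime p" "of_nat p = (0 :: 'a::idom)"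
  shows "CHAR('a) = p"
proof -
  have "CHAR('a) dvd p" using assms(2) by (simp add: of_nat_eq_0_iff_char_dvd)
  moreover have "CHAR('a) \<noteq> 1" by simp
  ultimately show ?thesis using assms(1) by (meson prime_nat_iff)
qed

theorem theorem3p10:
  fixes \<iota> :: "'f::{field,finite} fls \<Rightarrow> 'c::complete_nonarch_field"
    and \<omega> :: 'c
    and p e q k n \<nu>\<^sub>0 :: nat
  assumes "prime p" and "q = p ^ e" and "CARD('f) = q"
    and "is_C_infinity \<iota>"
    and "carlitz_period \<iota> \<omega>"
    and "k > 0" and "n > 0"
    and "\<exists>j>0. int k - 2 * int n = int j * (int q - 1)"
    and "n \<le> p ^ multiplicity p (k - n)"
    and "\<nu>\<^sub>0 = multiplicity p (k - n)"
  shows "(\<forall>l m. [m = int n] (mod (int q - 1)) \<longrightarrow>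
            F_form \<iota> \<omega> k n l \<in> cusp_forms \<iota> \<omega> ((k - n) * q ^ l + n) m) \<and>
         (\<forall>(\<nu> :: nat) (d :: nat) (wp :: 'f poly).
            prime_elem wp \<and> degree wp = d \<and> real d > log (real q) (real n) \<longrightarrow>
            form_cong \<iota> \<omega> wp (q ^ \<nu> * p ^ \<nu>\<^sub>0) (F_form \<iota> \<omega> k n (d + \<nu>)) (F_form \<iota> \<omega> k n \<nu>))"
proof -
  interpret carlitz \<iota> q \<omega>
    by unfold_locales (fact assms)+
  have "of_nat p ^ e = (0::'c)" using of_nat_q assms(2) by simp
  then have char_c: "CHAR('c) = p" by (intro CHAR_eq_prime assms(1)) simp
  have "of_nat p ^ e = (0::'f)"
    using of_nat_card_finite_field[where 'f = 'f] assms(2,3) by simp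
  then have char_f: "CHAR('f) = p" by (intro CHAR_eq_prime assms(1)) simp
  have char: "prime CHAR('c)" and q: "q = CHAR('c) ^ e" and charf: "CHAR('f) = CHAR('c)"
    using assms(1,2) char_c char_f by auto
  have F: "F_form \<iota> \<omega> k n l = A_exp ((k - n) * q ^ l) n" for l
    using F_form_eq_A_exp[OF assms(7)] by auto
  obtain i where i: "i > 0" "int k - 2 * int n = int i * (int q - 1)" using assms(8) by blast
  then have "int k = int (2 * n + i * (q - 1))" using q_gt_1 by (simp add: of_nat_diff)
  then have k: "k = 2 * n + i * (q - 1)" by (simp only: of_nat_eq_iff)
  \<comment> \<open>\<open>k - n = n + i (q - 1)\<close>, and \<open>i (q - 1)\<close> is positive.
    The strict inequality enters the inversion through \<open>n < K\<close>.\<close>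
  have kn: "k - n > n" using k i(1) q_gt_1 by simp
  obtain r where r: "k - n = p ^ \<nu>\<^sub>0 * r" using multiplicity_dvd[of p "k - n"] assms(10) by (auto elim: dvdE)
  have cusp: "F_form \<iota> \<omega> k n l \<in> cusp_forms \<iota> \<omega> ((k - n) * q ^ l + n) m" if m: "[m = int n] (mod (int q - 1))" for l m
    unfolding F
  proof (rule A_exp_cusp_form[OF char q _ _ assms(7) _ _ _ m])
    show "p ^ \<nu>\<^sub>0 = CHAR('c) ^ \<nu>\<^sub>0" by (simp add: char_c)
    show "(k - n) * q ^ l = p ^ \<nu>\<^sub>0 * (r * q ^ l)" by (simp add: r)
    show "n \<le> p ^ \<nu>\<^sub>0" using assms(9,10) by simp
    have le: "k - n \<le> (k - n) * q ^ l" using q_gt_1 by simp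
    then show "n < (k - n) * q ^ l" using kn by linarith
    have "q - 1 dvd q ^ l - 1" using power_diff_1_eq[of "int q" l]
      by (metis dvd_def nat_power_eq of_nat_1 of_nat_dvd_iff of_nat_diff of_nat_power one_le_power q_gt_1 less_imp_le)
    \<comment> \<open>With \<open>K = (k - n) q^l\<close>, the difference \<open>K - n\<close> is
      \<open>(k - n) (q^l - 1)\<close> plus \<open>k - 2 n\<close>, and the latter is
      \<open>i (q - 1)\<close>.\<close>
    then have "q - 1 dvd (k - n) * (q ^ l - 1) + i * (q - 1)" by simp
    also have "(k - n) * (q ^ l - 1) + i * (q - 1) = (k - n) * q ^ l - n"
      using le kn k by (simp add: diff_mult_distrib2)
    finally show "q - 1 dvd (k - n) * q ^ l - n" .
  qed
  have cong: "form_cong \<iota> \<omega> wp (q ^ \<nu> * p ^ \<nu>\<^sub>0) (F_form \<iota> \<omega> k n (d + \<nu>)) (F_form \<iota> \<omega> k n \<nu>)"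
    if wp: "prime_elem wp" "degree wp = d" "real d > log (real q) (real n)" for \<nu> d :: nat and wp :: "'f poly"
    unfolding F
  proof (rule A_exp_congruence[OF wp(1) char q charf])
    have "real n < real q powr real d" using wp(3) q_gt_1 assms(7) by (simp add: log_less_iff)
    then have "real n < real (q ^ d)" using q_gt_1 by (simp add: powr_realpow)
    then show "n < q ^ degree wp" unfolding wp(2) by (simp only: of_nat_less_iff)
    fix a :: "'f poly"
    \<comment> \<open>The two exponents are \<open>N r q^d\<close> and \<open>N r\<close>, and
      \<open>N\<close> is a power of the characteristic. Hence the difference of powers of
      \<open>a\<close> is the \<open>N\<close>-th power of \<open>(a^r)^(q^d) - a^r\<close>, and
      each factor contributes one \<open>wp\<close>.\<close>
    define N where "N = q ^ \<nu> * p ^ \<nu>\<^sub>0"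
    have N: "N = CHAR('f poly) ^ (e * \<nu> + \<nu>\<^sub>0)" by (simp add: N_def char_f assms(2) power_add power_mult)
    have "wp dvd (a ^ r) ^ (q ^ d) - a ^ r" using poly_fermat[OF wp(1), of "a ^ r"] by (simp add: card_field wp(2))
    then have "wp ^ N dvd ((a ^ r) ^ (q ^ d) - a ^ r) ^ N" by (rule dvd_power_same)
    also have "\<dots> = ((a ^ r) ^ (q ^ d)) ^ N - (a ^ r) ^ N"
      using assms(1) char_f N by (intro freshmans_dream_diff) simp_all
    also have "\<dots> = a ^ ((k - n) * q ^ (d + \<nu>)) - a ^ ((k - n) * q ^ \<nu>)"
      by (simp add: r N_def power_add mult_ac flip: power_mult)
    finally show "wp ^ (q ^ \<nu> * p ^ \<nu>\<^sub>0) dvd a ^ ((k - n) * q ^ (d + \<nu>)) - a ^ ((k - n) * q ^ \<nu>)"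
      by (simp add: N_def)
  qed
  show ?thesis using cusp cong by blast
qed

end
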